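(* Let $d\ge2$, let $N$ be a positive integer, fix $\xi\in\mathbb S^{d-1}$ and $p_0,p_1,\dots,p_N\in[0,1]$ satisfying $\sum_{i=0}^Np_i=1$. For Lebesgue-almost every $(t_1,\dots,t_N)\in(0,\infty)^N$, we have $$p_0\delta_0+\sum_{i=1}^Np_i\delta_{t_i}\in\mathscr P_{\mathrm{emp}}(\xi)\cap\mathscr P^\infty_{\mathrm{emp}}(\xi).$$
   Context: $\mathscr P$ is the set of Borel probability measures on $[0,\infty)$; $\mathbb S^{d-1}$ is the Euclidean unit sphere in $\mathbb R^d$; $\Rightarrow$ is weak convergence. First-passage percolation on $\mathbb Z^d$, $d\ge2$, with edge-weight law $\mathcal L\in\mathscr P$: $(\tau_e)_{e\in E(\mathbb Z^d)}$ are i.i.d. with law $\mathcal L$, indexed by undirected nearest-neighbor edges, on a complete probability space; $F(t)=\mathbb P(\tau_e\le t)$. $p_{\mathrm c}(\mathbb Z^d)$ is the critical probability of Bernoulli bond percolation. For $x\in\mathbb R^d$, $[x]\in\mathbb Z^d$ is the unique integer point with $x\in[x]+[0,1)^d$. $\mathcal P(x,y)$ is the set of self-avoiding nearest-neighbor paths (viewed as edge sets) from $[x]$ to $[y]$, $T(\gamma)=\sum_{e\in\gamma}\tau_e$, $T(x,y)=\inf_{\mathcal P(x,y)}T(\gamma)$, $\mathrm{Geo}(x,y)=\{\gamma\in\mathcal P(x,y):T(\gamma)=T(x,y)\}$. An infinite path $\Gamma=\{e_1,e_2,\dots\}$ visiting vertices $x_0,x_1,\dots$ in order is an infinite geodesic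 if every $\Gamma^{(\ell)}=\{e_1,\dots,e_\ell\}$ is a finite geodesic; $\mathrm{Geo}_\infty(\xi)$ is the set of those with $x_\ell/\|x_\ell\|_2\to\xi$. For a finite path $\gamma$, $\hat\nu^+_\gamma=\frac1{|\{e\in\gamma:\tau_e\ne0\}|}\sum_{e\in\gamma:\tau_e\ne0}\delta_{\tau_e}$ (the zero measure if all weights on $\gamma$ vanish). Definition of $\mathscr P_{\mathrm{emp}}(\xi)$: $\mathcal L\in\mathscr P_{\mathrm{emp}}(\xi)$ if either $F(0)\ge p_{\mathrm c}(\mathbb Z^d)$, or $F(0)<p_{\mathrm c}(\mathbb Z^d)$ and there is a deterministic $\hat\nu^+\in\mathscr P$ such that almost surely $\hat\nu^+_{\gamma_n}\Rightarrow\hat\nu^+$ as $n\to\infty$ (along real $n$) for any choice of $\gamma_n\in\mathrm{Geo}(0,n\xi)$. Definition of $\mathscr P^\infty_{\mathrm{emp}}(\xi)$: $\mathcal L\in\mathscr P^\infty_{\mathrm{emp}}(\xi)$ if either $F(0)\ge p_{\mathrm c}(\mathbb Z^d)$, or $F(0)<p_{\mathrm c}(\mathbb Z^d)$ and there is a deterministic $\hat\nu^+_\infty\in\mathscr P$ such that almost surely $\hat\nu^+_{\Gamma^{(\ell)}}\Rightarrow\hat\nu^+_\infty$ as $\ell\to\infty$ for every $\Gamma\in\mathrm{Geo}_\infty(\xi)$. *)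

theory Defs
  imports "HOL-Probability.Probability"
begin

section \<open>Measures on the half-line and weak convergence\<close>

text \<open>Borel probability measures on $[0,\infty)$, as Borel probability measures on the real line
  that are concentrated on $[0,\infty)$.\<close>

definition nonneg_laws :: "real measure set" where
  "nonneg_laws = {L. real_distribution L \<and> (AE x in L. 0 \<le> x)}"

text \<open>The constant \<^const>\<open>weak_conv_m\<close> is restricted to sequences indexed by the naturals; here the
  index runs along an arbitrary filter, and the approximating measures may be the zero measure.\<close>

definition weak_conv_along ::
    "('i \<Rightarrow> real measure) \<Rightarrow> real measure \<Rightarrow> 'i filter \<Rightarrow> bool" where
  "weak_conv_along \<mu> \<nu> F \<longleftrightarrow>
     (\<forall>f :: real \<Rightarrow> real. continuous_on UNIV f \<and> bounded (range f) \<longrightarrow>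
        ((\<lambda>i. integral\<^sup>L (\<mu> i) f) \<longlongrightarrow> integral\<^sup>L \<nu> f) F)"

lemma weak_conv_along_sequentially_iff:
  assumes \<mu>: "\<And>n. real_distribution (\<mu> n)" and \<nu>: "real_distribution \<nu>"
  shows "weak_conv_along \<mu> \<nu> sequentially \<longleftrightarrow> weak_conv_m \<mu> \<nu>"
proof
  assume w: "weak_conv_along \<mu> \<nu> sequentially"
  show "weak_conv_m \<mu> \<nu>"
  proof (rule integral_bdd_continuous_conv_imp_weak_conv[OF \<mu> \<nu>])
    fix f :: "real \<Rightarrow> real"
    assume f: "\<And>x. isCont f x" and B: "\<And>x. \<bar>f x\<bar> \<le> 1"
    have "continuous_on UNIV f" using f by (simp add: continuous_at_imp_continuous_on)
    moreover have "bounded (range f)" using B by (auto simp: bounded_iff)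
    ultimately show "(\<lambda>n. integral\<^sup>L (\<mu> n) f) \<longlonglongrightarrow> integral\<^sup>L \<nu> f"
      using w by (auto simp: weak_conv_along_def)
  qed
next
  assume w: "weak_conv_m \<mu> \<nu>"
  show "weak_conv_along \<mu> \<nu> sequentially"
    unfolding weak_conv_along_def
  proof (intro allI impI)
    fix f :: "real \<Rightarrow> real"
    assume f: "continuous_on UNIV f \<and> bounded (range f)"
    then obtain B where B: "\<And>x. norm (f x) \<le> B" by (auto simp: bounded_iff)
    have "\<And>x. isCont f x" using f by (simp add: continuous_on_eq_continuous_at)
    from weak_conv_imp_integral_bdd_continuous_conv[OF \<mu> \<nu> w this B]
    show "(\<lambda>n. integral\<^sup>L (\<mu> n) f) \<longlonglongrightarrow> integral\<^sup>L \<nu> f" .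
  qed
qed

text \<open>For a finite set $I$, the measure $\sum_{i \in I} w_i \delta_{a_i}$.\<close>

definition weighted_atoms :: "'i set \<Rightarrow> ('i \<Rightarrow> real) \<Rightarrow> ('i \<Rightarrow> real) \<Rightarrow> real measure" where
  "weighted_atoms I w a = distr (point_measure I (\<lambda>i. ennreal (w i))) borel a"

lemma sets_weighted_atoms [simp]: "sets (weighted_atoms I w a) = sets borel"
  by (simp add: weighted_atoms_def)

lemma emeasure_weighted_atoms:
  assumes "finite I" and "B \<in> sets borel"
  shows "emeasure (weighted_atoms I w a) B =
         (\<Sum>i\<in>I. ennreal (w i) * emeasure (return borel (a i)) B)"
proof -
  have "emeasure (weighted_atoms I w a) B =
        emeasure (point_measure I (\<lambda>i. ennreal (w i))) (a -` B \<inter> I)"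
    using assms by (simp add: weighted_atoms_def emeasure_distr space_point_measure)
  also have "\<dots> = (\<Sum>i\<in>a -` B \<inter> I. ennreal (w i))"
    using assms by (simp add: emeasure_point_measure_finite)
  also have "\<dots> = (\<Sum>i\<in>I. ennreal (w i) * emeasure (return borel (a i)) B)"
    using assms by (intro sum.mono_neutral_cong_left) (auto simp: indicator_def)
  finally show ?thesis .
qed

section \<open>The lattice and Bernoulli bond percolation\<close>

type_synonym 'd vertex = "(int, 'd) vec"
type_synonym 'd edge = "'d vertex set"

definition lattice_edges :: "'d::finite edge set" where
  "lattice_edges = {{u, v} | u v. (\<Sum>i\<in>UNIV. \<bar>u $ i - v $ i\<bar>) = 1}"

definition open_cluster :: "('d::finite edge \<Rightarrow> bool) \<Rightarrow> 'd vertex \<Rightarrow> 'd vertex set" where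
  "open_cluster \<omega> x = {y. (x, y) \<in> {(u, v). {u, v} \<in> lattice_edges \<and> \<omega> {u, v}}\<^sup>*}"

definition percolation_space :: "real \<Rightarrow> ('d::finite edge \<Rightarrow> bool) measure" where
  "percolation_space q = (\<Pi>\<^sub>M e\<in>lattice_edges. measure_pmf (bernoulli_pmf q))"

definition percolation_prob :: "'d::finite itself \<Rightarrow> real \<Rightarrow> real" where
  "percolation_prob (_ :: 'd itself) q =
     measure (percolation_space q)
       {\<omega> \<in> space (percolation_space q). infinite (open_cluster \<omega> (0 :: 'd vertex))}"

definition critical_prob :: "'d::finite itself \<Rightarrow> real" where
  "critical_prob d = Inf {q \<in> {0..1}. percolation_prob d q > 0}"

section \<open>Paths and geodesics\<close>

definition lattice_point :: "real ^ 'd::finite \<Rightarrow> 'd vertex" where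
  "lattice_point x = (\<chi> i. \<lfloor>x $ i\<rfloor>)"

lemma lattice_point_unique:
  "lattice_point x = z \<longleftrightarrow> (\<forall>i. x $ i - of_int (z $ i) \<in> {0..<1})"
  by (auto simp: lattice_point_def vec_eq_iff floor_eq_iff algebra_simps)

definition real_vec :: "'d::finite vertex \<Rightarrow> real ^ 'd" where
  "real_vec z = (\<chi> i. of_int (z $ i))"

text \<open>A path is an edge set. The one-vertex list gives the empty path from a vertex to itself.\<close>

definition paths_between :: "'d::finite vertex \<Rightarrow> 'd vertex \<Rightarrow> 'd edge set set" where
  "paths_between u v =
     {{{xs ! i, xs ! Suc i} | i. Suc i < length xs} | xs.
        xs \<noteq> [] \<and> hd xs = u \<and> last xs = v \<and> distinct xs \<and>
        (\<forall>i. Suc i < length xs \<longrightarrow> {xs ! i, xs ! Suc i} \<in> lattice_edges)}"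

definition paths :: "real ^ 'd::finite \<Rightarrow> real ^ 'd \<Rightarrow> 'd edge set set" where
  "paths x y = paths_between (lattice_point x) (lattice_point y)"

definition path_time :: "('d::finite edge \<Rightarrow> real) \<Rightarrow> 'd edge set \<Rightarrow> real" where
  "path_time \<tau> \<gamma> = (\<Sum>e\<in>\<gamma>. \<tau> e)"

definition passage_time :: "('d::finite edge \<Rightarrow> real) \<Rightarrow> real ^ 'd \<Rightarrow> real ^ 'd \<Rightarrow> real" where
  "passage_time \<tau> x y = (INF \<gamma>\<in>paths x y. path_time \<tau> \<gamma>)"

definition Geo :: "('d::finite edge \<Rightarrow> real) \<Rightarrow> real ^ 'd \<Rightarrow> real ^ 'd \<Rightarrow> 'd edge set set" where
  "Geo \<tau> x y = {\<gamma> \<in> paths x y. path_time \<tau> \<gamma> = passage_time \<tau> x y}"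

text \<open>An infinite path is given by the sequence $x_0, x_1, \dots$ of vertices it visits; the starting
  vertex is arbitrary. The edge set of its first $\ell$ steps:\<close>

definition initial_segment :: "(nat \<Rightarrow> 'd::finite vertex) \<Rightarrow> nat \<Rightarrow> 'd edge set" where
  "initial_segment x l = {{x i, x (Suc i)} | i. i < l}"

definition infinite_geodesic :: "('d::finite edge \<Rightarrow> real) \<Rightarrow> (nat \<Rightarrow> 'd vertex) \<Rightarrow> bool" where
  "infinite_geodesic \<tau> x \<longleftrightarrow>
     inj x \<and> (\<forall>i. {x i, x (Suc i)} \<in> lattice_edges) \<and>
     (\<forall>l. initial_segment x l \<in> Geo \<tau> (real_vec (x 0)) (real_vec (x l)))"

definition Geo_inf ::
    "('d::finite edge \<Rightarrow> real) \<Rightarrow> real ^ 'd \<Rightarrow> (nat \<Rightarrow> 'd vertex) set" where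
  "Geo_inf \<tau> \<xi> =
     {x. infinite_geodesic \<tau> x \<and>
         (\<lambda>l. real_vec (x l) /\<^sub>R norm (real_vec (x l))) \<longlonglongrightarrow> \<xi>}"

section \<open>Empirical measures\<close>

text \<open>The empirical measure of the nonzero weights: the push-forward under the weights of the
  uniform distribution on the edges of nonzero weight. It is the zero measure if there are none.\<close>

definition emp_pos :: "('d::finite edge \<Rightarrow> real) \<Rightarrow> 'd edge set \<Rightarrow> real measure" where
  "emp_pos \<tau> \<gamma> =
     (let A = {e \<in> \<gamma>. \<tau> e \<noteq> 0} in weighted_atoms A (\<lambda>_. 1 / real (card A)) \<tau>)"

lemma emp_pos_zero:
  assumes "\<And>e. e \<in> \<gamma> \<Longrightarrow> \<tau> e = 0"
  shows "emp_pos \<tau> \<gamma> = null_measure borel"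
proof (rule measure_eqI)
  have A: "{e \<in> \<gamma>. \<tau> e \<noteq> 0} = {}" using assms by auto
  show "sets (emp_pos \<tau> \<gamma>) = sets (null_measure borel)"
    by (simp add: emp_pos_def Let_def)
  fix B assume "B \<in> sets (emp_pos \<tau> \<gamma>)"
  then show "emeasure (emp_pos \<tau> \<gamma>) B = emeasure (null_measure borel) B"
    unfolding emp_pos_def Let_def A by (simp add: emeasure_weighted_atoms)
qed

section \<open>First-passage percolation\<close>

text \<open>The weights are realised as the coordinates of the completed product space. The lemma below
  shows that almost sure properties of this model hold for every i.i.d. family with the same law.\<close>

definition fpp_space :: "real measure \<Rightarrow> ('d::finite edge \<Rightarrow> real) measure" where
  "fpp_space L = completion (\<Pi>\<^sub>M e\<in>lattice_edges. L)"

lemma lattice_edges_nonempty: "(lattice_edges :: 'd::finite edge set) \<noteq> {}"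
proof -
  obtain k :: 'd where True by simp
  have "(\<Sum>i\<in>UNIV. \<bar>(axis k 1 :: 'd vertex) $ i - (0 :: 'd vertex) $ i\<bar>) = 1"
    by (simp add: axis_def if_distrib[of abs] cong: if_cong)
  then show ?thesis unfolding lattice_edges_def by blast
qed

lemma AE_fpp_space_transfer:
  fixes Q :: "('d::finite edge \<Rightarrow> real) \<Rightarrow> bool"
  assumes L: "real_distribution L"
    and Q: "AE \<omega> in fpp_space L. Q \<omega>"
    and M: "prob_space M"
    and indep: "prob_space.indep_vars M (\<lambda>_. borel) \<tau> lattice_edges"
    and law: "\<And>e. e \<in> lattice_edges \<Longrightarrow> distr M borel (\<tau> e) = L"
  shows "AE w in M. Q (\<lambda>e\<in>lattice_edges. \<tau> e w)"
proof -
  interpret M: prob_space M by (rule M)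
  interpret L: real_distribution L by (rule L)
  have rv: "\<tau> e \<in> borel_measurable M" if "e \<in> lattice_edges" for e
    using indep that by (auto simp: M.indep_vars_def2)
  have "distr M (\<Pi>\<^sub>M e\<in>lattice_edges. borel) (\<lambda>w. \<lambda>e\<in>lattice_edges. \<tau> e w) =
        (\<Pi>\<^sub>M e\<in>lattice_edges. distr M borel (\<tau> e))"
    using M.indep_vars_iff_distr_eq_PiM'[where X = \<tau>, OF lattice_edges_nonempty rv] indep by simp
  also have "\<dots> = (\<Pi>\<^sub>M e\<in>lattice_edges. L)"
    by (intro PiM_cong) (simp_all add: law)
  finally have d: "distr M (\<Pi>\<^sub>M e\<in>lattice_edges. borel) (\<lambda>w. \<lambda>e\<in>lattice_edges. \<tau> e w) =
    (\<Pi>\<^sub>M e\<in>lattice_edges. L)" .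
  have meas: "(\<lambda>w. \<lambda>e\<in>lattice_edges. \<tau> e w) \<in> measurable M (\<Pi>\<^sub>M e\<in>lattice_edges. borel)"
    using rv by (intro measurable_restrict) auto
  have "AE \<omega> in distr M (\<Pi>\<^sub>M e\<in>lattice_edges. borel) (\<lambda>w. \<lambda>e\<in>lattice_edges. \<tau> e w). Q \<omega>"
    using Q unfolding d fpp_space_def by (simp add: AE_completion_iff)
  from AE_distrD[OF meas this] show ?thesis .
qed

definition P_emp :: "real ^ 'd::finite \<Rightarrow> real measure set" where
  "P_emp \<xi> = {L \<in> nonneg_laws.
     cdf L 0 \<ge> critical_prob TYPE('d) \<or>
     (cdf L 0 < critical_prob TYPE('d) \<and>
      (\<exists>\<nu>\<in>nonneg_laws.
        AE \<tau> in fpp_space L.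
          \<forall>\<gamma> :: real \<Rightarrow> 'd edge set.
            (\<forall>n>0. \<gamma> n \<in> Geo \<tau> 0 (n *\<^sub>R \<xi>)) \<longrightarrow>
            weak_conv_along (\<lambda>n. emp_pos \<tau> (\<gamma> n)) \<nu> at_top))}"

definition P_emp_inf :: "real ^ 'd::finite \<Rightarrow> real measure set" where
  "P_emp_inf \<xi> = {L \<in> nonneg_laws.
     cdf L 0 \<ge> critical_prob TYPE('d) \<or>
     (cdf L 0 < critical_prob TYPE('d) \<and>
      (\<exists>\<nu>\<in>nonneg_laws.
        AE \<tau> in fpp_space L.
          \<forall>\<Gamma>\<in>Geo_inf \<tau> \<xi>.
            weak_conv_along (\<lambda>l. emp_pos \<tau> (initial_segment \<Gamma> l)) \<nu> sequentially))}"

end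

theory Submission
  imports Defs
begin

text \<open>Give every edge an i.i.d. type in \<open>{0..N}\<close> and the weight \<open>t\<close> of its type. The passage time of a
  path is then linear in \<open>t\<close> with the type counts as coefficients, so the time constant \<open>\<mu>(t)\<close> in
  direction \<open>\<xi>\<close> is concave in \<open>t\<close> and, coordinate by coordinate, differentiable for almost every \<open>t\<close>.
  Perturbing \<open>t\<close> in one coordinate by \<open>\<plusminus>s\<close> and using a geodesic for \<open>t\<close> as a competitor squeezes its
  number of edges of that type, divided by the distance, between the two difference quotients of
  \<open>\<mu>\<close>; letting \<open>s\<close> tend to 0 identifies the limit as the partial derivative. The limiting counts are
  not all zero because \<open>\<mu>(t) > 0\<close> below \<open>p\<^sub>c\<close>, which is deduced, by sprinkling, from
  the sharpness theorem in the form of Duminil-Copin and Tassion. Since the weights are bounded,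
  passage times are Lipschitz in the endpoints, so the limit theorem along integer directions
  (a subadditive ergodic theorem) extends to all directions at once.\<close>

text \<open>Perturbing \<open>t\<close> changes the law of the weights, whereas the squeeze compares
  passage times for \<open>t\<close> and for its perturbations in one and the same environment. This
  is why the environment carries labels and the weight function is applied afterwards. The theorem
  itself speaks of environments of weights; for almost every \<open>t\<close> the values
  \<open>t i\<close> are distinct, and the labels can be read back from the weights. Geodesics need
  not be unique, and the choices of them are uncountably many. Every almost sure statement is
  therefore made about passage times, for the countably many perturbations of size
  \<open>1 / Suc n\<close>; what is then said about geodesics is deterministic on that event.
  Differentiability is what makes all geodesics agree: at a kink the two difference quotients would
  leave an interval of possible densities. In the limit theorem Kolmogorov's zero-one law takes the
  place of ergodicity, because changing finitely many edges moves all passage times by a bounded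
  amount. The bounded weights supply this bound too.\<close>

section \<open>Bernoulli expectations over finite sets\<close>

text \<open>The mean of \<open>f A\<close> when each element of \<open>E\<close> belongs to \<open>A\<close> independently with probability \<open>q\<close>.\<close>

definition bexp :: "'e set \<Rightarrow> real \<Rightarrow> ('e set \<Rightarrow> real) \<Rightarrow> real" where
  "bexp E q f = (\<Sum>A\<in>Pow E. q ^ card A * (1 - q) ^ card (E - A) * f A)"

lemma bexp_empty [simp]: "bexp {} q f = f {}"
  by (simp add: bexp_def)

text \<open>Conditioning on whether \<open>e\<close> is present; the inductions over
  \<open>E\<close> below run through this recursion.\<close>

lemma bexp_insert:
  assumes "finite E" "e \<notin> E"
  shows "bexp (insert e E) q f = q * bexp E q (\<lambda>A. f (insert e A)) + (1 - q) * bexp E q f"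
proof -
  have inj: "inj_on (insert e) (Pow E)"
    using assms(2) by (auto simp: inj_on_def)
  have disj: "Pow E \<inter> insert e ` Pow E = {}" using assms(2) by auto
  have c1: "card (insert e A) = Suc (card A)" "insert e E - insert e A = E - A" if "A \<in> Pow E" for A
    using that assms by (auto simp: card_insert_if finite_subset)
  have c2: "card (insert e E - A) = Suc (card (E - A))" if "A \<in> Pow E" for A
  proof -
    have "insert e E - A = insert e (E - A)" using that assms by auto
    then show ?thesis using assms by simp
  qed
  show ?thesis
    unfolding bexp_def Pow_insert
    by (subst sum.union_disjoint)
      (use assms disj inj in \<open>auto simp: sum.reindex c1 c2 sum_distrib_left mult_ac intro!: sum.cong\<close>)
qed

lemma bexp_cong:
  assumes "\<And>A. A \<subseteq> E \<Longrightarrow> f A = g A"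
  shows "bexp E q f = bexp E q g"
  unfolding bexp_def by (intro sum.cong) (auto simp: assms)

lemma bexp_add: "bexp E q (\<lambda>A. f A + g A) = bexp E q f + bexp E q g"
  by (simp add: bexp_def sum.distrib algebra_simps)

lemma bexp_cmult: "bexp E q (\<lambda>A. c * f A) = c * bexp E q f"
  by (simp add: bexp_def sum_distrib_left algebra_simps)

lemma bexp_diff: "bexp E q (\<lambda>A. f A - g A) = bexp E q f - bexp E q g"
  by (simp add: bexp_def sum_subtractf algebra_simps)

lemma bexp_sum: "bexp E q (\<lambda>A. \<Sum>i\<in>I. f i A) = (\<Sum>i\<in>I. bexp E q (f i))"
  unfolding bexp_def by (simp add: sum_distrib_left sum.swap[of _ "Pow E"])

lemma bexp_mono:
  assumes "0 \<le> q" "q \<le> 1" "\<And>A. A \<subseteq> E \<Longrightarrow> f A \<le> g A"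
  shows "bexp E q f \<le> bexp E q g"
  unfolding bexp_def using assms by (intro sum_mono mult_left_mono) auto

lemma bexp_const: "finite E \<Longrightarrow> bexp E q (\<lambda>_. c) = c"
  by (induction E rule: finite_induct) (auto simp: bexp_insert algebra_simps)

lemma bexp_nonneg:
  assumes "0 \<le> q" "q \<le> 1" "\<And>A. A \<subseteq> E \<Longrightarrow> 0 \<le> f A"
  shows "0 \<le> bexp E q f"
  unfolding bexp_def using assms by (intro sum_nonneg mult_nonneg_nonneg) auto

lemma bexp_Un:
  assumes "finite E" "finite F" "E \<inter> F = {}"
  shows "bexp (E \<union> F) q f = bexp E q (\<lambda>A. bexp F q (\<lambda>B. f (A \<union> B)))"
  using assms
proof (induction E arbitrary: f rule: finite_induct)
  case empty
  then show ?case by simp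
next
  case (insert e E)
  then show ?case by (simp add: bexp_insert)
qed

text \<open>Split \<open>E\<close> into \<open>F\<close>, \<open>G\<close> and the rest: the
  integrand ignores the rest, and a double sum of a product factorises. Independence in this form
  replaces product measures until \<open>integral_PiM_bexp\<close>.\<close>

lemma bexp_indep:
  assumes "finite E" "F \<subseteq> E" "G \<subseteq> E" "F \<inter> G = {}"
  shows "bexp E q (\<lambda>A. f (A \<inter> F) * g (A \<inter> G)) = bexp F q f * bexp G q g"
proof -
  have fin: "finite F" "finite G" "finite (E - F - G)" using assms finite_subset by auto
  have E: "E = F \<union> (G \<union> (E - F - G))" using assms by auto
  have "bexp E q (\<lambda>A. f (A \<inter> F) * g (A \<inter> G)) =
    bexp F q (\<lambda>A. bexp G q (\<lambda>B. bexp (E - F - G) q (\<lambda>C. f ((A \<union> (B \<union> C)) \<inter> F) * g ((A \<union> (B \<union> C)) \<inter> G))))"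
  proof -
    have G: "bexp (G \<union> (E - F - G)) q h = bexp G q (\<lambda>B. bexp (E - F - G) q (\<lambda>C. h (B \<union> C)))" for h
      using fin by (intro bexp_Un) auto
    have "bexp E q h = bexp F q (\<lambda>A. bexp (G \<union> (E - F - G)) q (\<lambda>B. h (A \<union> B)))" for h
      by (subst E, rule bexp_Un) (use fin assms in auto)
    then show ?thesis unfolding G .
  qed
  also have "\<dots> = bexp F q (\<lambda>A. bexp G q (\<lambda>B. f A * g B))"
  proof (intro bexp_cong)
    fix A B assume "A \<subseteq> F" "B \<subseteq> G"
    have "bexp (E - F - G) q (\<lambda>C. f ((A \<union> (B \<union> C)) \<inter> F) * g ((A \<union> (B \<union> C)) \<inter> G)) =
      bexp (E - F - G) q (\<lambda>C. f A * g B)"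
    proof (intro bexp_cong)
      fix C assume "C \<subseteq> E - F - G"
      have "(A \<union> (B \<union> C)) \<inter> F = A" "(A \<union> (B \<union> C)) \<inter> G = B"
        using assms(4) \<open>A \<subseteq> F\<close> \<open>B \<subseteq> G\<close> \<open>C \<subseteq> E - F - G\<close> by auto
      then show "f ((A \<union> (B \<union> C)) \<inter> F) * g ((A \<union> (B \<union> C)) \<inter> G) = f A * g B" by simp
    qed
    also have "\<dots> = f A * g B" using fin by (simp add: bexp_const)
    finally show "bexp (E - F - G) q (\<lambda>C. f ((A \<union> (B \<union> C)) \<inter> F) * g ((A \<union> (B \<union> C)) \<inter> G)) = f A * g B" .
  qed
  also have "\<dots> = bexp F q f * bexp G q g"
    by (simp add: bexp_cmult mult.commute[of _ "bexp G q g"])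
  finally show ?thesis .
qed

lemma bexp_marginal:
  assumes "finite E" "F \<subseteq> E"
  shows "bexp E q (\<lambda>A. f (A \<inter> F)) = bexp F q f"
  using bexp_indep[of E F "{}" q f "\<lambda>_. 1"] assms by simp

lemma bexp_image:
  assumes "finite E" "inj_on h E"
  shows "bexp (h ` E) q f = bexp E q (\<lambda>A. f (h ` A))"
  using assms
proof (induction E arbitrary: f rule: finite_induct)
  case empty
  then show ?case by simp
next
  case (insert e E)
  then have "h e \<notin> h ` E" by auto
  with insert show ?case by (simp add: bexp_insert)
qed

lemma bexp_subset:
  assumes "finite E" "D \<subseteq> E"
  shows "bexp E q (\<lambda>A. of_bool (D \<subseteq> A)) = q ^ card D"
proof -
  have fD: "finite D" using assms finite_subset by blast
  have "bexp E q (\<lambda>A. of_bool (D \<subseteq> A)) = bexp E q (\<lambda>A. of_bool (D \<subseteq> A \<inter> D))"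
    by (intro bexp_cong) auto
  also have "\<dots> = bexp D q (\<lambda>A. of_bool (D \<subseteq> A))"
    using bexp_marginal[OF assms, where f = "\<lambda>A. of_bool (D \<subseteq> A)"] by simp
  also have "\<dots> = q ^ card D"
  proof -
    have "bexp D q (\<lambda>A. of_bool (D \<subseteq> A)) = (\<Sum>A\<in>{D}. q ^ card A * (1 - q) ^ card (D - A) * of_bool (D \<subseteq> A))"
      unfolding bexp_def using fD by (intro sum.mono_neutral_right) auto
    then show ?thesis by simp
  qed
  finally show ?thesis .
qed

text \<open>The union of two independent random sets of densities \<open>p\<close> and
  \<open>r\<close> misses each element with probability \<open>(1 - p) * (1 - r)\<close>. An average
  over sprinkled configurations thus becomes one at a higher density.\<close>

lemma bexp_sprinkle:
  assumes "finite E"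
  shows "bexp E p (\<lambda>A. bexp E r (\<lambda>B. f (A \<union> B))) = bexp E (p + (1 - p) * r) f"
  using assms
proof (induction E arbitrary: f rule: finite_induct)
  case empty
  then show ?case by simp
next
  case (insert e E)
  let ?g = "\<lambda>A. f (insert e A)"
  have IH: "bexp E p (\<lambda>A. bexp E r (\<lambda>B. h (A \<union> B))) = bexp E (p + (1 - p) * r) h" for h
    by (rule insert.IH)
  show ?case
    using insert.hyps IH[of f] IH[of ?g]
    by (simp add: bexp_insert bexp_add bexp_cmult) (simp add: algebra_simps)
qed

text \<open>Russo's formula for arbitrary \<open>f\<close>: the product rule applied to
  \<open>bexp_insert\<close>. When \<open>f\<close> indicates an increasing event, the summand is
  the probability that \<open>e\<close> is pivotal.\<close>

lemma bexp_has_derivative: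
  assumes "finite E"
  shows "((\<lambda>q. bexp E q f) has_real_derivative
    (\<Sum>e\<in>E. bexp E q (\<lambda>A. f (insert e A) - f (A - {e})))) (at q)"
  using assms
proof (induction E arbitrary: f rule: finite_induct)
  case empty
  then show ?case by simp
next
  case (insert e E)
  have *: "((\<lambda>q. q * bexp E q (\<lambda>A. f (insert e A)) + (1 - q) * bexp E q f) has_real_derivative
    (bexp E q (\<lambda>A. f (insert e A)) + q * (\<Sum>e'\<in>E. bexp E q (\<lambda>A. f (insert e (insert e' A)) - f (insert e (A - {e'})))))
    + (- bexp E q f + (1 - q) * (\<Sum>e'\<in>E. bexp E q (\<lambda>A. f (insert e' A) - f (A - {e'}))))) (at q)"
    by (rule derivative_eq_intros insert.IH refl | simp)+
  have e: "bexp (insert e E) q (\<lambda>A. f (insert e A) - f (A - {e})) = bexp E q (\<lambda>A. f (insert e A)) - bexp E q f"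
  proof -
    have "bexp E q (\<lambda>A. f (A - {e})) = bexp E q f" "bexp E q (\<lambda>A. f (insert e A - {e})) = bexp E q f"
      using insert.hyps by (auto intro!: bexp_cong arg_cong[of _ _ f])
    then show ?thesis using insert.hyps by (simp add: bexp_insert bexp_diff algebra_simps)
  qed
  have e': "bexp (insert e E) q (\<lambda>A. f (insert e' A) - f (A - {e'})) =
      q * bexp E q (\<lambda>A. f (insert e (insert e' A)) - f (insert e (A - {e'})))
      + (1 - q) * bexp E q (\<lambda>A. f (insert e' A) - f (A - {e'}))" if "e' \<in> E" for e'
  proof -
    have "e \<noteq> e'" using that insert.hyps by auto
    then show ?thesis using insert.hyps by (simp add: bexp_insert insert_commute insert_Diff_if)
  qed
  have "(\<Sum>e'\<in>insert e E. bexp (insert e E) q (\<lambda>A. f (insert e' A) - f (A - {e'}))) =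
    (bexp E q (\<lambda>A. f (insert e A)) + q * (\<Sum>e'\<in>E. bexp E q (\<lambda>A. f (insert e (insert e' A)) - f (insert e (A - {e'})))))
    + (- bexp E q f + (1 - q) * (\<Sum>e'\<in>E. bexp E q (\<lambda>A. f (insert e' A) - f (A - {e'}))))"
    using insert.hyps by (simp add: e e' sum.distrib sum_distrib_left)
  with * show ?case using insert.hyps by (simp add: bexp_insert)
qed

section \<open>Sharpness of the percolation transition\<close>

definition conn :: "'v set set \<Rightarrow> ('v \<times> 'v) set" where
  "conn A = {(u, v). {u, v} \<in> A}"

text \<open>The event that the cluster of \<open>v\<close> leaves \<open>L\<close>. The empty path
  counts, so a vertex outside \<open>L\<close> always satisfies it and a path may be cut at its
  first exit.\<close>

definition out :: "'v set set \<Rightarrow> 'v set \<Rightarrow> 'v \<Rightarrow> bool" where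
  "out A L v \<longleftrightarrow> (\<exists>z. z \<notin> L \<and> (v, z) \<in> (conn A)\<^sup>*)"

lemma conn_mono: "A \<subseteq> B \<Longrightarrow> conn A \<subseteq> conn B"
  by (auto simp: conn_def)

lemma out_mono: "out A L v \<Longrightarrow> A \<subseteq> B \<Longrightarrow> out B L v"
  unfolding out_def using rtrancl_mono[OF conn_mono] by blast

lemma out_mono2: "out A L v \<Longrightarrow> M \<subseteq> L \<Longrightarrow> out A M v"
  unfolding out_def by blast

lemma out_step: "{u, v} \<in> A \<Longrightarrow> out A L v \<Longrightarrow> out A L u"
  unfolding out_def by (metis (no_types, lifting) conn_def case_prodI mem_Collect_eq converse_rtrancl_into_rtrancl)

lemma out_refl: "v \<notin> L \<Longrightarrow> out A L v"
  unfolding out_def by auto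

lemma out_reach: "(u, v) \<in> (conn A)\<^sup>* \<Longrightarrow> out A L v \<Longrightarrow> out A L u"
  unfolding out_def by (meson rtrancl_trans)

text \<open>A path stopped at its first vertex outside \<open>L\<close> uses only edges that meet
  \<open>L\<close>. In a locally finite graph the event thus depends on finitely many edges when
  \<open>L\<close> is finite.\<close>

lemma out_touching:
  assumes "out A L v" "A \<subseteq> G"
  shows "out (A \<inter> {e\<in>G. e \<inter> L \<noteq> {}}) L v"
proof -
  obtain z where z: "z \<notin> L" "(v, z) \<in> (conn A)\<^sup>*" using assms by (auto simp: out_def)
  from z(2) show ?thesis
  proof (induction rule: converse_rtrancl_induct)
    case base
    then show ?case using z by (simp add: out_refl)
  next
    case (step u w)
    show ?case
    proof (cases "u \<in> L")
      case True
      then have "{u, w} \<in> A \<inter> {e\<in>G. e \<inter> L \<noteq> {}}"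
        using step assms by (auto simp: conn_def)
      then show ?thesis using step(3) by (rule out_step)
    qed (simp add: out_refl)
  qed
qed

locale graph =
  fixes G :: "'v set set"
  assumes locally_finite: "\<And>x. finite {y. {x, y} \<in> G}"
    and edges: "\<And>e. e \<in> G \<Longrightarrow> \<exists>x y. e = {x, y}"
begin

definition touching :: "'v set \<Rightarrow> 'v set set" where
  "touching L = {e\<in>G. e \<inter> L \<noteq> {}}"

definition inside :: "'v set \<Rightarrow> 'v set set" where
  "inside S = {e\<in>G. e \<subseteq> S}"

definition bdry :: "'v set \<Rightarrow> ('v \<times> 'v) set" where
  "bdry S = {(x, y). x \<in> S \<and> y \<notin> S \<and> {x, y} \<in> G}"

text \<open>The functional of Duminil-Copin and Tassion: the expected number of open boundary edges
  of \<open>S\<close> whose inner end is joined to \<open>a\<close> inside \<open>S\<close>.\<close>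

definition phi :: "'v \<Rightarrow> real \<Rightarrow> 'v set \<Rightarrow> real" where
  "phi a q S = (\<Sum>(x, y)\<in>bdry S. q * bexp (inside S) q (\<lambda>A. of_bool ((a, x) \<in> (conn A)\<^sup>*)))"

definition exit_prob :: "'v \<Rightarrow> real \<Rightarrow> 'v set \<Rightarrow> real" where
  "exit_prob a q L = bexp (touching L) q (\<lambda>A. of_bool (out A L a))"

lemma finite_bdry: "finite S \<Longrightarrow> finite (bdry S)"
  by (rule finite_subset[of _ "SIGMA x:S. {y. {x, y} \<in> G}"])
    (auto simp: bdry_def intro: locally_finite)

lemma finite_touching:
  assumes "finite L" shows "finite (touching L)"
proof (rule finite_subset)
  show "touching L \<subseteq> (\<lambda>(x, y). {x, y}) ` (SIGMA x:L. {y. {x, y} \<in> G})"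
  proof
    fix e assume e: "e \<in> touching L"
    then obtain x y where xy: "e = {x, y}" using edges[of e] by (auto simp: touching_def)
    show "e \<in> (\<lambda>(x, y). {x, y}) ` (SIGMA x:L. {y. {x, y} \<in> G})"
    proof (cases "x \<in> L")
      case True
      then have "(x, y) \<in> (SIGMA x:L. {y. {x, y} \<in> G})" using e xy by (auto simp: touching_def)
      then show ?thesis using xy by (intro image_eqI[of _ _ "(x, y)"]) auto
    next
      case False
      then have "(y, x) \<in> (SIGMA x:L. {y. {x, y} \<in> G})" "e = {y, x}"
        using e xy by (auto simp: touching_def insert_commute)
      then show ?thesis by (intro image_eqI[of _ _ "(y, x)"]) auto
    qed
  qed
qed (use assms locally_finite in auto)

lemma inside_subset_touching: "S \<subseteq> L \<Longrightarrow> inside S \<subseteq> touching L"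
proof
  fix e assume "S \<subseteq> L" "e \<in> inside S"
  moreover from this obtain x y where "e = {x, y}" using edges[of e] by (auto simp: inside_def)
  ultimately show "e \<in> touching L" by (auto simp: inside_def touching_def)
qed

section \<open>The differential inequality for exit probabilities\<close>

definition trapped :: "'v set \<Rightarrow> 'v set set \<Rightarrow> 'v set" where
  "trapped L A = {x\<in>L. \<not> out A L x}"

text \<open>The untrapped vertices are found by exploring from outside \<open>L\<close>. A path that
  reaches the outside never visits a trapped vertex, so this exploration uses no edge with both ends
  in \<open>S\<close>.\<close>

lemma trapped_eq_iff:
  assumes "S \<subseteq> L" "A \<subseteq> G"
  shows "trapped L A = S \<longleftrightarrow> trapped L (A - inside S) = S"
proof
  assume S: "trapped L A = S"
  have *: "out (A - inside S) L x" if x: "out A L x" for x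
  proof -
    obtain z where z: "z \<notin> L" "(x, z) \<in> (conn A)\<^sup>*" using x by (auto simp: out_def)
    from z(2) show ?thesis
    proof (induction rule: converse_rtrancl_induct)
      case base
      then show ?case using z by (simp add: out_refl)
    next
      case (step u w)
      have e: "{u, w} \<in> A" using step by (auto simp: conn_def)
      have "out A L u" using e step(3) out_mono out_step by (metis Diff_subset)
      then have "u \<notin> S" using S by (auto simp: trapped_def)
      then have "{u, w} \<in> A - inside S" using e by (auto simp: inside_def)
      then show ?case using step(3) by (rule out_step)
    qed
  qed
  show "trapped L (A - inside S) = S"
    using * out_mono[of "A - inside S" L _ A] S by (auto simp: trapped_def)
next
  assume S: "trapped L (A - inside S) = S"
  have *: "x \<notin> S" if x: "out A L x" for x
  proof -
    obtain z where z: "z \<notin> L" "(x, z) \<in> (conn A)\<^sup>*" using x by (auto simp: out_def)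
    from z(2) show ?thesis
    proof (induction rule: converse_rtrancl_induct)
      case base
      then show ?case using z assms by auto
    next
      case (step u w)
      have e: "{u, w} \<in> A" using step by (auto simp: conn_def)
      show ?case
      proof
        assume u: "u \<in> S"
        have "{u, w} \<in> A - inside S" using step(3) e by (auto simp: inside_def)
        moreover have "out (A - inside S) L w"
          using step(3) S by (auto simp: trapped_def intro: out_refl)
        ultimately have "out (A - inside S) L u" by (rule out_step)
        then show False using u S by (auto simp: trapped_def)
      qed
    qed
  qed
  show "trapped L A = S"
  proof
    show "trapped L A \<subseteq> S"
      using out_mono[of "A - inside S" L _ A] S by (auto simp: trapped_def)
    show "S \<subseteq> trapped L A" using * assms(1) by (auto simp: trapped_def)
  qed
qed

text \<open>All terms on the right are nonnegative by monotonicity, so it suffices to exhibit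
  pivotal edges. If \<open>a\<close> is trapped, only \<open>S = trapped L A\<close> contributes on
  the left. Adding a boundary edge of \<open>S\<close> whose inner end is joined to \<open>a\<close>
  lets \<open>a\<close> out, since the outer end is not trapped; removing it leaves \<open>a\<close>
  trapped.\<close>

lemma pivotal_count:
  assumes "finite L" "a \<in> L" "A \<subseteq> touching L"
  shows "(\<Sum>S\<in>{S. S \<subseteq> L \<and> a \<in> S}. of_bool (trapped L A = S) *
      (\<Sum>(x, y)\<in>bdry S. of_bool ((a, x) \<in> (conn (A \<inter> inside S))\<^sup>*)))
    \<le> (\<Sum>e\<in>touching L. of_bool (out (insert e A) L a) - of_bool (out (A - {e}) L a :: bool) :: real)"
    (is "?l \<le> (\<Sum>e\<in>_. ?f e)")
proof (cases "out A L a")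
  case True
  then have "trapped L A = S \<Longrightarrow> a \<notin> S" for S by (auto simp: trapped_def)
  then have "?l = 0" by (intro sum.neutral) auto
  moreover have "0 \<le> ?f e" for e
    using out_mono[of "A - {e}" L a "insert e A"] by auto
  ultimately show ?thesis by (simp add: sum_nonneg)
next
  case False
  define S where "S = trapped L A"
  have aS: "a \<in> S" "S \<subseteq> L" using False assms by (auto simp: S_def trapped_def)
  have fS: "finite S" using aS assms finite_subset by blast
  let ?B = "{(x, y)\<in>bdry S. (a, x) \<in> (conn (A \<inter> inside S))\<^sup>*}"
  have "?l = (\<Sum>S'\<in>{S}. of_bool (trapped L A = S') *
      (\<Sum>(x, y)\<in>bdry S'. of_bool ((a, x) \<in> (conn (A \<inter> inside S'))\<^sup>*)))"
    using aS assms by (intro sum.mono_neutral_right) (auto simp: S_def)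
  also have "\<dots> = (\<Sum>(x, y)\<in>bdry S. of_bool ((a, x) \<in> (conn (A \<inter> inside S))\<^sup>*))"
    by (simp add: S_def)
  also have "\<dots> = (\<Sum>(x, y)\<in>?B. 1)"
    using finite_bdry[OF fS] by (intro sum.mono_neutral_cong_right) auto
  also have "\<dots> = (\<Sum>e\<in>(\<lambda>(x, y). {x, y}) ` ?B. 1)"
  proof -
    \<comment> \<open>Exactly one end of a boundary edge lies in \<open>S\<close>, which fixes the
      orientation.\<close>
    have "inj_on (\<lambda>(x, y). {x, y}) ?B"
      by (auto simp: inj_on_def bdry_def doubleton_eq_iff)
    then show ?thesis by (simp add: card_image)
  qed
  also have "\<dots> \<le> (\<Sum>e\<in>(\<lambda>(x, y). {x, y}) ` ?B. ?f e)"
  proof (rule sum_mono)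
    fix e assume "e \<in> (\<lambda>(x, y). {x, y}) ` ?B"
    then obtain x y where xy: "e = {x, y}" "x \<in> S" "y \<notin> S" "(a, x) \<in> (conn (A \<inter> inside S))\<^sup>*"
      by (auto simp: bdry_def)
    have "out A L y" using xy by (auto simp: S_def trapped_def intro: out_refl)
    then have "out (insert e A) L y" by (rule out_mono) auto
    then have "out (insert e A) L x" using xy by (auto intro: out_step[of x y])
    moreover have "(a, x) \<in> (conn (insert e A))\<^sup>*"
      using xy(4) rtrancl_mono[OF conn_mono, of "A \<inter> inside S" "insert e A"] by auto
    ultimately have "out (insert e A) L a" by (rule out_reach[rotated])
    moreover have "\<not> out (A - {e}) L a" using False out_mono[of "A - {e}" L a A] by auto
    ultimately show "1 \<le> ?f e" by simp
  qed
  also have "\<dots> \<le> (\<Sum>e\<in>touching L. ?f e)"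
  proof (rule sum_mono2)
    show "finite (touching L)" using assms finite_touching by auto
    show "(\<lambda>(x, y). {x, y}) ` ?B \<subseteq> touching L"
      using aS by (auto simp: bdry_def touching_def)
    show "0 \<le> ?f e" for e using out_mono[of "A - {e}" L a "insert e A"] by auto
  qed
  finally show ?thesis .
qed

text \<open>Russo's formula together with a decomposition according to the set \<open>S\<close> of vertices that do not
  reach the complement of \<open>L\<close>: the event \<open>trapped L A = S\<close> ignores the edges inside \<open>S\<close>, and on it
  the boundary edges of \<open>S\<close> reached from \<open>a\<close> are pivotal.\<close>

lemma exit_prob_deriv_ge:
  assumes L: "finite L" "a \<in> L" and q: "0 < q" "q \<le> 1"
    and phi: "\<And>S. finite S \<Longrightarrow> a \<in> S \<Longrightarrow> phi a q S \<ge> 1"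
  obtains D where "((\<lambda>q. exit_prob a q L) has_real_derivative D) (at q)" "D \<ge> 1 - exit_prob a q L"
proof
  let ?E = "touching L"
  let ?D = "\<Sum>e\<in>?E. bexp ?E q (\<lambda>A. of_bool (out (insert e A) L a) - of_bool (out (A - {e}) L a))"
  have fE: "finite ?E" using L finite_touching by auto
  show "((\<lambda>q. exit_prob a q L) has_real_derivative ?D) (at q)"
    unfolding exit_prob_def by (rule bexp_has_derivative[OF fE])
  let ?SS = "{S. S \<subseteq> L \<and> a \<in> S}"
  have ind: "bexp ?E q (\<lambda>A. of_bool (trapped L A = S) * of_bool ((a, x) \<in> (conn (A \<inter> inside S))\<^sup>*)) =
    bexp ?E q (\<lambda>A. of_bool (trapped L A = S)) * bexp (inside S) q (\<lambda>A. of_bool ((a, x) \<in> (conn A)\<^sup>*))"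
    if S: "S \<subseteq> L" for S x
  proof -
    have EG: "?E \<subseteq> G" by (auto simp: touching_def)
    have iE: "inside S \<subseteq> ?E" using S by (rule inside_subset_touching)
    have tr: "trapped L A = S \<longleftrightarrow> trapped L (A \<inter> (?E - inside S)) = S" if "A \<subseteq> ?E" for A
    proof -
      have "A \<inter> (?E - inside S) = A - inside S" using that by auto
      then show ?thesis using trapped_eq_iff[OF S, of A] that EG by auto
    qed
    have "bexp ?E q (\<lambda>A. of_bool (trapped L A = S) * of_bool ((a, x) \<in> (conn (A \<inter> inside S))\<^sup>*)) =
      bexp ?E q (\<lambda>A. of_bool (trapped L (A \<inter> (?E - inside S)) = S) * of_bool ((a, x) \<in> (conn (A \<inter> inside S))\<^sup>*))"
      using tr by (intro bexp_cong) auto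
    also have "\<dots> = bexp (?E - inside S) q (\<lambda>A. of_bool (trapped L A = S)) * bexp (inside S) q (\<lambda>A. of_bool ((a, x) \<in> (conn A)\<^sup>*))"
      using iE fE by (intro bexp_indep[where f = "\<lambda>A. of_bool (trapped L A = S)" and g = "\<lambda>A. of_bool ((a, x) \<in> (conn A)\<^sup>*)"]) auto
    also have "bexp (?E - inside S) q (\<lambda>A. of_bool (trapped L A = S)) = bexp ?E q (\<lambda>A. of_bool (trapped L (A \<inter> (?E - inside S)) = S))"
      using fE by (subst bexp_marginal[where f = "\<lambda>A. of_bool (trapped L A = S)"]) auto
    also have "\<dots> = bexp ?E q (\<lambda>A. of_bool (trapped L A = S))"
      using tr by (intro bexp_cong) auto
    finally show ?thesis .
  qed
  have "1 - exit_prob a q L = bexp ?E q (\<lambda>A. 1 - of_bool (out A L a))"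
    using fE by (simp add: exit_prob_def bexp_diff bexp_const)
  also have "\<dots> = bexp ?E q (\<lambda>A. \<Sum>S\<in>?SS. of_bool (trapped L A = S))"
  proof (intro bexp_cong)
    fix A
    show "1 - of_bool (out A L a) = (\<Sum>S\<in>?SS. of_bool (trapped L A = S) :: real)"
    proof (cases "out A L a")
      case True
      then have "(\<Sum>S\<in>?SS. of_bool (trapped L A = S) :: real) = 0" by (intro sum.neutral) (auto simp: trapped_def)
      then show ?thesis using True by simp
    next
      case False
      have "(\<Sum>S\<in>?SS. of_bool (trapped L A = S) :: real) = (\<Sum>S\<in>{trapped L A}. of_bool (trapped L A = S))"
        using L False by (intro sum.mono_neutral_right) (auto simp: trapped_def)
      then show ?thesis using False by simp
    qed
  qed
  also have "\<dots> = (\<Sum>S\<in>?SS. bexp ?E q (\<lambda>A. of_bool (trapped L A = S)))"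
    by (rule bexp_sum)
  also have "\<dots> \<le> (\<Sum>S\<in>?SS. bexp ?E q (\<lambda>A. of_bool (trapped L A = S)) *
      (\<Sum>(x, y)\<in>bdry S. bexp (inside S) q (\<lambda>A. of_bool ((a, x) \<in> (conn A)\<^sup>*))))"
  proof (rule sum_mono)
    fix S assume S: "S \<in> ?SS"
    let ?s = "\<Sum>(x, y)\<in>bdry S. bexp (inside S) q (\<lambda>A. of_bool ((a, x) \<in> (conn A)\<^sup>*))"
    have "1 \<le> phi a q S" using S L finite_subset by (intro phi) auto
    also have "phi a q S = q * ?s" by (simp add: phi_def sum_distrib_left split_beta)
    \<comment> \<open>\<open>phi\<close> asks the boundary edge to be open, pivotality does not;
      \<open>q \<le> 1\<close> drops that factor.\<close>
    also have "\<dots> \<le> 1 * ?s"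
      using q by (intro mult_right_mono sum_nonneg) (auto intro!: bexp_nonneg)
    finally have s: "1 \<le> ?s" by simp
    have "0 \<le> bexp ?E q (\<lambda>A. of_bool (trapped L A = S))" using q by (intro bexp_nonneg) auto
    from mult_left_mono[OF s this]
    show "bexp ?E q (\<lambda>A. of_bool (trapped L A = S)) \<le> bexp ?E q (\<lambda>A. of_bool (trapped L A = S)) * ?s"
      by simp
  qed
  also have "\<dots> = bexp ?E q (\<lambda>A. \<Sum>S\<in>?SS. of_bool (trapped L A = S) *
      (\<Sum>(x, y)\<in>bdry S. of_bool ((a, x) \<in> (conn (A \<inter> inside S))\<^sup>*)))"
    by (subst bexp_sum) (auto simp: sum_distrib_left split_beta bexp_sum ind intro!: sum.cong)
  also have "\<dots> \<le> bexp ?E q (\<lambda>A. \<Sum>e\<in>?E. of_bool (out (insert e A) L a) - of_bool (out (A - {e}) L a))"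
    using q L by (intro bexp_mono pivotal_count) auto
  also have "\<dots> = ?D" by (rule bexp_sum)
  finally show "1 - exit_prob a q L \<le> ?D" .
qed

text \<open>A Gronwall argument: by the differential inequality,
  \<open>(1 - exit_prob a q L) * exp q\<close> does not increase between \<open>q1\<close> and
  \<open>q2\<close>. The bound is the same for all \<open>L\<close>, so it survives the passage to
  infinite clusters.\<close>

lemma exit_prob_ge:
  assumes L: "finite L" "a \<in> L" and q: "0 < q1" "q1 \<le> q2" "q2 \<le> 1"
    and phi: "\<And>q S. q1 \<le> q \<Longrightarrow> q \<le> q2 \<Longrightarrow> finite S \<Longrightarrow> a \<in> S \<Longrightarrow> phi a q S \<ge> 1"
  shows "exit_prob a q2 L \<ge> 1 - exp (q1 - q2)"
proof -
  let ?h = "\<lambda>q. (1 - exit_prob a q L) * exp q"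
  have "?h q2 \<le> ?h q1"
  proof (rule DERIV_nonpos_imp_nonincreasing[OF q(2)])
    fix x assume x: "q1 \<le> x" "x \<le> q2"
    obtain D where D: "((\<lambda>q. exit_prob a q L) has_real_derivative D) (at x)" "D \<ge> 1 - exit_prob a x L"
      using exit_prob_deriv_ge[OF L, of x] x q phi by (metis order.trans order_less_le_trans)
    have "(?h has_real_derivative (- D) * exp x + (1 - exit_prob a x L) * exp x) (at x)"
      using D(1) by (auto intro!: derivative_eq_intros)
    moreover have "(- D) * exp x + (1 - exit_prob a x L) * exp x = - ((D - (1 - exit_prob a x L)) * exp x)"
      by (simp add: algebra_simps)
    moreover have "0 \<le> (D - (1 - exit_prob a x L)) * exp x" using D(2) by simp
    ultimately show "\<exists>y. (?h has_real_derivative y) (at x) \<and> y \<le> 0" by (metis neg_le_0_iff_le)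
  qed
  also have "?h q1 \<le> 1 * exp q1"
    using q by (intro mult_right_mono) (auto simp: exit_prob_def intro!: bexp_nonneg)
  finally have "(1 - exit_prob a q2 L) * exp q2 * exp (- q2) \<le> exp q1 * exp (- q2)"
    by (intro mult_right_mono) auto
  moreover have "(1 - exit_prob a q2 L) * exp q2 * exp (- q2) = 1 - exit_prob a q2 L"
    by (simp add: exp_minus)
  ultimately have "1 - exit_prob a q2 L \<le> exp q1 * exp (- q2)"
    using \<open>(1 - exit_prob a q2 L) * exp q2 * exp (- q2) \<le> exp q1 * exp (- q2)\<close> by argo
  then show ?thesis by (simp add: exp_diff exp_minus divide_inverse)
qed

section \<open>One step of the exponential decay: leaving \<open>S\<close> and starting
  afresh\<close>

definition cluster_in :: "'v \<Rightarrow> 'v set \<Rightarrow> 'v set set \<Rightarrow> 'v set" where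
  "cluster_in a S A = {v. (a, v) \<in> (conn (A \<inter> inside S))\<^sup>*}"

lemma cluster_in_subset: "a \<in> S \<Longrightarrow> cluster_in a S A \<subseteq> S"
proof
  fix v assume a: "a \<in> S" and "v \<in> cluster_in a S A"
  then have "(a, v) \<in> (conn (A \<inter> inside S))\<^sup>*" by (simp add: cluster_in_def)
  then show "v \<in> S" by (induction rule: rtrancl_induct) (use a in \<open>auto simp: conn_def inside_def\<close>)
qed

text \<open>Exploring the cluster from \<open>a\<close> inspects only edges that meet the vertices
  already found. Hence the event that it equals \<open>C\<close> is decided by the edges inside
  \<open>S\<close> that meet \<open>C\<close>.\<close>

lemma cluster_in_eq_iff:
  assumes "a \<in> C"
  shows "cluster_in a S A = C \<longleftrightarrow> cluster_in a S (A \<inter> (inside S \<inter> touching C)) = C"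
    (is "_ \<longleftrightarrow> cluster_in a S ?A = C")
proof
  assume C: "cluster_in a S A = C"
  have "(a, v) \<in> (conn (?A \<inter> inside S))\<^sup>*" if "(a, v) \<in> (conn (A \<inter> inside S))\<^sup>*" for v
    using that
  proof (induction rule: rtrancl_induct)
    case (step u w)
    have "u \<in> C" using step C by (auto simp: cluster_in_def)
    then have "(u, w) \<in> conn (?A \<inter> inside S)" using step
      by (auto simp: conn_def inside_def touching_def)
    then show ?case using step by (meson rtrancl.rtrancl_into_rtrancl)
  qed auto
  moreover have "(conn (?A \<inter> inside S))\<^sup>* \<subseteq> (conn (A \<inter> inside S))\<^sup>*"
    by (intro rtrancl_mono conn_mono) auto
  ultimately show "cluster_in a S ?A = C" using C unfolding cluster_in_def by blast
next
  assume C: "cluster_in a S ?A = C"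
  have "v \<in> C" if "(a, v) \<in> (conn (A \<inter> inside S))\<^sup>*" for v
    using that
  proof (induction rule: rtrancl_induct)
    case (step u w)
    then have "(u, w) \<in> conn (?A \<inter> inside S)"
      by (auto simp: conn_def inside_def touching_def)
    moreover have "(a, u) \<in> (conn (?A \<inter> inside S))\<^sup>*" using step C by (auto simp: cluster_in_def)
    ultimately have "(a, w) \<in> (conn (?A \<inter> inside S))\<^sup>*" by (meson rtrancl.rtrancl_into_rtrancl)
    then show ?case using C by (auto simp: cluster_in_def)
  qed (use assms in auto)
  moreover have "(conn (?A \<inter> inside S))\<^sup>* \<subseteq> (conn (A \<inter> inside S))\<^sup>*"
    by (intro rtrancl_mono conn_mono) auto
  ultimately show "cluster_in a S A = C" using C unfolding cluster_in_def by blast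
qed

text \<open>Take the last vertex \<open>x\<close> of the path in \<open>C\<close> and its successor
  \<open>y\<close>. If \<open>y\<close> were in \<open>S\<close>, the edge would lie inside
  \<open>S\<close> and \<open>y\<close> would belong to the cluster; so the edge crosses the
  boundary of \<open>S\<close>, and the rest of the path avoids \<open>C\<close>.\<close>

lemma last_exit:
  assumes "out A L a" "A \<subseteq> G" "a \<in> S" "S \<subseteq> L" "C = cluster_in a S A"
  shows "\<exists>(x, y)\<in>bdry S. x \<in> C \<and> {x, y} \<in> A \<and> out {e\<in>A. e \<inter> C = {}} L y"
proof -
  let ?R = "(conn {e\<in>A. e \<inter> C = {}})\<^sup>*"
  obtain z where z: "z \<notin> L" "(a, z) \<in> (conn A)\<^sup>*" using assms by (auto simp: out_def)
  have CS: "C \<subseteq> S" using cluster_in_subset assms by auto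
  have aC: "a \<in> C" using assms by (auto simp: cluster_in_def)
  \<comment> \<open>Induction from the far end: either the walk from here on avoids
    \<open>C\<close>, or a step out of \<open>C\<close> followed by such a walk has already been
    found.\<close>
  from z(2) have "(a \<notin> C \<and> (a, z) \<in> ?R) \<or> (\<exists>x y. x \<in> C \<and> y \<notin> C \<and> {x, y} \<in> A \<and> (y, z) \<in> ?R)"
  proof (induction rule: converse_rtrancl_induct)
    case base
    then show ?case using z CS assms by auto
  next
    case (step u w)
    have e: "{u, w} \<in> A" using step by (auto simp: conn_def)
    show ?case
    proof (cases "w \<notin> C \<and> (w, z) \<in> ?R")
      case True
      show ?thesis
      proof (cases "u \<in> C")
        case False
        then have "(u, w) \<in> conn {e\<in>A. e \<inter> C = {}}" using True e by (auto simp: conn_def)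
        then show ?thesis using True False by (meson converse_rtrancl_into_rtrancl)
      qed (use True e in blast)
    qed (use step in blast)
  qed
  then obtain x y where xy: "x \<in> C" "y \<notin> C" "{x, y} \<in> A" "(y, z) \<in> ?R" using aC by blast
  have "y \<notin> S"
  proof
    assume "y \<in> S"
    then have "(x, y) \<in> conn (A \<inter> inside S)" using xy CS assms by (auto simp: conn_def inside_def)
    then have "y \<in> C" using xy(1) unfolding assms(5) cluster_in_def
      by (auto intro: rtrancl.rtrancl_into_rtrancl)
    then show False using xy by auto
  qed
  then have "(x, y) \<in> bdry S" using xy CS assms by (auto simp: bdry_def)
  then show ?thesis using xy z by (auto simp: out_def intro!: bexI[of _ "(x, y)"])
qed

text \<open>Conditioning on the cluster of \<open>a\<close> inside \<open>S\<close> replaces the BK inequality: the three events in the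
  decomposition of \<open>last_exit\<close> depend on disjoint sets of edges.\<close>

lemma exit_prob_step:
  assumes L: "finite L" and q: "0 \<le> q" "q \<le> 1" and S: "a \<in> S" "S \<subseteq> L"
    and K: "\<And>x y. (x, y) \<in> bdry S \<Longrightarrow> K y \<subseteq> L \<and> exit_prob y q (K y) \<le> r"
  shows "exit_prob a q L \<le> phi a q S * r"
proof -
  let ?E = "touching L"
  have fS: "finite S" using L S finite_subset by auto
  have fE: "finite ?E" using L finite_touching by auto
  have EG: "?E \<subseteq> G" by (auto simp: touching_def)
  have fin_inside: "finite (inside S)" using inside_subset_touching[OF S(2)] fE finite_subset by blast
  let ?t = "\<lambda>C x y A. of_bool (cluster_in a S A = C) * (of_bool ({x, y} \<in> A) * of_bool (out {e\<in>A. e \<inter> C = {}} L y)) :: real"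
  let ?SS = "\<lambda>x. {C. C \<subseteq> S \<and> a \<in> C \<and> x \<in> C}"
  have "exit_prob a q L \<le> bexp ?E q (\<lambda>A. \<Sum>(x, y)\<in>bdry S. \<Sum>C\<in>?SS x. ?t C x y A)"
    unfolding exit_prob_def
  proof (intro bexp_mono q)
    fix A assume A: "A \<subseteq> ?E"
    show "of_bool (out A L a) \<le> (\<Sum>(x, y)\<in>bdry S. \<Sum>C\<in>?SS x. ?t C x y A)"
    proof (cases "out A L a")
      case True
      define C where "C = cluster_in a S A"
      have AG: "A \<subseteq> G" using A EG by auto
      obtain x y where xy: "(x, y) \<in> bdry S" "x \<in> C" "{x, y} \<in> A" "out {e\<in>A. e \<inter> C = {}} L y"
        using last_exit[OF True AG S C_def] by auto
      have C: "C \<subseteq> S" "a \<in> C" using cluster_in_subset S by (auto simp: C_def) (auto simp: cluster_in_def)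
      have "1 = ?t C x y A" using xy by (simp add: C_def)
      also have "\<dots> \<le> (\<Sum>C\<in>?SS x. ?t C x y A)"
        using C xy fS by (intro member_le_sum) auto
      also have "\<dots> \<le> (\<Sum>(x, y)\<in>bdry S. \<Sum>C\<in>?SS x. ?t C x y A)"
        using member_le_sum[of "(x, y)" "bdry S" "\<lambda>(x, y). \<Sum>C\<in>?SS x. ?t C x y A"]
          xy finite_bdry[OF fS] by (auto simp: sum_nonneg)
      finally show ?thesis using True by simp
    qed (auto intro!: sum_nonneg)
  qed
  also have "\<dots> = (\<Sum>(x, y)\<in>bdry S. \<Sum>C\<in>?SS x. bexp ?E q (?t C x y))"
    by (simp add: bexp_sum split_beta)
  also have "\<dots> \<le> (\<Sum>(x, y)\<in>bdry S. \<Sum>C\<in>?SS x.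
      bexp (inside S) q (\<lambda>A. of_bool (cluster_in a S A = C)) * (q * r))"
  proof (intro sum_mono, clarify, rule sum_mono)
    fix x y C assume xy: "(x, y) \<in> bdry S" and C: "C \<in> ?SS x"
    \<comment> \<open>\<open>?E1\<close> decides the cluster, \<open>?E2\<close> is the exit edge,
      and \<open>?E3\<close> carries the remaining path. They are disjoint because
      \<open>{x, y}\<close> is not inside \<open>S\<close>, while both it and the edges of
      \<open>?E1\<close> meet \<open>C\<close>.\<close>
    let ?E1 = "inside S \<inter> touching C" and ?E2 = "{{x, y}}" and ?E3 = "{e\<in>?E. e \<inter> C = {}}"
    let ?f = "\<lambda>A. of_bool (cluster_in a S A = C) :: real"
    have sub: "?E1 \<subseteq> ?E" "?E2 \<subseteq> ?E" "?E3 \<subseteq> ?E"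
      using inside_subset_touching[OF S(2)] xy S by (auto simp: bdry_def touching_def)
    have disj: "?E1 \<inter> (?E2 \<union> ?E3) = {}" "?E2 \<inter> ?E3 = {}"
      using xy C by (auto simp: inside_def bdry_def touching_def)
    have sub23: "?E2 \<union> ?E3 \<subseteq> ?E" using sub by blast
    have fin23: "finite (?E2 \<union> ?E3)" using sub23 fE finite_subset by blast
    have cl: "cluster_in a S A = C \<longleftrightarrow> cluster_in a S (A \<inter> ?E1) = C" for A
      using C by (intro cluster_in_eq_iff) auto
    have "bexp ?E q (?t C x y) = bexp ?E q (\<lambda>A. ?f (A \<inter> ?E1) *
      (of_bool ({x, y} \<in> A \<inter> (?E2 \<union> ?E3)) * of_bool (out {e\<in>A \<inter> (?E2 \<union> ?E3). e \<inter> C = {}} L y)))"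
    proof (intro bexp_cong)
      fix A assume A: "A \<subseteq> ?E"
      have 1: "{e\<in>A \<inter> (?E2 \<union> ?E3). e \<inter> C = {}} = {e\<in>A. e \<inter> C = {}}" using A C by auto
      show "?t C x y A = ?f (A \<inter> ?E1) *
      (of_bool ({x, y} \<in> A \<inter> (?E2 \<union> ?E3)) * of_bool (out {e\<in>A \<inter> (?E2 \<union> ?E3). e \<inter> C = {}} L y))"
        unfolding 1 using cl[of A] by auto
    qed
    also have "\<dots> = bexp ?E1 q ?f * bexp (?E2 \<union> ?E3) q (\<lambda>A. of_bool ({x, y} \<in> A) * of_bool (out {e\<in>A. e \<inter> C = {}} L y))"
      by (rule bexp_indep[OF fE sub(1) sub23 disj(1), of q ?f
            "\<lambda>A. of_bool ({x, y} \<in> A) * of_bool (out {e\<in>A. e \<inter> C = {}} L y)"])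
    also have "bexp (?E2 \<union> ?E3) q (\<lambda>A. of_bool ({x, y} \<in> A) * of_bool (out {e\<in>A. e \<inter> C = {}} L y)) =
       bexp (?E2 \<union> ?E3) q (\<lambda>A. of_bool ({x, y} \<in> A \<inter> ?E2) * of_bool (out (A \<inter> ?E3) L y))"
    proof (intro bexp_cong)
      fix A assume A: "A \<subseteq> ?E2 \<union> ?E3"
      have "{e\<in>A. e \<inter> C = {}} = A \<inter> ?E3" using A C sub by auto
      then show "of_bool ({x, y} \<in> A) * of_bool (out {e\<in>A. e \<inter> C = {}} L y) = (of_bool ({x, y} \<in> A \<inter> ?E2) * of_bool (out (A \<inter> ?E3) L y) :: real)"
        by simp
    qed
    also have "\<dots> = bexp ?E2 q (\<lambda>A. of_bool ({x, y} \<in> A)) * bexp ?E3 q (\<lambda>A. of_bool (out A L y))"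
      by (rule bexp_indep[OF fin23 Un_upper1 Un_upper2 disj(2), of q "\<lambda>A. of_bool ({x, y} \<in> A)"
            "\<lambda>A. of_bool (out A L y)"])
    also have "bexp ?E2 q (\<lambda>A. of_bool ({x, y} \<in> A)) = q" by (simp add: bexp_insert)
    also have "bexp ?E1 q ?f = bexp (inside S) q (\<lambda>A. ?f (A \<inter> ?E1))"
      by (rule bexp_marginal[OF fin_inside inf_le1, where q = q and f = ?f, symmetric])
    also have "\<dots> = bexp (inside S) q ?f"
      using cl by (intro bexp_cong) auto
    finally have *: "bexp ?E q (?t C x y) = bexp (inside S) q ?f * (q * bexp ?E3 q (\<lambda>A. of_bool (out A L y)))" .
    have KL: "K y \<subseteq> L" and Kr: "exit_prob y q (K y) \<le> r" using K xy by auto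
    have "bexp ?E3 q (\<lambda>A. of_bool (out A L y)) = bexp ?E q (\<lambda>A. of_bool (out (A \<inter> ?E3) L y))"
      by (rule bexp_marginal[OF fE sub(3), where q = q and f = "\<lambda>A. of_bool (out A L y)", symmetric])
    \<comment> \<open>Forgetting that the path avoids \<open>C\<close>, and asking it to leave only
      the smaller set \<open>K y\<close>, both enlarge the event.\<close>
    also have "\<dots> \<le> bexp ?E q (\<lambda>A. of_bool (out (A \<inter> touching (K y)) (K y) y))"
    proof (intro bexp_mono q)
      fix A assume A: "A \<subseteq> ?E"
      have "out (A \<inter> touching (K y)) (K y) y" if o: "out (A \<inter> ?E3) L y"
      proof -
        have "out A (K y) y" by (rule out_mono[OF out_mono2[OF o KL] inf_le1])
        from out_touching[OF this, of G] A EG show ?thesis by (auto simp: touching_def)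
      qed
      then show "of_bool (out (A \<inter> ?E3) L y) \<le> (of_bool (out (A \<inter> touching (K y)) (K y) y) :: real)" by auto
    qed
    also have "\<dots> = exit_prob y q (K y)"
    proof -
      have "touching (K y) \<subseteq> ?E" using KL by (auto simp: touching_def)
      from bexp_marginal[OF fE this, of q "\<lambda>A. of_bool (out A (K y) y)"]
      show ?thesis by (simp add: exit_prob_def)
    qed
    also have "\<dots> \<le> r" by (rule Kr)
    finally have "q * bexp ?E3 q (\<lambda>A. of_bool (out A L y)) \<le> q * r" using q(1) by (rule mult_left_mono)
    moreover have "0 \<le> bexp (inside S) q ?f" using q by (intro bexp_nonneg) auto
    ultimately show "bexp ?E q (?t C x y) \<le> bexp (inside S) q ?f * (q * r)"
      unfolding * by (rule mult_left_mono)
  qed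
  also have "\<dots> = (\<Sum>(x, y)\<in>bdry S. bexp (inside S) q (\<lambda>A. \<Sum>C\<in>?SS x. of_bool (cluster_in a S A = C)) * (q * r))"
    by (simp add: bexp_sum sum_distrib_right)
  \<comment> \<open>Exactly one \<open>C\<close> is the cluster of \<open>a\<close>, and it is
    counted when it contains \<open>x\<close>.\<close>
  also have "\<dots> = (\<Sum>(x, y)\<in>bdry S. bexp (inside S) q (\<lambda>A. of_bool ((a, x) \<in> (conn A)\<^sup>*)) * (q * r))"
  proof (intro sum.cong refl, clarify, intro arg_cong2[where f = times] bexp_cong refl)
    fix x y A assume A: "A \<subseteq> inside S"
    have AS: "A \<inter> inside S = A" using A by auto
    have a: "a \<in> cluster_in a S A" by (auto simp: cluster_in_def)
    show "(\<Sum>C\<in>?SS x. of_bool (cluster_in a S A = C)) = (of_bool ((a, x) \<in> (conn A)\<^sup>*) :: real)"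
    proof (cases "x \<in> cluster_in a S A")
      case True
      have "(\<Sum>C\<in>?SS x. of_bool (cluster_in a S A = C) :: real) = (\<Sum>C\<in>{cluster_in a S A}. of_bool (cluster_in a S A = C))"
        using True a cluster_in_subset[OF S(1)] fS by (intro sum.mono_neutral_right) auto
      then show ?thesis using True AS by (simp add: cluster_in_def)
    next
      case False
      then have "(\<Sum>C\<in>?SS x. of_bool (cluster_in a S A = C) :: real) = 0" by (intro sum.neutral) auto
      then show ?thesis using False AS by (simp add: cluster_in_def)
    qed
  qed
  also have "\<dots> = phi a q S * r"
    by (simp add: phi_def sum_distrib_left sum_distrib_right split_beta mult_ac)
  finally show ?thesis .
qed

end

section \<open>The integer lattice\<close>

definition dist1 :: "'d::finite vertex \<Rightarrow> 'd vertex \<Rightarrow> nat" where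
  "dist1 u v = (\<Sum>i\<in>UNIV. nat \<bar>u $ i - v $ i\<bar>)"

definition lball :: "'d::finite vertex \<Rightarrow> nat \<Rightarrow> 'd vertex set" where
  "lball u n = {v. dist1 u v \<le> n}"

lemma dist1_refl [simp]: "dist1 u u = 0"
  by (simp add: dist1_def)

lemma dist1_eq_0_iff [simp]: "dist1 u v = 0 \<longleftrightarrow> u = v"
  by (auto simp: dist1_def vec_eq_iff)

lemma dist1_commute: "dist1 u v = dist1 v u"
  by (simp add: dist1_def abs_minus_commute)

lemma dist1_triangle: "dist1 u w \<le> dist1 u v + dist1 v w"
  unfolding dist1_def sum.distrib[symmetric] by (intro sum_mono) auto

lemma dist1_translate [simp]: "dist1 (z + u) (z + v) = dist1 u v"
  by (simp add: dist1_def)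

lemma int_dist1: "int (dist1 u v) = (\<Sum>i\<in>UNIV. \<bar>u $ i - v $ i\<bar>)"
  by (simp add: dist1_def)

lemma lattice_edge_iff: "{u, v} \<in> lattice_edges \<longleftrightarrow> dist1 u v = 1"
proof -
  have "(\<Sum>i\<in>UNIV. \<bar>u $ i - v $ i\<bar>) = 1 \<longleftrightarrow> dist1 u v = 1" for u v :: "'a vertex"
    unfolding int_dist1[symmetric] by simp
  then show ?thesis
    unfolding lattice_edges_def by (auto simp: doubleton_eq_iff dist1_commute)
qed

lemma zero_in_lball: "u \<in> lball u n"
  by (simp add: lball_def)

lemma finite_lball: "finite (lball u n)"
proof (rule finite_subset)
  show "lball u n \<subseteq> (\<lambda>f. \<chi> i. f i) ` (PiE UNIV (\<lambda>i. {u $ i - int n..u $ i + int n}))"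
  proof
    fix v assume v: "v \<in> lball u n"
    have "\<bar>u $ i - v $ i\<bar> \<le> int n" for i
    proof -
      have "nat \<bar>u $ i - v $ i\<bar> \<le> dist1 u v"
        unfolding dist1_def by (rule member_le_sum) auto
      then show ?thesis using v by (auto simp: lball_def)
    qed
    then have "v $ i \<in> {u $ i - int n..u $ i + int n}" for i
      by (smt (verit) atLeastAtMost_iff)
    then have "($) v \<in> PiE UNIV (\<lambda>i. {u $ i - int n..u $ i + int n})"
      by auto
    moreover have "v = (\<chi> i. v $ i)" by simp
    ultimately show "v \<in> (\<lambda>f. \<chi> i. f i) ` (PiE UNIV (\<lambda>i. {u $ i - int n..u $ i + int n}))"
      by (intro image_eqI)
  qed
  show "finite ((\<lambda>f. \<chi> i. f i) ` (PiE UNIV (\<lambda>i. {u $ i - int n..u $ i + int n})) :: 'a vertex set)"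
    by (intro finite_imageI finite_PiE) auto
qed

interpretation lattice: graph "lattice_edges :: 'd::finite edge set"
proof
  fix x :: "'d vertex"
  have "{y. {x, y} \<in> lattice_edges} \<subseteq> lball x 1" by (auto simp: lattice_edge_iff lball_def)
  then show "finite {y. {x, y} \<in> lattice_edges}" using finite_lball finite_subset by blast
  show "\<exists>x y. e = {x, y}" if "e \<in> lattice_edges" for e :: "'d edge"
    using that by (auto simp: lattice_edges_def)
qed

section \<open>Translation invariance of exit probabilities\<close>

lemma conn_image:
  assumes "inj h"
  shows "conn ((`) h ` A) = map_prod h h ` conn A"
proof -
  have "{u, v} = h ` e \<longleftrightarrow> (\<exists>x y. u = h x \<and> v = h y \<and> e = {x, y})" for u v e
  proof
    assume uv: "{u, v} = h ` e"
    then obtain x y where xy: "u = h x" "v = h y" by (metis imageE insertCI)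
    then have "h ` {x, y} = h ` e" using uv by simp
    then show "\<exists>x y. u = h x \<and> v = h y \<and> e = {x, y}" using xy assms by (metis inj_image_eq_iff)
  qed auto
  then show ?thesis
    by (auto simp: conn_def image_iff)
qed

lemma out_image:
  assumes "bij h"
  shows "out ((`) h ` A) (h ` L) (h v) \<longleftrightarrow> out A L v"
proof -
  have inj: "inj h" using assms by (rule bij_is_inj)
  have "(h u, h w) \<in> (conn ((`) h ` A))\<^sup>*" if "(u, w) \<in> (conn A)\<^sup>*" for u w
    using that
  proof (induction rule: rtrancl_induct)
    case (step y z)
    then have "(h y, h z) \<in> conn ((`) h ` A)" by (auto simp: conn_image[OF inj])
    then show ?case using step by (meson rtrancl.rtrancl_into_rtrancl)
  qed auto
  moreover have "\<exists>w. z = h w \<and> (u, w) \<in> (conn A)\<^sup>*" if "(h u, z) \<in> (conn ((`) h ` A))\<^sup>*" for u z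
    using that
  proof (induction rule: rtrancl_induct)
    case (step y z)
    then obtain w where w: "y = h w" "(u, w) \<in> (conn A)\<^sup>*" by auto
    from step(2) obtain a b where "y = h a" "z = h b" "(a, b) \<in> conn A"
      by (auto simp: conn_image[OF inj])
    then show ?case using w inj by (auto dest: injD intro: rtrancl.rtrancl_into_rtrancl)
  qed auto
  ultimately show ?thesis
    unfolding out_def using inj assms by (metis inj_image_mem_iff)
qed

lemma translate_edge_iff: "(+) z ` e \<in> lattice_edges \<longleftrightarrow> e \<in> (lattice_edges :: 'd::finite edge set)"
proof
  assume "(+) z ` e \<in> lattice_edges"
  then obtain u v where uv: "(+) z ` e = {u, v}" "{u, v} \<in> lattice_edges" using lattice.edges by metis
  have "e = (+) (- z) ` (+) z ` e" by (simp add: image_image)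
  then have "e = {- z + u, - z + v}" by (simp add: uv)
  then show "e \<in> lattice_edges" using uv(2) dist1_translate[of "- z" u v] by (simp add: lattice_edge_iff)
next
  assume "e \<in> lattice_edges"
  then obtain u v where uv: "e = {u, v}" "{u, v} \<in> lattice_edges" using lattice.edges by metis
  then show "(+) z ` e \<in> lattice_edges" by (simp add: lattice_edge_iff)
qed

lemma translate_lball: "(+) z ` lball u n = lball (z + u) n"
proof
  show "lball (z + u) n \<subseteq> (+) z ` lball u n"
  proof
    fix v assume "v \<in> lball (z + u) n"
    then have "v - z \<in> lball u n" using dist1_translate[of z u "v - z"] by (simp add: lball_def)
    then show "v \<in> (+) z ` lball u n" by (intro image_eqI[of _ _ "v - z"]) auto
  qed
qed (auto simp: lball_def)

lemma translate_touching: "lattice.touching ((+) z ` L) = (`) ((+) z) ` lattice.touching L"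
proof
  show "lattice.touching ((+) z ` L) \<subseteq> (`) ((+) z) ` lattice.touching L"
  proof
    fix e assume e: "e \<in> lattice.touching ((+) z ` L)"
    let ?f = "(+) (- z) ` e"
    have ef: "e = (+) z ` ?f" by (simp add: image_image)
    have "?f \<in> lattice_edges" using e ef translate_edge_iff[of z ?f] by (simp add: lattice.touching_def)
    moreover have "?f \<inter> L \<noteq> {}" using e by (auto simp: lattice.touching_def)
    ultimately show "e \<in> (`) ((+) z) ` lattice.touching L"
      using ef by (auto simp: lattice.touching_def)
  qed
  show "(`) ((+) z) ` lattice.touching L \<subseteq> lattice.touching ((+) z ` L)"
    by (auto simp: lattice.touching_def translate_edge_iff)
qed

lemma exit_prob_translate:
  "lattice.exit_prob z q (lball z n) = lattice.exit_prob (0 :: 'd::finite vertex) q (lball 0 n)"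
    for z :: "'d::finite vertex"
proof -
  have "bij ((+) z)" by (simp add: bij_plus)
  have L: "lball z n = (+) z ` lball (0 :: 'd vertex) n" by (simp add: translate_lball)
  have inj: "inj_on ((`) ((+) z)) E" for E by (auto simp: inj_on_def inj_image_eq_iff)
  show ?thesis
    unfolding lattice.exit_prob_def L translate_touching
    by (subst bexp_image)
      (use out_image[OF \<open>bij ((+) z)\<close>, of _ "lball 0 n" 0] lattice.finite_touching[OF finite_lball] inj in auto)
qed

text \<open>Iterates \<open>exit_prob_step\<close>: each time the path leaves a copy of
  \<open>S\<close>, at the cost of a factor \<open>phi\<close>, a ball of the next smaller size
  about its exit point still remains to be left, and by translation invariance that ball is as good
  as one about 0.\<close>

lemma exit_prob_exp_decay:
  assumes S: "finite S" "(0 :: 'd::finite vertex) \<in> S" and q: "0 \<le> q" "q \<le> 1"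
  obtains L where "L > 0" "\<And>k. lattice.exit_prob (0 :: 'd vertex) q (lball 0 (k * L)) \<le> lattice.phi 0 q S ^ k"
proof -
  obtain m where m: "S \<subseteq> lball 0 m"
  proof
    show "S \<subseteq> lball 0 (Max (dist1 0 ` S))" using S by (auto simp: lball_def)
  qed
  have phi0: "0 \<le> lattice.phi (0 :: 'd vertex) q S"
    unfolding lattice.phi_def using q by (intro sum_nonneg) (auto intro!: mult_nonneg_nonneg bexp_nonneg)
  \<comment> \<open>\<open>S\<close> lies in the ball of radius \<open>m\<close> and a boundary edge
    adds one step, so the radii shrink by \<open>Suc m\<close>.\<close>
  have "lattice.exit_prob (0 :: 'd vertex) q (lball 0 (k * Suc m)) \<le> lattice.phi 0 q S ^ k" for k
  proof (induction k)
    case 0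
    have "lattice.exit_prob (0 :: 'd vertex) q (lball 0 0) \<le> bexp (lattice.touching (lball (0 :: 'd vertex) 0)) q (\<lambda>_. 1)"
      unfolding lattice.exit_prob_def using q by (intro bexp_mono) auto
    then show ?case using lattice.finite_touching[OF finite_lball, of "0 :: 'd vertex" 0] by (simp add: bexp_const)
  next
    case (Suc k)
    have "lattice.exit_prob (0 :: 'd vertex) q (lball 0 (Suc k * Suc m)) \<le> lattice.phi 0 q S * lattice.phi 0 q S ^ k"
    proof (rule lattice.exit_prob_step[where K = "\<lambda>y. lball y (k * Suc m)"])
      show "S \<subseteq> lball 0 (Suc k * Suc m)" using m by (auto simp: lball_def)
      fix x y assume xy: "(x, y) \<in> lattice.bdry S"
      then have "dist1 0 x \<le> m" "dist1 x y = 1" using m by (auto simp: lattice.bdry_def lball_def lattice_edge_iff)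
      then have y: "dist1 0 y \<le> Suc m" using dist1_triangle[of 0 y x] by simp
      have "lball y (k * Suc m) \<subseteq> lball 0 (Suc k * Suc m)"
      proof
        fix v assume "v \<in> lball y (k * Suc m)"
        then show "v \<in> lball 0 (Suc k * Suc m)" using y dist1_triangle[of 0 v y] by (simp add: lball_def)
      qed
      then show "lball y (k * Suc m) \<subseteq> lball 0 (Suc k * Suc m) \<and>
          lattice.exit_prob y q (lball y (k * Suc m)) \<le> lattice.phi 0 q S ^ k"
        using Suc by (simp only: exit_prob_translate[of y])
    qed (use S q finite_lball in auto)
    then show ?case by simp
  qed
  then show ?thesis using that by blast
qed

text \<open>The bridge from finite sums to the infinite product measure. \<open>Z\<close> is the set
  of open states: \<open>{True}\<close> for percolation, and in the passage time estimate a set of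
  labels that contains those of zero weight.\<close>

lemma integral_PiM_bexp:
  assumes K: "prob_space K" and Z: "Z \<in> sets K" and E: "finite E" "E \<subseteq> I"
  shows "integrable (\<Pi>\<^sub>M e\<in>I. K) (\<lambda>\<omega>. f {e\<in>E. \<omega> e \<in> Z})"
    and "(\<integral>\<omega>. f {e\<in>E. \<omega> e \<in> Z} \<partial>(\<Pi>\<^sub>M e\<in>I. K)) = bexp E (measure K Z) f"
proof -
  interpret K: prob_space K by (rule K)
  interpret P: product_prob_space "\<lambda>_. K" I by unfold_locales
  let ?P = "\<Pi>\<^sub>M e\<in>I. K"
  define X where "X A = prod_emb I (\<lambda>_. K) E (\<Pi>\<^sub>E e\<in>E. if e \<in> A then Z else space K - Z)" for A
  have Xs: "X A \<in> sets ?P" for A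
    unfolding X_def using E Z by (intro sets_PiM_I) auto
  have mX: "measure ?P (X A) = measure K Z ^ card A * (1 - measure K Z) ^ card (E - A)" if "A \<subseteq> E" for A
  proof -
    have "measure ?P (X A) = (\<Prod>e\<in>E. measure K (if e \<in> A then Z else space K - Z))"
      unfolding X_def using E Z by (intro P.measure_PiM_emb) auto
    also have "\<dots> = (\<Prod>e\<in>E. if e \<in> A then measure K Z else 1 - measure K Z)"
      using Z by (intro prod.cong) (auto simp: K.prob_compl)
    also have "\<dots> = (\<Prod>e\<in>E \<inter> A. measure K Z) * (\<Prod>e\<in>E - A. 1 - measure K Z)"
      using E by (subst prod.If_cases) (auto simp: Diff_eq)
    also have "E \<inter> A = A" using that by auto
    finally show ?thesis by simp
  qed
  have XI: "\<omega> \<in> X A \<longleftrightarrow> {e\<in>E. \<omega> e \<in> Z} = A" if "A \<subseteq> E" "\<omega> \<in> space ?P" for A \<omega>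
  proof -
    have sp: "\<omega> e \<in> space K" if "e \<in> E" for e using that \<open>\<omega> \<in> space ?P\<close> E by (auto simp: space_PiM)
    have "\<omega> \<in> X A \<longleftrightarrow> (\<forall>e\<in>E. \<omega> e \<in> (if e \<in> A then Z else space K - Z))"
      using that(2) unfolding X_def prod_emb_def by (auto simp: space_PiM PiE_def restrict_def Pi_def extensional_def)
    also have "\<dots> \<longleftrightarrow> {e\<in>E. \<omega> e \<in> Z} = A" using sp that(1) by auto
    finally show ?thesis .
  qed
  have eq: "f {e\<in>E. \<omega> e \<in> Z} = (\<Sum>A\<in>Pow E. f A * indicator (X A) \<omega>)" if "\<omega> \<in> space ?P" for \<omega>
  proof -
    have "(\<Sum>A\<in>Pow E. f A * indicator (X A) \<omega>) = (\<Sum>A\<in>{{e\<in>E. \<omega> e \<in> Z}}. f A * indicator (X A) \<omega>)"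
    proof (intro sum.mono_neutral_right ballI)
      fix A assume A: "A \<in> Pow E - {{e\<in>E. \<omega> e \<in> Z}}"
      then have "\<omega> \<notin> X A" using XI[OF _ that, of A] by blast
      then show "f A * indicator (X A) \<omega> = 0" by simp
    qed (use E in auto)
    also have "\<dots> = f {e\<in>E. \<omega> e \<in> Z}" using that by (simp add: XI indicator_def)
    finally show ?thesis ..
  qed
  have int: "integrable ?P (\<lambda>\<omega>. f A * indicator (X A) \<omega>)" for A
    using Xs[of A] by (intro integrable_mult_right integrable_real_indicator) (auto simp: P.emeasure_eq_measure)
  have *: "integrable ?P (\<lambda>\<omega>. \<Sum>A\<in>Pow E. f A * indicator (X A) \<omega>)"
    by (intro Bochner_Integration.integrable_sum int)
  show "integrable ?P (\<lambda>\<omega>. f {e\<in>E. \<omega> e \<in> Z})"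
    by (subst Bochner_Integration.integrable_cong[OF refl eq]) (use * in auto)
  have "(\<integral>\<omega>. f {e\<in>E. \<omega> e \<in> Z} \<partial>?P) = (\<integral>\<omega>. (\<Sum>A\<in>Pow E. f A * indicator (X A) \<omega>) \<partial>?P)"
    by (intro Bochner_Integration.integral_cong refl eq)
  also have "\<dots> = (\<Sum>A\<in>Pow E. f A * measure ?P (X A))"
    using int Xs by (subst Bochner_Integration.integral_sum) (auto simp: measure_def[symmetric])
  also have "\<dots> = bexp E (measure K Z) f"
    unfolding bexp_def using mX by (intro sum.cong) auto
  finally show "(\<integral>\<omega>. f {e\<in>E. \<omega> e \<in> Z} \<partial>?P) = bexp E (measure K Z) f" .
qed

text \<open>Balls are finite, so a cluster is infinite exactly if it leaves all of them. These exit
  events decrease, and continuity from above applies.\<close>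

lemma percolation_prob_ge:
  assumes q: "0 \<le> q" "q \<le> 1"
    and c: "\<And>n. c \<le> lattice.exit_prob (0 :: 'd::finite vertex) q (lball 0 n)"
  shows "c \<le> percolation_prob TYPE('d) q"
proof -
  let ?K = "measure_pmf (bernoulli_pmf q)"
  let ?P = "percolation_space q :: ('d edge \<Rightarrow> bool) measure"
  interpret PP: product_prob_space "\<lambda>_. ?K" "lattice_edges :: 'd edge set" by unfold_locales
  interpret P: prob_space ?P unfolding percolation_space_def by unfold_locales
  define A :: "('d edge \<Rightarrow> bool) \<Rightarrow> 'd edge set" where "A \<omega> = {e\<in>lattice_edges. \<omega> e}" for \<omega>
  define X where "X n = {\<omega>\<in>space ?P. out (A \<omega>) (lball 0 n) 0}" for n
  have tou: "out (A \<omega>) (lball 0 n) 0 \<longleftrightarrow> out {e\<in>lattice.touching (lball 0 n). \<omega> e \<in> {True}} (lball 0 n) 0" for \<omega> n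
  proof -
    have "A \<omega> \<inter> {e \<in> lattice_edges. e \<inter> lball 0 n \<noteq> {}} = {e\<in>lattice.touching (lball 0 n). \<omega> e \<in> {True}}"
      by (auto simp: A_def lattice.touching_def)
    then show ?thesis
      using out_touching[of "A \<omega>" "lball 0 n" 0 lattice_edges] out_mono[of _ "lball 0 n" 0 "A \<omega>"]
      by (auto simp: A_def)
  qed
  have ET: "finite (lattice.touching (lball (0 :: 'd vertex) n))"
    "lattice.touching (lball (0 :: 'd vertex) n) \<subseteq> lattice_edges" for n
    using lattice.finite_touching[OF finite_lball] by (auto simp: lattice.touching_def)
  have KT: "{True} \<in> sets ?K" by simp
  note I = integral_PiM_bexp[OF measure_pmf.prob_space_axioms[of "bernoulli_pmf q"] KT ET, folded percolation_space_def]
  have Xs: "X n \<in> sets ?P" for n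
  proof -
    have "integrable ?P (\<lambda>\<omega>. of_bool (out {e\<in>lattice.touching (lball 0 n). \<omega> e \<in> {True}} (lball 0 n) 0) :: real)"
      by (rule I(1)[where f = "\<lambda>A. of_bool (out A (lball 0 n) 0)"])
    then have "(\<lambda>\<omega>. of_bool (out {e\<in>lattice.touching (lball 0 n). \<omega> e \<in> {True}} (lball 0 n) 0) :: real) \<in> borel_measurable ?P"
      by auto
    from measurable_sets[OF this, of "{1}"]
    show ?thesis unfolding X_def tou by (auto simp: vimage_def Int_def conj_commute)
  qed
  have mX: "measure ?P (X n) = lattice.exit_prob (0 :: 'd vertex) q (lball 0 n)" for n
  proof -
    have "measure ?P (X n) = (\<integral>\<omega>. indicator (X n) \<omega> \<partial>?P)" using Xs by simp
    also have "\<dots> = (\<integral>\<omega>. of_bool (out {e\<in>lattice.touching (lball 0 n). \<omega> e \<in> {True}} (lball 0 n) 0) \<partial>?P)"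
      by (intro Bochner_Integration.integral_cong) (auto simp: X_def tou indicator_def)
    also have "\<dots> = bexp (lattice.touching (lball (0 :: 'd vertex) n)) (measure ?K {True}) (\<lambda>A. of_bool (out A (lball 0 n) 0))"
      using I(2)[where f = "\<lambda>A. of_bool (out A (lball 0 n) 0)", of n] by simp
    also have "measure ?K {True} = q" using q by (simp add: measure_pmf_single)
    finally show ?thesis by (simp add: lattice.exit_prob_def)
  qed
  have inf: "{\<omega> \<in> space ?P. infinite (open_cluster \<omega> (0 :: 'd vertex))} = (\<Inter>n. X n)"
  proof -
    have cl: "open_cluster \<omega> 0 = {y. (0, y) \<in> (conn (A \<omega>))\<^sup>*}" for \<omega>
      by (simp add: open_cluster_def A_def conn_def)
    have "infinite (open_cluster \<omega> 0) \<longleftrightarrow> (\<forall>n. out (A \<omega>) (lball 0 n) 0)" for \<omega>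
    proof
      assume "infinite (open_cluster \<omega> 0)"
      then have "\<not> open_cluster \<omega> 0 \<subseteq> lball 0 n" for n using finite_lball finite_subset by blast
      then show "\<forall>n. out (A \<omega>) (lball 0 n) 0" by (auto simp: out_def cl)
    next
      assume o: "\<forall>n. out (A \<omega>) (lball 0 n) 0"
      show "infinite (open_cluster \<omega> 0)"
      proof
        assume fin: "finite (open_cluster \<omega> 0)"
        then have "open_cluster \<omega> 0 \<subseteq> lball 0 (Max (dist1 0 ` open_cluster \<omega> 0))" by (auto simp: lball_def)
        then show False using o[rule_format, of "Max (dist1 0 ` open_cluster \<omega> 0)"] by (auto simp: out_def cl)
      qed
    qed
    then show ?thesis by (auto simp: X_def)
  qed
  have "decseq X"
    unfolding X_def
  proof (rule decseq_SucI)
    fix n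
    have "lball (0 :: 'd vertex) n \<subseteq> lball 0 (Suc n)" by (auto simp: lball_def)
    then show "{\<omega> \<in> space ?P. out (A \<omega>) (lball 0 (Suc n)) 0} \<subseteq> {\<omega> \<in> space ?P. out (A \<omega>) (lball 0 n) 0}"
      using out_mono2[of _ "lball (0 :: 'd vertex) (Suc n)" 0 "lball 0 n"] by (intro Collect_mono) simp
  qed
  then have "(\<lambda>n. measure ?P (X n)) \<longlonglongrightarrow> measure ?P (\<Inter>n. X n)"
    using Xs by (intro P.finite_Lim_measure_decseq) auto
  then have "c \<le> measure ?P (\<Inter>n. X n)"
    by (rule LIMSEQ_le_const) (use c mX in auto)
  then show ?thesis unfolding percolation_prob_def inf .
qed

section \<open>Comparison with the critical probability\<close>

lemma critical_prob_le:
  assumes "0 \<le> q" "q \<le> 1" "percolation_prob TYPE('d::finite) q > 0"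
  shows "critical_prob TYPE('d) \<le> q"
  unfolding critical_prob_def using assms by (intro cInf_lower bdd_belowI[of _ 0]) auto

lemma out_lattice_edges: "out (lattice_edges :: 'd::finite edge set) (lball 0 n) 0"
proof -
  obtain k :: 'd where True by simp
  have d: "dist1 (axis k (int m) :: 'd vertex) (axis k (int m')) = nat \<bar>int m - int m'\<bar>" for m m'
  proof -
    have "nat \<bar>(axis k (int m) :: 'd vertex) $ i - axis k (int m') $ i\<bar> = (if i = k then nat \<bar>int m - int m'\<bar> else 0)" for i
      by (auto simp: axis_def)
    then show ?thesis by (simp add: dist1_def)
  qed
  have z: "axis k 0 = (0 :: 'd vertex)" by (simp add: axis_def vec_eq_iff)
  have "(0, axis k (int m) :: 'd vertex) \<in> (conn lattice_edges)\<^sup>*" for m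
  proof (induction m)
    case (Suc m)
    have "(axis k (int m), axis k (int (Suc m))) \<in> conn lattice_edges"
      using d[of m "Suc m"] by (simp add: conn_def lattice_edge_iff)
    then show ?case using Suc by (meson rtrancl.rtrancl_into_rtrancl)
  qed (simp add: z)
  moreover have "axis k (int (Suc n)) \<notin> lball (0 :: 'd vertex) n"
    using d[of 0 "Suc n"] z by (simp add: lball_def)
  ultimately show ?thesis unfolding out_def by blast
qed

text \<open>With all edges open the origin lies in an infinite cluster. The bound ensures that
  parameters below the critical one are probabilities.\<close>

lemma critical_prob_le_1: "critical_prob TYPE('d::finite) \<le> 1"
proof (rule critical_prob_le)
  have "1 \<le> percolation_prob TYPE('d) 1"
  proof (rule percolation_prob_ge)
    fix n
    let ?E = "lattice.touching (lball (0 :: 'd vertex) n)"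
    have fE: "finite ?E" by (intro lattice.finite_touching finite_lball)
    have "out (lattice_edges \<inter> {e \<in> lattice_edges. e \<inter> lball 0 n \<noteq> {}}) (lball 0 n) (0 :: 'd vertex)"
      by (rule out_touching[OF out_lattice_edges]) auto
    also have "lattice_edges \<inter> {e \<in> lattice_edges. e \<inter> lball 0 n \<noteq> {}} = ?E" by (auto simp: lattice.touching_def)
    finally have o: "out ?E (lball 0 n) 0" .
    \<comment> \<open>At \<open>q = 1\<close> every proper subset has weight 0, and the full set has
      weight 1 because \<open>0 ^ 0 = 1\<close>.\<close>
    have "lattice.exit_prob 0 1 (lball (0 :: 'd vertex) n) = (\<Sum>A\<in>{?E}. 1 ^ card A * (1 - 1) ^ card (?E - A) * of_bool (out A (lball 0 n) 0))"
      unfolding lattice.exit_prob_def bexp_def using fE finite_subset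
      by (intro sum.mono_neutral_right) (auto simp: card_eq_0_iff)
    then show "1 \<le> lattice.exit_prob 0 1 (lball (0 :: 'd vertex) n)" using o by simp
  qed auto
  then show "0 < percolation_prob TYPE('d) 1" by simp
qed auto

text \<open>Otherwise \<open>exit_prob_ge\<close> gives percolation at \<open>q2\<close>. The
  differential inequality is integrated over an interval, so the contradiction yields a suitable
  \<open>q\<close> only somewhere inside it; the interval is chosen where the lemma is
  applied.\<close>

lemma subcritical_phi_less_1:
  assumes "0 < q1" "q1 < q2" "q2 < critical_prob TYPE('d::finite)"
  obtains q S where "q1 \<le> q" "q \<le> q2" "finite S" "(0 :: 'd vertex) \<in> S" "lattice.phi 0 q S < 1"
proof -
  have q2: "q2 \<le> 1" using assms critical_prob_le_1[where ?'d = 'd] by simp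
  have "\<exists>q S. q1 \<le> q \<and> q \<le> q2 \<and> finite S \<and> (0 :: 'd vertex) \<in> S \<and> lattice.phi 0 q S < 1"
  proof (rule ccontr)
    assume "\<not> ?thesis"
    then have "1 - exp (q1 - q2) \<le> percolation_prob TYPE('d) q2"
      using assms q2 by (intro percolation_prob_ge lattice.exit_prob_ge) (auto simp: finite_lball zero_in_lball not_less)
    moreover have "exp (q1 - q2) < 1" using assms by simp
    ultimately have "0 < percolation_prob TYPE('d) q2" by linarith
    then have "critical_prob TYPE('d) \<le> q2" using assms q2 by (intro critical_prob_le) auto
    then show False using assms by simp
  qed
  then show ?thesis using that by blast
qed

section \<open>Paths and passage times\<close>

definition walk_edges :: "'v list \<Rightarrow> 'v set set" where
  "walk_edges xs = {{xs ! i, xs ! Suc i} | i. Suc i < length xs}"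

definition ptime :: "('d::finite edge \<Rightarrow> real) \<Rightarrow> 'd vertex \<Rightarrow> 'd vertex \<Rightarrow> real" where
  "ptime \<tau> u v = (INF \<gamma>\<in>paths_between u v. path_time \<tau> \<gamma>)"

lemma passage_time_eq: "passage_time \<tau> x y = ptime \<tau> (lattice_point x) (lattice_point y)"
  by (simp add: passage_time_def ptime_def paths_def)

lemma walk_edges_Nil [simp]: "walk_edges [] = {}"
  by (simp add: walk_edges_def)

lemma walk_edges_single [simp]: "walk_edges [x] = {}"
  by (simp add: walk_edges_def)

lemma walk_edges_Cons [simp]: "walk_edges (x # y # xs) = insert {x, y} (walk_edges (y # xs))"
proof
  show "walk_edges (x # y # xs) \<subseteq> insert {x, y} (walk_edges (y # xs))"
  proof
    fix e assume "e \<in> walk_edges (x # y # xs)"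
    then obtain i where i: "e = {(x # y # xs) ! i, (x # y # xs) ! Suc i}" "Suc i < length (x # y # xs)"
      by (auto simp: walk_edges_def)
    then show "e \<in> insert {x, y} (walk_edges (y # xs))"
      by (cases i) (auto simp: walk_edges_def)
  qed
  have "{(y # xs) ! i, (y # xs) ! Suc i} \<in> walk_edges (x # y # xs)" if "Suc i < length (y # xs)" for i
    unfolding walk_edges_def using that by (intro CollectI exI[of _ "Suc i"]) auto
  moreover have "{x, y} \<in> walk_edges (x # y # xs)"
    unfolding walk_edges_def by (intro CollectI exI[of _ 0]) auto
  ultimately show "insert {x, y} (walk_edges (y # xs)) \<subseteq> walk_edges (x # y # xs)"
    by (auto simp: walk_edges_def[of "y # xs"])
qed

lemma walk_edges_append: "walk_edges (xs @ x # ys) = walk_edges (xs @ [x]) \<union> walk_edges (x # ys)"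
proof (induction xs)
  case (Cons a xs)
  then show ?case by (cases xs) auto
qed auto

lemma walk_edges_map: "walk_edges (map f xs) = (`) f ` walk_edges xs"
proof (induction xs)
  case (Cons a xs)
  then show ?case by (cases xs) auto
qed auto

lemma finite_walk_edges: "finite (walk_edges xs)"
proof (induction xs)
  case (Cons a xs)
  then show ?case by (cases xs) auto
qed auto

text \<open>Cutting the loop between two visits to a vertex only removes edges. In this way
  concatenations of self-avoiding paths become admissible again.\<close>

lemma loop_erasure:
  assumes "xs \<noteq> []"
  obtains ys where "ys \<noteq> []" "hd ys = hd xs" "last ys = last xs" "distinct ys" "walk_edges ys \<subseteq> walk_edges xs"
proof -
  have "\<exists>ys. ys \<noteq> [] \<and> hd ys = hd xs \<and> last ys = last xs \<and> distinct ys \<and> walk_edges ys \<subseteq> walk_edges xs"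
    using assms
  proof (induction xs rule: length_induct)
    case (1 xs)
    show ?case
    proof (cases "distinct xs")
      case False
      then obtain as b cs ds where xs: "xs = as @ [b] @ cs @ [b] @ ds" using not_distinct_decomp by blast
      let ?zs = "as @ [b] @ ds"
      have "walk_edges xs = walk_edges (as @ [b]) \<union> (walk_edges ((b # cs) @ [b]) \<union> walk_edges (b # ds))"
        unfolding xs using walk_edges_append[of as b "cs @ [b] @ ds"] walk_edges_append[of "b # cs" b ds] by simp
      moreover have "walk_edges ?zs = walk_edges (as @ [b]) \<union> walk_edges (b # ds)"
        using walk_edges_append[of as b ds] by simp
      ultimately have sub: "walk_edges ?zs \<subseteq> walk_edges xs" by auto
      have len: "length ?zs < length xs" by (simp add: xs)
      have ends: "hd ?zs = hd xs" "last ?zs = last xs" by (auto simp: xs hd_append)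
      obtain ys where "ys \<noteq> []" "hd ys = hd ?zs" "last ys = last ?zs" "distinct ys" "walk_edges ys \<subseteq> walk_edges ?zs"
        using "1.IH"[rule_format, OF len] by blast
      then show ?thesis using sub ends by (intro exI[of _ ys]) auto
    qed (use 1 in auto)
  qed
  then show ?thesis using that by blast
qed

lemma paths_between_eq: "paths_between u v =
   {walk_edges xs | xs. xs \<noteq> [] \<and> hd xs = u \<and> last xs = v \<and> distinct xs \<and> walk_edges xs \<subseteq> lattice_edges}"
proof -
  have "(\<forall>i. Suc i < length xs \<longrightarrow> {xs ! i, xs ! Suc i} \<in> lattice_edges) \<longleftrightarrow> walk_edges xs \<subseteq> lattice_edges"
    for xs :: "'a vertex list"
    by (auto simp: walk_edges_def)
  then show ?thesis unfolding paths_between_def walk_edges_def[symmetric] by simp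
qed

lemma walk_contains_path:
  assumes "xs \<noteq> []" "walk_edges xs \<subseteq> lattice_edges"
  obtains \<gamma> where "\<gamma> \<in> paths_between (hd xs) (last xs)" "\<gamma> \<subseteq> walk_edges xs"
proof -
  obtain ys where ys: "ys \<noteq> []" "hd ys = hd xs" "last ys = last xs" "distinct ys" "walk_edges ys \<subseteq> walk_edges xs"
    by (rule loop_erasure[OF assms(1)])
  then have "walk_edges ys \<in> paths_between (hd xs) (last xs)"
    using assms(2) unfolding paths_between_eq by blast
  then show ?thesis using that ys by blast
qed

lemma path_finite: "\<gamma> \<in> paths_between u v \<Longrightarrow> finite \<gamma>"
  by (auto simp: paths_between_eq finite_walk_edges)

lemma path_subset: "\<gamma> \<in> paths_between u v \<Longrightarrow> \<gamma> \<subseteq> lattice_edges"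
  by (auto simp: paths_between_eq)

lemma path_concat:
  assumes "\<gamma> \<in> paths_between u v" "\<gamma>' \<in> paths_between v w"
  obtains \<eta> where "\<eta> \<in> paths_between u w" "\<eta> \<subseteq> \<gamma> \<union> \<gamma>'"
proof -
  obtain xs where xs: "xs \<noteq> []" "hd xs = u" "last xs = v" "walk_edges xs \<subseteq> lattice_edges" "\<gamma> = walk_edges xs"
    using assms(1) by (auto simp: paths_between_eq)
  obtain ys where ys: "ys \<noteq> []" "hd ys = v" "last ys = w" "walk_edges ys \<subseteq> lattice_edges" "\<gamma>' = walk_edges ys"
    using assms(2) by (auto simp: paths_between_eq)
  have xs': "xs = butlast xs @ [v]" using xs append_butlast_last_id[of xs] by simp
  have ys': "ys = v # tl ys" using ys by (cases ys) auto
  let ?zs = "butlast xs @ v # tl ys"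
  have e: "walk_edges ?zs = \<gamma> \<union> \<gamma>'"
    by (subst walk_edges_append) (simp only: xs(5) ys(5) xs'[symmetric] ys'[symmetric])
  have h: "hd ?zs = u" using xs xs' by (metis hd_append list.sel(1))
  have l: "last ?zs = w" using ys ys' by (metis last_appendR list.discI)
  obtain \<eta> where "\<eta> \<in> paths_between (hd ?zs) (last ?zs)" "\<eta> \<subseteq> walk_edges ?zs"
    by (rule walk_contains_path[of ?zs]) (use e xs ys in auto)
  then show ?thesis using that e h l by simp
qed

lemma path_refl: "{} \<in> paths_between u u"
  unfolding paths_between_eq by (intro CollectI exI[of _ "[u]"]) auto

lemma path_edge: "{u, v} \<in> lattice_edges \<Longrightarrow> {{u, v}} \<in> paths_between u v"
  unfolding paths_between_eq using lattice_edge_iff[of u u]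
  by (intro CollectI exI[of _ "[u, v]"]) auto

lemma ex_short_path: "\<exists>\<gamma>\<in>paths_between u v. card \<gamma> \<le> dist1 u v"
proof (induction "dist1 u v" arbitrary: u)
  case 0
  then show ?case using path_refl by (intro bexI[of _ "{}"]) auto
next
  case (Suc n)
  then have "u \<noteq> v" by auto
  then obtain i where i: "u $ i \<noteq> v $ i" by (auto simp: vec_eq_iff)
  define u' where "u' = (\<chi> j. if j = i then u $ i + sgn (v $ i - u $ i) else u $ j)"
  have "dist1 u u' = (\<Sum>j\<in>UNIV. if j = i then 1 else 0)"
    unfolding dist1_def using i by (intro sum.cong) (auto simp: u'_def sgn_if)
  then have uu': "dist1 u u' = 1" by simp
  have "nat \<bar>u $ j - v $ j\<bar> = nat \<bar>u' $ j - v $ j\<bar> + (if j = i then 1 else 0)" for j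
    using i by (auto simp: u'_def sgn_if)
  then have "dist1 u v = dist1 u' v + 1" unfolding dist1_def by (simp add: sum.distrib)
  then have "n = dist1 u' v" using Suc by simp
  from Suc.hyps(1)[OF this] obtain \<gamma> where \<gamma>: "\<gamma> \<in> paths_between u' v" "card \<gamma> \<le> n" using \<open>n = dist1 u' v\<close> by auto
  obtain \<eta> where \<eta>: "\<eta> \<in> paths_between u v" "\<eta> \<subseteq> {{u, u'}} \<union> \<gamma>"
    using path_concat[OF path_edge \<gamma>(1)] uu' lattice_edge_iff by metis
  have "card \<eta> \<le> card ({{u, u'}} \<union> \<gamma>)" using \<eta> path_finite[OF \<gamma>(1)] by (intro card_mono) auto
  also have "\<dots> \<le> Suc (card \<gamma>)" by (simp add: card_insert_le_m1 path_finite[OF \<gamma>(1)] card_insert_if)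
  finally show ?case using \<gamma>(2) \<eta>(1) Suc.hyps(2) by (intro bexI[of _ \<eta>]) auto
qed

lemma paths_between_nonempty: "paths_between u v \<noteq> {}"
  using ex_short_path by blast

lemma countable_lattice_edges: "countable (lattice_edges :: 'd::finite edge set)"
proof (rule countable_subset)
  show "lattice_edges \<subseteq> (\<Union>n. lattice.touching (lball (0 :: 'd vertex) n))"
  proof
    fix e :: "'d edge" assume e: "e \<in> lattice_edges"
    then obtain x y where "e = {x, y}" using lattice.edges by blast
    then have "x \<in> e \<inter> lball 0 (dist1 0 x)" by (simp add: lball_def)
    then have "e \<in> lattice.touching (lball 0 (dist1 0 x))" using e by (auto simp: lattice.touching_def)
    then show "e \<in> (\<Union>n. lattice.touching (lball (0 :: 'd vertex) n))" by blast
  qed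
  show "countable (\<Union>n. lattice.touching (lball (0 :: 'd vertex) n))"
    by (rule countable_UN) (auto intro!: countable_finite lattice.finite_touching finite_lball)
qed

lemma countable_paths_between: "countable (paths_between u v)"
proof (rule countable_subset)
  show "paths_between u v \<subseteq> {\<gamma>. \<gamma> \<subseteq> lattice_edges \<and> finite \<gamma>}"
    using path_finite path_subset by blast
  show "countable {\<gamma>. \<gamma> \<subseteq> lattice_edges \<and> finite (\<gamma> :: 'a edge set)}"
    using countable_Collect_finite_subset[OF countable_lattice_edges] by (simp add: conj_commute)
qed

section \<open>Passage times as functions of the endpoints and of the weights\<close>

lemma path_time_nonneg:
  assumes "\<And>e. e \<in> lattice_edges \<Longrightarrow> 0 \<le> \<tau> e" "\<gamma> \<in> paths_between u v"
  shows "0 \<le> path_time \<tau> \<gamma>"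
  unfolding path_time_def using assms path_subset by (intro sum_nonneg) blast

lemma bdd_below_path_time:
  assumes "\<And>e. e \<in> lattice_edges \<Longrightarrow> 0 \<le> \<tau> e"
  shows "bdd_below (path_time \<tau> ` paths_between u v)"
  by (rule bdd_belowI[of _ 0]) (use assms path_time_nonneg[where \<tau> = \<tau>] in blast)

lemma ptime_le:
  assumes "\<And>e. e \<in> lattice_edges \<Longrightarrow> 0 \<le> \<tau> e" "\<gamma> \<in> paths_between u v"
  shows "ptime \<tau> u v \<le> path_time \<tau> \<gamma>"
  unfolding ptime_def using bdd_below_path_time[OF assms(1)] assms(2) by (rule cINF_lower)

lemma ptime_ge:
  assumes "\<And>\<gamma>. \<gamma> \<in> paths_between u v \<Longrightarrow> c \<le> path_time \<tau> \<gamma>"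
  shows "c \<le> ptime \<tau> u v"
  unfolding ptime_def using paths_between_nonempty assms by (rule cINF_greatest)

lemma ptime_nonneg:
  assumes "\<And>e. e \<in> lattice_edges \<Longrightarrow> 0 \<le> \<tau> e"
  shows "0 \<le> ptime \<tau> u v"
  by (rule ptime_ge) (use assms path_time_nonneg[where \<tau> = \<tau>] in blast)

lemma ptime_approx:
  assumes "0 < \<epsilon>"
  obtains \<gamma> where "\<gamma> \<in> paths_between u v" "path_time \<tau> \<gamma> < ptime \<tau> u v + \<epsilon>"
proof -
  have "\<exists>\<gamma>\<in>paths_between u v. path_time \<tau> \<gamma> < ptime \<tau> u v + \<epsilon>"
  proof (rule ccontr)
    assume "\<not> ?thesis"
    then have "ptime \<tau> u v + \<epsilon> \<le> ptime \<tau> u v" by (intro ptime_ge) auto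
    then show False using assms by simp
  qed
  then show ?thesis using that by blast
qed

lemma ptime_triangle:
  assumes "\<And>e. e \<in> lattice_edges \<Longrightarrow> 0 \<le> \<tau> e"
  shows "ptime \<tau> u w \<le> ptime \<tau> u v + ptime \<tau> v w"
proof (rule field_le_epsilon)
  fix \<epsilon> :: real assume "0 < \<epsilon>"
  then have \<epsilon>: "0 < \<epsilon> / 2" by simp
  obtain \<gamma> where \<gamma>: "\<gamma> \<in> paths_between u v" "path_time \<tau> \<gamma> < ptime \<tau> u v + \<epsilon> / 2"
    by (rule ptime_approx[OF \<epsilon>])
  obtain \<gamma>' where \<gamma>': "\<gamma>' \<in> paths_between v w" "path_time \<tau> \<gamma>' < ptime \<tau> v w + \<epsilon> / 2"
    by (rule ptime_approx[OF \<epsilon>])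
  obtain \<eta> where \<eta>: "\<eta> \<in> paths_between u w" "\<eta> \<subseteq> \<gamma> \<union> \<gamma>'" by (rule path_concat[OF \<gamma>(1) \<gamma>'(1)])
  have fin: "finite \<gamma>" "finite \<gamma>'" using \<gamma>(1) \<gamma>'(1) path_finite by auto
  have sub: "\<gamma> \<subseteq> lattice_edges" "\<gamma>' \<subseteq> lattice_edges" using \<gamma>(1) \<gamma>'(1) path_subset by auto
  have "ptime \<tau> u w \<le> path_time \<tau> \<eta>" by (rule ptime_le[OF assms \<eta>(1)])
  also have "\<dots> \<le> path_time \<tau> (\<gamma> \<union> \<gamma>')"
    unfolding path_time_def using fin sub \<eta> assms by (intro sum_mono2) auto
  also have "\<dots> \<le> path_time \<tau> \<gamma> + path_time \<tau> \<gamma>'"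
  proof -
    have "0 \<le> sum \<tau> (\<gamma> \<inter> \<gamma>')" using sub assms by (intro sum_nonneg) auto
    then show ?thesis
      unfolding path_time_def using sum.union_inter[OF fin, of \<tau>] by simp
  qed
  also have "\<dots> \<le> ptime \<tau> u v + ptime \<tau> v w + \<epsilon>" using \<gamma> \<gamma>' by simp
  finally show "ptime \<tau> u w \<le> ptime \<tau> u v + ptime \<tau> v w + \<epsilon>" .
qed

lemma ptime_le_dist1:
  assumes "\<And>e. e \<in> lattice_edges \<Longrightarrow> 0 \<le> \<tau> e \<and> \<tau> e \<le> M"
  shows "ptime \<tau> u v \<le> M * dist1 u v"
proof -
  obtain \<gamma> where \<gamma>: "\<gamma> \<in> paths_between u v" "card \<gamma> \<le> dist1 u v" using ex_short_path by blast
  have M: "0 \<le> M" using assms lattice_edges_nonempty by force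
  have "ptime \<tau> u v \<le> path_time \<tau> \<gamma>" using assms \<gamma> by (intro ptime_le) auto
  also have "\<dots> \<le> (\<Sum>e\<in>\<gamma>. M)"
    unfolding path_time_def using assms path_subset[OF \<gamma>(1)] by (intro sum_mono) auto
  also have "\<dots> \<le> M * dist1 u v" using \<gamma> M by (simp add: mult.commute mult_left_mono)
  finally show ?thesis .
qed

lemma ptime_Lipschitz:
  assumes "\<And>e. e \<in> lattice_edges \<Longrightarrow> 0 \<le> \<tau> e \<and> \<tau> e \<le> M"
  shows "\<bar>ptime \<tau> u v - ptime \<tau> u' v'\<bar> \<le> M * dist1 u u' + M * dist1 v v'"
proof -
  have nn: "\<And>e. e \<in> lattice_edges \<Longrightarrow> 0 \<le> \<tau> e" using assms by auto
  have bd: "ptime \<tau> x y \<le> M * dist1 x y" for x y by (rule ptime_le_dist1[OF assms])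
  have "ptime \<tau> u v \<le> M * dist1 u u' + ptime \<tau> u' v' + M * dist1 v v'" for u v u' v'
  proof -
    have "ptime \<tau> u v \<le> ptime \<tau> u u' + ptime \<tau> u' v" by (rule ptime_triangle[OF nn])
    also have "ptime \<tau> u' v \<le> ptime \<tau> u' v' + ptime \<tau> v' v" by (rule ptime_triangle[OF nn])
    finally show ?thesis
      using bd[of u u'] bd[of v' v] by (simp add: dist1_commute)
  qed
  from this[of u v u' v'] this[of u' v' u v] show ?thesis by (simp add: dist1_commute abs_le_iff)
qed

lemma ptime_cong:
  assumes "\<And>e. e \<in> lattice_edges \<Longrightarrow> \<tau> e = \<tau>' e"
  shows "ptime \<tau> u v = ptime \<tau>' u v"
  unfolding ptime_def path_time_def
  using assms path_subset by (intro INF_cong refl sum.cong) blast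

lemma ptime_concave:
  assumes "0 \<le> a" "0 \<le> b" "\<And>e. e \<in> lattice_edges \<Longrightarrow> 0 \<le> \<tau> e \<and> 0 \<le> \<tau>' e"
  shows "a * ptime \<tau> u v + b * ptime \<tau>' u v \<le> ptime (\<lambda>e. a * \<tau> e + b * \<tau>' e) u v"
proof (rule ptime_ge)
  fix \<gamma> assume \<gamma>: "\<gamma> \<in> paths_between u v"
  have "a * ptime \<tau> u v + b * ptime \<tau>' u v \<le> a * path_time \<tau> \<gamma> + b * path_time \<tau>' \<gamma>"
    using assms \<gamma> by (intro add_mono mult_left_mono ptime_le) auto
  then show "a * ptime \<tau> u v + b * ptime \<tau>' u v \<le> path_time (\<lambda>e. a * \<tau> e + b * \<tau>' e) \<gamma>"
    by (simp add: path_time_def sum_distrib_left sum.distrib)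
qed

text \<open>On any path the changed edges cost at most \<open>M\<close> each. The bound does not
  depend on the endpoints, which makes limits of rescaled passage times blind to finite
  changes.\<close>

lemma ptime_finite_change:
  assumes "\<And>e. e \<in> lattice_edges \<Longrightarrow> 0 \<le> \<tau> e \<and> \<tau> e \<le> M" "\<And>e. e \<in> lattice_edges \<Longrightarrow> 0 \<le> \<tau>' e \<and> \<tau>' e \<le> M"
    and F: "finite F" "\<And>e. e \<in> lattice_edges - F \<Longrightarrow> \<tau> e = \<tau>' e"
  shows "ptime \<tau> u v \<le> ptime \<tau>' u v + M * card F"
proof -
  have M: "0 \<le> M" using assms lattice_edges_nonempty by force
  have "ptime \<tau> u v - M * card F \<le> ptime \<tau>' u v"
  proof (rule ptime_ge)
    fix \<gamma> assume \<gamma>: "\<gamma> \<in> paths_between u v"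
    note sub = path_subset[OF \<gamma>] and fin = path_finite[OF \<gamma>]
    have "path_time \<tau> \<gamma> = sum \<tau> (\<gamma> - F) + sum \<tau> (\<gamma> \<inter> F)"
      unfolding path_time_def using fin by (metis Diff_Diff_Int Diff_subset add.commute sum.subset_diff inf_le1)
    also have "sum \<tau> (\<gamma> - F) = sum \<tau>' (\<gamma> - F)" using F sub by (intro sum.cong) auto
    also have "\<dots> \<le> path_time \<tau>' \<gamma>"
      unfolding path_time_def using assms(2) sub fin by (intro sum_mono2) auto
    also have "sum \<tau> (\<gamma> \<inter> F) \<le> (\<Sum>e\<in>\<gamma> \<inter> F. M)" using assms(1) sub by (intro sum_mono) auto
    also have "\<dots> \<le> M * card F"
      using M F(1) card_mono[of F "\<gamma> \<inter> F"] by (simp add: mult.commute mult_left_mono)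
    finally have "path_time \<tau> \<gamma> \<le> path_time \<tau>' \<gamma> + M * card F" by simp
    moreover have "ptime \<tau> u v \<le> path_time \<tau> \<gamma>" using assms \<gamma> by (intro ptime_le) auto
    ultimately show "ptime \<tau> u v - M * card F \<le> path_time \<tau>' \<gamma>" by simp
  qed
  then show ?thesis by simp
qed

lemma translate_path:
  assumes "\<gamma> \<in> paths_between u v"
  shows "(`) ((+) z) ` \<gamma> \<in> paths_between (z + u) (z + v)"
proof -
  obtain xs where xs: "xs \<noteq> []" "hd xs = u" "last xs = v" "distinct xs" "walk_edges xs \<subseteq> lattice_edges" "\<gamma> = walk_edges xs"
    using assms by (auto simp: paths_between_eq)
  have "(`) ((+) z) ` \<gamma> = walk_edges (map ((+) z) xs)" by (simp add: xs walk_edges_map)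
  moreover have "walk_edges (map ((+) z) xs) \<subseteq> lattice_edges"
    using xs translate_edge_iff by (auto simp: walk_edges_map)
  moreover have "distinct (map ((+) z) xs)" using xs by (simp add: distinct_map)
  moreover have "hd (map ((+) z) xs) = z + u" "last (map ((+) z) xs) = z + v"
    using xs by (auto simp: hd_map last_map)
  ultimately show ?thesis unfolding paths_between_eq using xs(1)
    by (intro CollectI exI[of _ "map ((+) z) xs"]) auto
qed

lemma path_time_translate: "path_time \<tau> ((`) ((+) z) ` \<gamma>) = path_time (\<lambda>e. \<tau> ((+) z ` e)) \<gamma>"
  unfolding path_time_def
  by (subst sum.reindex) (auto simp: inj_on_def inj_image_eq_iff)

lemma ptime_translate: "ptime \<tau> (z + u) (z + v) = ptime (\<lambda>e. \<tau> ((+) z ` e)) u v"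
proof -
  have "paths_between (z + u) (z + v) = (`) ((`) ((+) z)) ` paths_between u v"
  proof
    show "paths_between (z + u) (z + v) \<subseteq> (`) ((`) ((+) z)) ` paths_between u v"
    proof
      fix \<gamma> assume "\<gamma> \<in> paths_between (z + u) (z + v)"
      from translate_path[OF this, of "- z"] have "(`) ((+) (- z)) ` \<gamma> \<in> paths_between u v"
        by (simp add: add.assoc[symmetric])
      moreover have "\<gamma> = (`) ((+) z) ` (`) ((+) (- z)) ` \<gamma>" by (simp add: image_image)
      ultimately show "\<gamma> \<in> (`) ((`) ((+) z)) ` paths_between u v" by blast
    qed
  qed (auto simp: translate_path)
  then show ?thesis unfolding ptime_def by (simp add: image_image path_time_translate)
qed

lemma path_reach: "\<gamma> \<in> paths_between u v \<Longrightarrow> (u, v) \<in> (conn \<gamma>)\<^sup>*"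
proof -
  have "xs \<noteq> [] \<Longrightarrow> (hd xs, last xs) \<in> (conn (walk_edges xs))\<^sup>*" for xs :: "'a vertex list"
  proof (induction xs)
    case (Cons x xs)
    show ?case
    proof (cases xs)
      case (Cons y ys)
      have "(conn (walk_edges xs))\<^sup>* \<subseteq> (conn (walk_edges (x # xs)))\<^sup>*"
        by (intro rtrancl_mono conn_mono) (auto simp: Cons)
      moreover have "(x, y) \<in> conn (walk_edges (x # xs))" by (simp add: Cons conn_def)
      ultimately show ?thesis using Cons.IH Cons by (auto intro: converse_rtrancl_into_rtrancl)
    qed auto
  qed auto
  then show "\<gamma> \<in> paths_between u v \<Longrightarrow> (u, v) \<in> (conn \<gamma>)\<^sup>*" by (auto simp: paths_between_eq)
qed

section \<open>Subadditive processes\<close>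

lemma (in prob_space) measure_preserving_funpow:
  assumes S: "S \<in> measurable M M" "distr M M S = M"
  shows "(S ^^ n) \<in> measurable M M" and "distr M M (S ^^ n) = M"
proof -
  have "(S ^^ n) \<in> measurable M M \<and> distr M M (S ^^ n) = M"
  proof (induction n)
    case 0
    then show ?case using distr_id[of M] by (simp add: id_def)
  next
    case (Suc n)
    then have m: "(S ^^ n) \<in> measurable M M" by simp
    have "distr M M (S \<circ> (S ^^ n)) = distr (distr M M (S ^^ n)) M S"
      using m S by (subst distr_distr) auto
    then have "distr M M (S \<circ> (S ^^ n)) = M" using Suc S by simp
    then show ?case using measurable_comp[OF m S(1)] by (simp only: funpow.simps)
  qed
  then show "(S ^^ n) \<in> measurable M M" "distr M M (S ^^ n) = M" by auto
qed

text \<open>The stopping-time argument of Katznelson and Weiss: cutting an orbit greedily into stretches on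
  which the process is below slope \<open>c\<close> bounds its mean by about \<open>c n\<close>.\<close>

lemma (in prob_space) subadditive_stopping_bound:
  fixes f :: "nat \<Rightarrow> 'a \<Rightarrow> real" and c g :: real
  assumes S: "S \<in> measurable M M" "distr M M S = M"
    and f: "\<And>n. f n \<in> borel_measurable M"
    and C: "0 \<le> C" "\<And>n x. x \<in> space M \<Longrightarrow> \<bar>f n x\<bar> \<le> C * n"
    and sub: "\<And>n k x. x \<in> space M \<Longrightarrow> f (n + k) x \<le> f n x + f k ((S ^^ n) x)"
    and g: "\<And>n. g * n \<le> expectation (f n)"
    and io: "AE x in M. \<exists>\<^sub>F n in sequentially. f n x < c * n"
  shows "g \<le> c"
proof -
  \<comment> \<open>No stretch of length at most \<open>k\<close> starting at a bad point lies below
    slope \<open>c\<close>.\<close>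
  define bad where "bad k = {x\<in>space M. \<forall>a\<in>{1..k}. c * a \<le> f a x}" for k
  define D where "D = C + \<bar>c\<bar>"
  have D0: "0 \<le> D" using C by (simp add: D_def)
  have bad_sets: "bad k \<in> sets M" for k
    unfolding bad_def using f by measurable
  note Sn = measure_preserving_funpow[OF S]
  have Ssp: "(S ^^ n) x \<in> space M" if "x \<in> space M" for n x
    using measurable_space[OF Sn(1) that] .
  \<comment> \<open>Induction on the remaining length. From a bad point one step is taken, whose
    excess over \<open>c\<close> is at most \<open>D\<close>; from any other point a stretch below
    slope \<open>c\<close>. A last stretch that would overshoot is shorter than \<open>k\<close> and
    costs at most \<open>D * k\<close>.\<close>
  have main: "f n x \<le> c * n + D * (\<Sum>j<n. indicator (bad k) ((S ^^ j) x)) + D * k"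
    if "x \<in> space M" for n k x
    using that
  proof (induction n arbitrary: x rule: less_induct)
    case (less n)
    let ?I = "\<lambda>j x. indicator (bad k) ((S ^^ j) x) :: real"
    have fn: "f n x \<le> C * n" using C(2)[OF less.prems, of n] by simp
    have cC: "(C - c) * a \<le> D * b" if "a \<le> b" for a b :: nat
    proof -
      have "(C - c) * a \<le> D * a" unfolding D_def by (intro mult_right_mono) auto
      also have "\<dots> \<le> D * b" using that D0 by (intro mult_left_mono) auto
      finally show ?thesis .
    qed
    have nn: "0 \<le> D * (\<Sum>j<m. ?I j y)" for m :: nat and y using D0 by (intro mult_nonneg_nonneg sum_nonneg) auto
    have split: "(\<Sum>j<a + m. ?I j x) = (\<Sum>j<a. ?I j x) + (\<Sum>j<m. ?I j ((S ^^ a) x))" for a m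
      by (induction m) (simp_all add: funpow_add add.commute[of a])
    show ?case
    proof (cases "n = 0")
      case True
      then show ?thesis using fn mult_nonneg_nonneg[OF D0, of "real k"] by simp
    next
      case n: False
      show ?thesis
      proof (cases "x \<in> bad k")
        case True
        have "f n x \<le> f 1 x + f (n - 1) ((S ^^ 1) x)" using sub[OF less.prems, of 1 "n - 1"] n by simp
        also have "f 1 x \<le> C" using C(2)[OF less.prems, of 1] by simp
        also have "f (n - 1) ((S ^^ 1) x) \<le> c * real (n - 1) + D * (\<Sum>j<n - 1. ?I j ((S ^^ 1) x)) + D * k"
          using n by (intro less.IH Ssp less.prems) auto
        also have "(\<Sum>j<n - 1. ?I j ((S ^^ 1) x)) = (\<Sum>j<n. ?I j x) - 1"
          using split[of 1 "n - 1"] n True by simp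
        finally have "f n x \<le> C + (c * real (n - 1) + D * ((\<Sum>j<n. ?I j x) - 1) + D * k)" by simp
        moreover have "c * real (n - 1) = c * n - c" using n by (simp add: of_nat_diff algebra_simps)
        moreover have "C - c \<le> D" by (simp add: D_def)
        ultimately show ?thesis by (simp add: algebra_simps)
      next
        case False
        then obtain a where a: "a \<in> {1..k}" "f a x < c * a" using less.prems by (auto simp: bad_def not_le)
        show ?thesis
        proof (cases "a \<le> n")
          case True
          have "f n x \<le> f a x + f (n - a) ((S ^^ a) x)" using sub[OF less.prems, of a "n - a"] True by simp
          also have "f (n - a) ((S ^^ a) x) \<le> c * real (n - a) + D * (\<Sum>j<n - a. ?I j ((S ^^ a) x)) + D * k"
            using n a by (intro less.IH Ssp less.prems) auto
          finally have "f n x \<le> c * a + (c * real (n - a) + D * (\<Sum>j<n - a. ?I j ((S ^^ a) x)) + D * k)"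
            using a by simp
          moreover have "c * a + c * real (n - a) = c * n" using True by (simp add: of_nat_diff algebra_simps)
          moreover have "D * (\<Sum>j<n - a. ?I j ((S ^^ a) x)) \<le> D * (\<Sum>j<n. ?I j x)"
            using split[of a "n - a"] True nn[of x a]
            by (simp add: distrib_left) 
          ultimately show ?thesis by linarith
        next
          case False
          then have "(C - c) * n \<le> D * k" using a by (intro cC) auto
          then show ?thesis using fn nn[of x n] by (simp add: algebra_simps)
        qed
      qed
    qed
  qed
  have bound: "g \<le> c + D * prob (bad k)" for k
  proof -
    \<comment> \<open>By invariance each visit to the bad set has the same probability. The term
      \<open>D * k\<close> does not grow with \<open>n\<close>, so the coefficient of
      \<open>n\<close> cannot be positive.\<close>
    have n: "(g - c - D * prob (bad k)) * n \<le> D * k" for n :: nat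
    proof -
      have int1: "integrable M (\<lambda>x. indicator (bad k) ((S ^^ j) x) :: real)" for j
        using measurable_compose[OF Sn(1)[of j] borel_measurable_indicator[OF bad_sets[of k]]]
        by (intro integrable_const_bound[where B = 1]) auto
      have E1: "expectation (\<lambda>x. indicator (bad k) ((S ^^ j) x)) = prob (bad k)" for j
      proof -
        have "expectation (\<lambda>x. indicator (bad k) ((S ^^ j) x) :: real) = (\<integral>y. indicator (bad k) y \<partial>distr M M (S ^^ j))"
          by (rule integral_distr[OF Sn(1) borel_measurable_indicator[OF bad_sets], symmetric])
        then show ?thesis using bad_sets[of k] by (simp add: Sn(2))
      qed
      have "g * n \<le> expectation (f n)" by (rule g)
      also have "\<dots> \<le> expectation (\<lambda>x. c * n + D * (\<Sum>j<n. indicator (bad k) ((S ^^ j) x)) + D * k)"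
      proof (rule integral_mono)
        show "integrable M (f n)"
          using C(2) f by (intro integrable_const_bound[where B = "C * n"]) auto
        show "integrable M (\<lambda>x. c * n + D * (\<Sum>j<n. indicator (bad k) ((S ^^ j) x)) + D * k)"
          using int1 by (intro Bochner_Integration.integrable_add integrable_const
              Bochner_Integration.integrable_mult_right Bochner_Integration.integrable_sum)
      qed (use main in auto)
      also have "\<dots> = c * n + D * (n * prob (bad k)) + D * k"
        using int1 by (simp add: E1 prob_space)
      finally show ?thesis by (simp add: algebra_simps)
    qed
    have "g - c - D * prob (bad k) \<le> 0"
    proof (rule ccontr)
      assume "\<not> ?thesis"
      then have pos: "0 < g - c - D * prob (bad k)" by simp
      from reals_Archimedean3[OF pos] obtain n where "D * k < real n * (g - c - D * prob (bad k))" by blast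
      with n[of n] show False by (simp add: mult.commute)
    qed
    then show ?thesis by simp
  qed
  \<comment> \<open>Now \<open>k\<close> grows: by \<open>io\<close> almost every point stops being
    bad eventually.\<close>
  have "(\<lambda>k. prob (bad k)) \<longlonglongrightarrow> prob (\<Inter>k. bad k)"
  proof (rule finite_Lim_measure_decseq)
    show "decseq bad" by (rule decseq_SucI) (auto simp: bad_def)
  qed (use bad_sets in auto)
  moreover have "prob (\<Inter>k. bad k) = 0"
  proof -
    have "AE x in M. x \<notin> (\<Inter>k. bad k)"
      using io
    proof eventually_elim
      case (elim x)
      then obtain n where n: "n \<ge> 1" "f n x < c * n" unfolding frequently_sequentially by blast
      then have "x \<notin> bad n" by (auto simp: bad_def intro!: bexI[of _ n])
      then show ?case by blast
    qed
    then show ?thesis using bad_sets by (subst prob_eq_0) auto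
  qed
  ultimately have "(\<lambda>k. c + D * prob (bad k)) \<longlonglongrightarrow> c + D * 0"
    by (intro tendsto_intros) auto
  then have "g \<le> c + D * 0" by (rule LIMSEQ_le_const) (use bound in auto)
  then show ?thesis by simp
qed

text \<open>The event in \<open>zero_one\<close> says that the lower limit of \<open>f n / n\<close>
  is at most \<open>c\<close>. For \<open>c < g\<close> it cannot have probability 1 by the stopping
  bound, hence it has probability 0. The slack \<open>1 / Suc k\<close> makes the event insensitive
  to bounded changes of \<open>f\<close>.\<close>

lemma (in prob_space) subadditive_liminf:
  fixes f :: "nat \<Rightarrow> 'a \<Rightarrow> real" and c g :: real
  assumes S: "S \<in> measurable M M" "distr M M S = M"
    and f: "\<And>n. f n \<in> borel_measurable M"
    and C: "0 \<le> C" "\<And>n x. x \<in> space M \<Longrightarrow> \<bar>f n x\<bar> \<le> C * n"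
    and sub: "\<And>n k x. x \<in> space M \<Longrightarrow> f (n + k) x \<le> f n x + f k ((S ^^ n) x)"
    and g: "\<And>n. g * n \<le> expectation (f n)"
    and zero_one: "\<And>c. prob {x\<in>space M. \<forall>k. \<exists>\<^sub>F n in sequentially. f n x < (c + 1 / Suc k) * n} \<in> {0, 1}"
    and c: "c < g"
  shows "AE x in M. \<forall>\<^sub>F n in sequentially. c * n \<le> f n x"
proof -
  define B where "B = {x\<in>space M. \<forall>k. \<exists>\<^sub>F n in sequentially. f n x < (c + 1 / Suc k) * n}"
  have B: "B \<in> sets M"
    unfolding B_def frequently_sequentially using f by measurable
  \<comment> \<open>The stopping bound is applied at the slope \<open>c + 1 / Suc k\<close>, still
    below \<open>g\<close>.\<close>
  obtain k where k: "1 / real (Suc k) < g - c" using reals_Archimedean[of "g - c"] c by (auto simp: inverse_eq_divide)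
  have "prob B \<noteq> 1"
  proof
    assume "prob B = 1"
    then have "AE x in M. x \<in> B" using B by (simp add: prob_eq_1)
    then have "AE x in M. \<exists>\<^sub>F n in sequentially. f n x < (c + 1 / Suc k) * n"
      by eventually_elim (auto simp: B_def)
    then have "g \<le> c + 1 / Suc k"
      using subadditive_stopping_bound[where f = f and S = S and C = C and g = g and c = "c + 1 / Suc k", OF S f C sub g]
      by blast
    then show False using k by simp
  qed
  then have "prob B = 0" using zero_one[of c] by (auto simp: B_def)
  then have "AE x in M. x \<notin> B" using B by (simp add: prob_eq_0)
  from this AE_space show ?thesis
  proof eventually_elim
    case (elim x)
    then obtain k where "\<not> (\<exists>\<^sub>F n in sequentially. f n x < (c + 1 / Suc k) * n)" by (auto simp: B_def)
    then have "\<forall>\<^sub>F n in sequentially. (c + 1 / Suc k) * n \<le> f n x" by (simp add: not_frequently not_less)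
    then show ?case
    proof eventually_elim
      case (elim n)
      have "c * n \<le> (c + 1 / Suc k) * n" by (intro mult_right_mono) auto
      then show ?case using elim by simp
    qed
  qed
qed

text \<open>Kolmogorov's law along an enumeration of \<open>I\<close>. It stands in for ergodicity
  of the translations, since the events needed here do not notice finitely many edges.\<close>

lemma zero_one_finite_change:
  fixes K :: "'l measure" and I :: "'i set"
  assumes K: "prob_space K" and I: "countable I" "infinite I"
    and B: "B \<in> sets (\<Pi>\<^sub>M i\<in>I. K)"
    and inv: "\<And>\<omega> \<omega>'. \<omega> \<in> space (\<Pi>\<^sub>M i\<in>I. K) \<Longrightarrow> \<omega>' \<in> space (\<Pi>\<^sub>M i\<in>I. K) \<Longrightarrow>
        finite {i\<in>I. \<omega> i \<noteq> \<omega>' i} \<Longrightarrow> \<omega> \<in> B \<Longrightarrow> \<omega>' \<in> B"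
  shows "measure (\<Pi>\<^sub>M i\<in>I. K) B \<in> {0, 1}"
proof -
  let ?P = "\<Pi>\<^sub>M i\<in>I. K"
  interpret K: prob_space K by (rule K)
  interpret P: prob_space ?P using K by (intro prob_space_PiM)
  obtain en :: "nat \<Rightarrow> 'i" where en: "bij_betw en UNIV I"
    using I by (metis bij_betw_from_nat_into)
  have enI: "en n \<in> I" for n using en by (auto simp: bij_betw_def)
  define X where "X n \<omega> = \<omega> (en n)" for n and \<omega> :: "'i \<Rightarrow> 'l"
  have X: "X n \<in> measurable ?P K" for n unfolding X_def using enI by simp
  have "P.indep_vars (\<lambda>_. K) X UNIV"
  proof (subst P.indep_vars_iff_distr_eq_PiM')
    have "distr ?P (\<Pi>\<^sub>M n\<in>UNIV. K) (\<lambda>\<omega>. \<lambda>n\<in>UNIV. \<omega> (en n)) = (\<Pi>\<^sub>M n\<in>(UNIV :: nat set). K)"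
      using en enI K by (intro distr_PiM_reindex) (auto simp: bij_betw_def)
    moreover have "distr ?P K (X n) = K" for n
      unfolding X_def using distr_PiM_component[of I "\<lambda>_. K" "en n"] K enI by simp
    ultimately show "distr ?P (\<Pi>\<^sub>M n\<in>UNIV. K) (\<lambda>\<omega>. \<lambda>n\<in>UNIV. X n \<omega>) = (\<Pi>\<^sub>M n\<in>UNIV. distr ?P K (X n))"
      by (simp add: X_def)
  qed (use X in auto)
  then have ind: "P.indep_sets (\<lambda>n. {X n -` A \<inter> space ?P | A. A \<in> sets K}) UNIV"
    by (simp add: P.indep_vars_def2)
  let ?A = "\<lambda>n. {X n -` A \<inter> space ?P | A. A \<in> sets K}"
  have "P.prob B = 0 \<or> P.prob B = 1"
  proof (rule P.kolmogorov_0_1_law[OF _ ind])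
    show "sigma_algebra (space ?P) (?A n)" for n
    proof -
      have "X n \<in> space ?P \<rightarrow> space K" using measurable_space[OF X] by auto
      then have "sets (vimage_algebra (space ?P) (X n) K) = ?A n" by (rule sets_vimage_algebra2)
      then show ?thesis using sets.sigma_algebra_axioms[of "vimage_algebra (space ?P) (X n) K"] by simp
    qed
    obtain a0 where a0: "a0 \<in> space K" using K.not_empty by blast
    have "B \<in> sigma_sets (space ?P) (\<Union>(?A ` {n..}))" for n
    proof -
      let ?N = "sigma (space ?P) (\<Union>(?A ` {n..}))"
      have sub: "\<Union>(?A ` {n..}) \<subseteq> Pow (space ?P)" by auto
      have spN: "space ?N = space ?P" using sub by (simp add: space_measure_of)
      have setsN: "sets ?N = sigma_sets (space ?P) (\<Union>(?A ` {n..}))" using sub by (simp add: sets_measure_of)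
      \<comment> \<open>Overwriting the first \<open>n\<close> coordinates changes only finitely
        many, so \<open>B\<close> is its own preimage under \<open>r\<close>; and \<open>r\<close>
        reads only coordinates from \<open>n\<close> on.\<close>
      define r where "r \<omega> = (\<lambda>i\<in>I. if i \<in> en ` {..<n} then a0 else \<omega> i)" for \<omega> :: "'i \<Rightarrow> 'l"
      have XN: "(\<lambda>\<omega>. \<omega> (en m)) \<in> measurable ?N K" if "n \<le> m" for m
      proof (rule measurableI)
        fix \<omega> assume "\<omega> \<in> space ?N"
        then show "\<omega> (en m) \<in> space K" using enI spN by (auto simp: space_PiM)
      next
        fix A assume "A \<in> sets K"
        then have "(\<lambda>\<omega>. \<omega> (en m)) -` A \<inter> space ?N \<in> ?A m" unfolding spN by (auto simp: X_def[abs_def])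
        then show "(\<lambda>\<omega>. \<omega> (en m)) -` A \<inter> space ?N \<in> sets ?N"
          unfolding setsN using that by (intro sigma_sets.Basic) blast
      qed
      have r: "r \<in> measurable ?N ?P"
        unfolding r_def
      proof (rule measurable_restrict)
        fix i assume i: "i \<in> I"
        show "(\<lambda>\<omega>. if i \<in> en ` {..<n} then a0 else \<omega> i) \<in> measurable ?N K"
        proof (cases "i \<in> en ` {..<n}")
          case True
          then show ?thesis using a0 by simp
        next
          case False
          obtain m where "i = en m" using i en by (auto simp: bij_betw_def)
          then show ?thesis using XN[of m] False by (cases "n \<le> m") auto
        qed
      qed
      have rB: "r -` B \<inter> space ?N = B"
      proof -
        have "r \<omega> \<in> B \<longleftrightarrow> \<omega> \<in> B" if w: "\<omega> \<in> space ?P" for \<omega>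
        proof -
          have "{i\<in>I. r \<omega> i \<noteq> \<omega> i} \<subseteq> en ` {..<n}" by (auto simp: r_def)
          then have fin: "finite {i\<in>I. r \<omega> i \<noteq> \<omega> i}" using finite_subset by blast
          then have fin': "finite {i\<in>I. \<omega> i \<noteq> r \<omega> i}" by (simp add: eq_commute)
          have rw: "r \<omega> \<in> space ?P" using measurable_space[OF r] w spN by auto
          show ?thesis using inv[OF rw w fin] inv[OF w rw fin'] by blast
        qed
        then show ?thesis using sets.sets_into_space[OF B] unfolding spN by auto
      qed
      have "r -` B \<inter> space ?N \<in> sets ?N" using measurable_sets[OF r B] .
      then show ?thesis unfolding rB setsN .
    qed
    then show "B \<in> P.tail_events ?A" by (simp add: P.tail_events_def)
  qed
  then show ?thesis by auto
qed

lemma liminf_zero_one: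
  fixes f :: "nat \<Rightarrow> ('i \<Rightarrow> 'l) \<Rightarrow> real" and c :: real
  assumes K: "prob_space K" and I: "countable I" "infinite I"
    and f: "\<And>n. f n \<in> borel_measurable (\<Pi>\<^sub>M i\<in>I. K)"
    and inv: "\<And>\<omega> \<omega>'. \<omega> \<in> space (\<Pi>\<^sub>M i\<in>I. K) \<Longrightarrow> \<omega>' \<in> space (\<Pi>\<^sub>M i\<in>I. K) \<Longrightarrow>
        finite {i\<in>I. \<omega> i \<noteq> \<omega>' i} \<Longrightarrow> \<exists>D. \<forall>n. f n \<omega>' \<le> f n \<omega> + D"
  shows "measure (\<Pi>\<^sub>M i\<in>I. K) {\<omega>\<in>space (\<Pi>\<^sub>M i\<in>I. K).
      \<forall>k. \<exists>\<^sub>F n in sequentially. f n \<omega> < (c + 1 / Suc k) * n} \<in> {0, 1}"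
proof (rule zero_one_finite_change[OF K I])
  let ?P = "\<Pi>\<^sub>M i\<in>I. K"
  show "{\<omega>\<in>space ?P. \<forall>k. \<exists>\<^sub>F n in sequentially. f n \<omega> < (c + 1 / Suc k) * n} \<in> sets ?P"
    unfolding frequently_sequentially using f by measurable
  fix \<omega> \<omega>' assume w: "\<omega> \<in> space ?P" "\<omega>' \<in> space ?P" "finite {i\<in>I. \<omega> i \<noteq> \<omega>' i}"
    and B: "\<omega> \<in> {\<omega>\<in>space ?P. \<forall>k. \<exists>\<^sub>F n in sequentially. f n \<omega> < (c + 1 / Suc k) * n}"
  obtain D where D: "\<And>n. f n \<omega>' \<le> f n \<omega> + D" using inv[OF w] by blast
  have "\<exists>\<^sub>F n in sequentially. f n \<omega>' < (c + 1 / Suc k) * n" for k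
  proof -
    \<comment> \<open>\<open>Suc (Suc (2 * k))\<close> is twice \<open>Suc k\<close>: one half of
      the slack \<open>1 / Suc k\<close> is spent here, the other half absorbs
      \<open>D\<close>.\<close>
    have "\<exists>\<^sub>F n in sequentially. f n \<omega> < (c + 1 / Suc (Suc (2 * k))) * n" using B by blast
    moreover have "\<forall>\<^sub>F n in sequentially. 2 * Suc k * D \<le> real n"
      using eventually_ge_at_top[of "nat \<lceil>2 * Suc k * D\<rceil>"] by eventually_elim linarith
    ultimately show ?thesis
    proof (rule frequently_rev_mp[OF _ eventually_mono], intro impI)
      fix n assume n: "2 * Suc k * D \<le> real n" and fn: "f n \<omega> < (c + 1 / Suc (Suc (2 * k))) * n"
      have "D \<le> 1 / Suc (Suc (2 * k)) * n" using n by (simp add: field_simps)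
      moreover have "(c + 1 / Suc (Suc (2 * k))) * n + 1 / Suc (Suc (2 * k)) * n = (c + 1 / Suc k) * n"
        by (simp add: divide_simps) (simp add: algebra_simps)?
      ultimately show "f n \<omega>' < (c + 1 / Suc k) * n" using D[of n] fn by linarith
    qed
  qed
  then show "\<omega>' \<in> {\<omega>\<in>space ?P. \<forall>k. \<exists>\<^sub>F n in sequentially. f n \<omega> < (c + 1 / Suc k) * n}" using w by blast
qed

section \<open>Time constants\<close>

definition env :: "'l measure \<Rightarrow> ('d::finite edge \<Rightarrow> 'l) measure" where
  "env K = (\<Pi>\<^sub>M e\<in>lattice_edges. K)"

text \<open>The environment consists of labels and the weight function \<open>w\<close> is a
  parameter, so that different weights can be compared on the same environment.\<close>

definition ttime :: "('l \<Rightarrow> real) \<Rightarrow> ('d::finite edge \<Rightarrow> 'l) \<Rightarrow> 'd vertex \<Rightarrow> 'd vertex \<Rightarrow> real" where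
  "ttime w \<omega> = ptime (\<lambda>e. w (\<omega> e))"

definition shift_env :: "'d::finite vertex \<Rightarrow> ('d edge \<Rightarrow> 'l) \<Rightarrow> 'd edge \<Rightarrow> 'l" where
  "shift_env z \<omega> = (\<lambda>e\<in>lattice_edges. \<omega> ((+) z ` e))"

definition block_time :: "('l \<Rightarrow> real) \<Rightarrow> 'd::finite edge set set \<Rightarrow> ('d edge \<Rightarrow> 'l) \<Rightarrow> real" where
  "block_time w P \<omega> = (INF \<gamma>\<in>P. path_time (\<lambda>e. w (\<omega> e)) \<gamma>)"

lemma infinite_lattice_edges: "infinite (lattice_edges :: 'd::finite edge set)"
proof
  assume fin: "finite (lattice_edges :: 'd edge set)"
  have fe: "finite e" if "e \<in> lattice_edges" for e :: "'d edge" using lattice.edges[OF that] by auto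
  define V where "V = insert 0 (\<Union>(lattice_edges :: 'd edge set))"
  have finV: "finite V" using fin fe by (auto simp: V_def)
  have "v \<in> V" if "(0, v) \<in> (conn lattice_edges)\<^sup>*" for v
    using that by (induction rule: rtrancl_induct) (auto simp: V_def conn_def)
  moreover have "V \<subseteq> lball 0 (Max (dist1 0 ` V))" using finV by (auto simp: lball_def)
  ultimately show False using out_lattice_edges[of "Max (dist1 0 ` V)", where 'd = 'd] unfolding out_def by blast
qed

lemma prob_space_env: "prob_space K \<Longrightarrow> prob_space (env K)"
  unfolding env_def by (rule prob_space_PiM)

lemma env_component: "e \<in> lattice_edges \<Longrightarrow> (\<lambda>\<omega>. \<omega> e) \<in> measurable (env K) K"
  unfolding env_def by simp

lemma shift_env_measurable: "shift_env z \<in> measurable (env K) (env K)"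
  unfolding shift_env_def[abs_def] env_def
  by (intro measurable_restrict measurable_component_singleton) (simp add: translate_edge_iff)

lemma shift_env_distr:
  assumes "prob_space K"
  shows "distr (env K) (env K) (shift_env z) = env K"
proof -
  have "inj_on ((`) ((+) z)) lattice_edges" by (auto simp: inj_on_def inj_image_eq_iff)
  then show ?thesis
    unfolding shift_env_def[abs_def] env_def
    using assms by (intro distr_PiM_reindex) (auto simp: translate_edge_iff)
qed

lemma shift_env_funpow:
  "e \<in> lattice_edges \<Longrightarrow> (shift_env z ^^ n) \<omega> e = \<omega> ((+) (int n *s z) ` e)"
proof (induction n arbitrary: e)
  case (Suc n)
  have "(+) (int n *s z) ` (+) z ` e = (+) (int (Suc n) *s z) ` e"
    by (simp add: image_image algebra_simps vector_sadd_rdistrib[of "int n" 1 z, simplified] add.assoc)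
  then show ?case using Suc.IH[of "(+) z ` e"] Suc.prems
    by (simp add: shift_env_def translate_edge_iff)
qed simp

lemma ttime_shift_env_funpow:
  "ttime w ((shift_env z ^^ n) \<omega>) u v = ttime w \<omega> (int n *s z + u) (int n *s z + v)"
  unfolding ttime_def ptime_translate by (rule ptime_cong) (simp add: shift_env_funpow)

lemma dist1_scale: "dist1 0 (int n *s z) = n * dist1 0 z"
  unfolding dist1_def sum_distrib_left by (intro sum.cong) (auto simp: abs_mult nat_mult_distrib)

locale bounded_weight = K: prob_space K for K :: "'l measure" +
  fixes w :: "'l \<Rightarrow> real" and M :: real
  assumes w_measurable [measurable]: "w \<in> borel_measurable K"
    and w_nonneg: "0 \<le> w x" and w_le: "w x \<le> M"
begin

lemma M_nonneg: "0 \<le> M"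
  using w_nonneg w_le order_trans by blast

lemma path_time_measurable:
  assumes "\<gamma> \<in> paths_between u v"
  shows "(\<lambda>\<omega>. path_time (\<lambda>e. w (\<omega> e)) \<gamma>) \<in> borel_measurable (env K)"
  unfolding path_time_def using path_subset[OF assms]
  by (intro borel_measurable_sum measurable_compose[OF env_component w_measurable]) auto

lemma ttime_measurable [measurable]: "(\<lambda>\<omega>. ttime w \<omega> u v) \<in> borel_measurable (env K)"
  unfolding ttime_def ptime_def
  by (intro borel_measurable_cINF_real countable_paths_between path_time_measurable)

lemma ttime_nonneg: "0 \<le> ttime w \<omega> u v"
  unfolding ttime_def by (rule ptime_nonneg) (rule w_nonneg)

lemma ttime_le: "ttime w \<omega> u v \<le> M * dist1 u v"
  unfolding ttime_def by (rule ptime_le_dist1) (simp add: w_nonneg w_le)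

lemma ttime_triangle: "ttime w \<omega> u v' \<le> ttime w \<omega> u v + ttime w \<omega> v v'"
  unfolding ttime_def by (rule ptime_triangle) (rule w_nonneg)

lemma ttime_Lipschitz: "\<bar>ttime w \<omega> u v - ttime w \<omega> u' v'\<bar> \<le> M * dist1 u u' + M * dist1 v v'"
  unfolding ttime_def by (rule ptime_Lipschitz) (simp add: w_nonneg w_le)

lemma ttime_integrable: "integrable (env K) (\<lambda>\<omega>. ttime w \<omega> u v)"
proof -
  interpret E: prob_space "env K" by (rule prob_space_env) (rule K.prob_space_axioms)
  show ?thesis
    by (intro E.integrable_const_bound[where B = "M * dist1 u v"]) (auto simp: ttime_nonneg ttime_le)
qed

text \<open>The time constant in Fekete's form. As an infimum it bounds the mean from below for
  every \<open>n\<close>, as \<open>subadditive_liminf\<close> asks, and it is nearly attained at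
  some finite \<open>n\<close>, which supplies the block length for the upper bound.\<close>

definition mu :: "'d::finite vertex \<Rightarrow> real" where
  "mu z = (INF n\<in>{1..}. (\<integral>\<omega>. ttime w \<omega> 0 (int n *s z) \<partial>env K) / n)"

lemma expect_ttime_nonneg: "0 \<le> (\<integral>\<omega>. ttime w \<omega> u v \<partial>env K)"
  by (intro Bochner_Integration.integral_nonneg ttime_nonneg)

lemma mu_le: "mu z * n \<le> (\<integral>\<omega>. ttime w \<omega> 0 (int n *s z) \<partial>env K)"
proof (cases "n = 0")
  case True
  then show ?thesis by (simp add: expect_ttime_nonneg)
next
  case False
  have "mu z \<le> (\<integral>\<omega>. ttime w \<omega> 0 (int n *s z) \<partial>env K) / n"
    unfolding mu_def using False
    by (intro cINF_lower bdd_belowI[of _ 0]) (auto simp: expect_ttime_nonneg)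
  then show ?thesis using False by (simp add: field_simps)
qed

lemma mu_nonneg: "0 \<le> mu z"
  unfolding mu_def by (intro cINF_greatest) (auto simp: expect_ttime_nonneg)

lemma mu_approx:
  assumes "0 < \<delta>"
  obtains n where "1 \<le> n" "(\<integral>\<omega>. ttime w \<omega> 0 (int n *s z) \<partial>env K) < (mu z + \<delta>) * n"
proof -
  have "\<exists>n\<in>{1..}. (\<integral>\<omega>. ttime w \<omega> 0 (int n *s z) \<partial>env K) / n < mu z + \<delta>"
  proof (rule ccontr)
    assume "\<not> ?thesis"
    then have "mu z + \<delta> \<le> mu z" unfolding mu_def[of z] by (intro cINF_greatest) (auto simp: not_less)
    then show False using assms by simp
  qed
  then obtain n where n: "1 \<le> n" "(\<integral>\<omega>. ttime w \<omega> 0 (int n *s z) \<partial>env K) / n < mu z + \<delta>" by auto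
  then have "(\<integral>\<omega>. ttime w \<omega> 0 (int n *s z) \<partial>env K) < (mu z + \<delta>) * n" by (simp add: field_simps)
  then show ?thesis using n that by blast
qed

lemma ttime_liminf:
  fixes c :: real
  assumes "c < mu z"
  shows "AE \<omega> in env K. \<forall>\<^sub>F n in sequentially. c * n \<le> ttime w \<omega> 0 (int n *s z)"
proof -
  interpret E: prob_space "env K" by (rule prob_space_env) (rule K.prob_space_axioms)
  show ?thesis
  proof (rule E.subadditive_liminf[where S = "shift_env z" and C = "M * dist1 0 z" and g = "mu z"
        and f = "\<lambda>n \<omega>. ttime w \<omega> 0 (int n *s z)"])
    show "shift_env z \<in> measurable (env K) (env K)" by (rule shift_env_measurable)
    show "distr (env K) (env K) (shift_env z) = env K" by (rule shift_env_distr) (rule K.prob_space_axioms)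
    show "(\<lambda>\<omega>. ttime w \<omega> 0 (int n *s z)) \<in> borel_measurable (env K)" for n by (rule ttime_measurable)
    show "0 \<le> M * dist1 0 z" using M_nonneg by simp
    show "\<bar>ttime w \<omega> 0 (int n *s z)\<bar> \<le> M * dist1 0 z * n" for n \<omega>
      using ttime_nonneg[of \<omega> 0 "int n *s z"] ttime_le[of \<omega> 0 "int n *s z"] by (simp add: dist1_scale mult_ac)
    show "ttime w \<omega> 0 (int (n + k) *s z) \<le> ttime w \<omega> 0 (int n *s z) + ttime w ((shift_env z ^^ n) \<omega>) 0 (int k *s z)"
      for n k \<omega>
      using ttime_triangle[of \<omega> 0 "int (n + k) *s z" "int n *s z"]
      by (simp add: ttime_shift_env_funpow vector_sadd_rdistrib)
    show "mu z * n \<le> E.expectation (\<lambda>\<omega>. ttime w \<omega> 0 (int n *s z))" for n by (rule mu_le)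
    show "c < mu z" by (rule assms)
    show "E.prob {\<omega> \<in> space (env K). \<forall>k. \<exists>\<^sub>F n in sequentially. ttime w \<omega> 0 (int n *s z) < (c + 1 / Suc k) * n} \<in> {0, 1}" for c
      unfolding env_def
    proof (rule liminf_zero_one)
      fix \<omega> \<omega>' :: "'a edge \<Rightarrow> 'l"
      let ?D = "{e \<in> lattice_edges. \<omega> e \<noteq> \<omega>' e}"
      assume "finite ?D"
      then have "ttime w \<omega>' 0 (int n *s z) \<le> ttime w \<omega> 0 (int n *s z) + M * card ?D" for n
        unfolding ttime_def by (intro ptime_finite_change) (auto simp: w_nonneg w_le)
      then show "\<exists>D. \<forall>n. ttime w \<omega>' 0 (int n *s z) \<le> ttime w \<omega> 0 (int n *s z) + D" by blast
    qed (use K.prob_space_axioms countable_lattice_edges infinite_lattice_edges ttime_measurable[unfolded env_def] in auto)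
  qed
qed

section \<open>Passage times over finitely many paths and the upper bound\<close>

lemma block_time_measurable:
  assumes "P \<subseteq> paths_between u v" "finite P"
  shows "block_time w P \<in> borel_measurable (env K)"
  unfolding block_time_def using assms path_time_measurable
  by (intro borel_measurable_cINF_real countable_finite) auto

lemma path_time_le: "\<gamma> \<in> paths_between u v \<Longrightarrow> path_time (\<lambda>e. w (\<omega> e)) \<gamma> \<le> M * card \<gamma>"
  unfolding path_time_def using sum_bounded_above[of \<gamma> "\<lambda>e. w (\<omega> e)" M] by (simp add: w_le mult.commute)

lemma block_time_le:
  assumes "\<gamma> \<in> P" "finite P"
  shows "block_time w P \<omega> \<le> path_time (\<lambda>e. w (\<omega> e)) \<gamma>"
  unfolding block_time_def using assms by (intro cINF_lower bdd_below_finite) auto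

lemma ttime_le_block_time:
  assumes "P \<subseteq> paths_between u v" "P \<noteq> {}"
  shows "ttime w \<omega> u v \<le> block_time w P \<omega>"
  unfolding block_time_def using assms
  by (intro cINF_greatest) (auto simp: ttime_def w_nonneg intro!: ptime_le)

lemma block_time_bounds:
  assumes "P \<subseteq> paths_between u v" "finite P" "\<gamma> \<in> P"
  shows "0 \<le> block_time w P \<omega>" "block_time w P \<omega> \<le> M * card \<gamma>"
proof -
  have "0 \<le> ttime w \<omega> u v" by (rule ttime_nonneg)
  also have "\<dots> \<le> block_time w P \<omega>" using assms by (intro ttime_le_block_time) auto
  finally show "0 \<le> block_time w P \<omega>" .
  have "block_time w P \<omega> \<le> path_time (\<lambda>e. w (\<omega> e)) \<gamma>" using assms by (intro block_time_le)
  also have "\<dots> \<le> M * card \<gamma>" using assms by (intro path_time_le) auto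
  finally show "block_time w P \<omega> \<le> M * card \<gamma>" .
qed

lemma block_time_cong:
  "(\<And>e. e \<in> \<Union>P \<Longrightarrow> \<omega> e = \<omega>' e) \<Longrightarrow> block_time w P \<omega> = block_time w P \<omega>'"
  unfolding block_time_def path_time_def
  by (intro INF_cong sum.cong refl arg_cong[where f = w]) blast

text \<open>Minima over the first \<open>m\<close> paths of an enumeration decrease to the passage
  time. They are dominated by the largest possible time of the path \<open>en 0\<close>, so the
  means converge too.\<close>

lemma block_time_approx:
  assumes "0 < \<delta>"
  obtains P where "finite P" "P \<noteq> {}" "P \<subseteq> paths_between u v"
    "(\<integral>\<omega>. block_time w P \<omega> \<partial>env K) < (\<integral>\<omega>. ttime w \<omega> u v \<partial>env K) + \<delta>"
proof -
  define en where "en = from_nat_into (paths_between u v)"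
  define P where "P m = en ` {..m}" for m
  have en: "en i \<in> paths_between u v" for i
    unfolding en_def by (rule from_nat_into[OF paths_between_nonempty])
  have P: "finite (P m)" "P m \<noteq> {}" "P m \<subseteq> paths_between u v" "en 0 \<in> P m" for m
    using en by (auto simp: P_def)
  interpret E: prob_space "env K" by (rule prob_space_env) (rule K.prob_space_axioms)
  have "(\<lambda>m. \<integral>\<omega>. block_time w (P m) \<omega> \<partial>env K) \<longlonglongrightarrow> (\<integral>\<omega>. ttime w \<omega> u v \<partial>env K)"
  proof (rule integral_dominated_convergence[where w = "\<lambda>_. M * card (en 0)"])
    show "AE \<omega> in env K. (\<lambda>m. block_time w (P m) \<omega>) \<longlonglongrightarrow> ttime w \<omega> u v"
    proof (rule AE_I2)
      fix \<omega> :: "'a edge \<Rightarrow> 'l"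
      show "(\<lambda>m. block_time w (P m) \<omega>) \<longlonglongrightarrow> ttime w \<omega> u v"
      proof (rule LIMSEQ_I)
        fix r :: real assume "0 < r"
        then obtain \<gamma> where \<gamma>: "\<gamma> \<in> paths_between u v" "path_time (\<lambda>e. w (\<omega> e)) \<gamma> < ttime w \<omega> u v + r"
          unfolding ttime_def by (rule ptime_approx)
        obtain i where i: "\<gamma> = en i"
          using \<gamma>(1) countable_paths_between from_nat_into_surj unfolding en_def by metis
        have "norm (block_time w (P m) \<omega> - ttime w \<omega> u v) < r" if "i \<le> m" for m
        proof -
          have "\<gamma> \<in> P m" using that i by (auto simp: P_def)
          then have "block_time w (P m) \<omega> \<le> path_time (\<lambda>e. w (\<omega> e)) \<gamma>" using P by (intro block_time_le)
          moreover have "ttime w \<omega> u v \<le> block_time w (P m) \<omega>" using P by (intro ttime_le_block_time)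
          ultimately show ?thesis using \<gamma>(2) by simp
        qed
        then show "\<exists>no. \<forall>n\<ge>no. norm (block_time w (P n) \<omega> - ttime w \<omega> u v) < r" by blast
      qed
    qed
    show "AE \<omega> in env K. norm (block_time w (P m) \<omega>) \<le> M * card (en 0)" for m
      using block_time_bounds[OF P(3) P(1) P(4)] by (intro AE_I2) simp
    show "block_time w (P m) \<in> borel_measurable (env K)" for m
      by (rule block_time_measurable[OF P(3) P(1)])
  qed auto
  then have "\<forall>\<^sub>F m in sequentially. (\<integral>\<omega>. block_time w (P m) \<omega> \<partial>env K) < (\<integral>\<omega>. ttime w \<omega> u v \<partial>env K) + \<delta>"
    using assms by (intro order_tendstoD(2)) auto
  then obtain m where "(\<integral>\<omega>. block_time w (P m) \<omega> \<partial>env K) < (\<integral>\<omega>. ttime w \<omega> u v \<partial>env K) + \<delta>"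
    using eventually_happens'[OF sequentially_bot] by blast
  then show ?thesis by (rule that[OF P(1-3)])
qed

text \<open>Minus the sum of the block times is additive, so the lower bound for subadditive processes yields
  an upper bound here. Only finitely many paths enter \<open>block_time\<close>; this makes the process insensitive
  to finite changes of the environment.\<close>

lemma block_average:
  assumes P: "finite P" "P \<noteq> {}" "P \<subseteq> paths_between u v" and y: "y \<noteq> 0"
    and c: "(\<integral>\<omega>. block_time w P \<omega> \<partial>env K) < c"
  shows "AE \<omega> in env K. \<forall>\<^sub>F n in sequentially. (\<Sum>j<n. block_time w P ((shift_env y ^^ j) \<omega>)) \<le> c * n"
proof -
  interpret E: prob_space "env K" by (rule prob_space_env) (rule K.prob_space_axioms)
  obtain \<gamma> where \<gamma>: "\<gamma> \<in> P" using P by auto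
  define B where "B = M * card \<gamma>"
  have B0: "0 \<le> B" using M_nonneg by (simp add: B_def)
  have bd: "0 \<le> block_time w P \<omega>" "block_time w P \<omega> \<le> B" for \<omega>
    using block_time_bounds[OF P(3) P(1) \<gamma>] by (auto simp: B_def)
  have meas: "block_time w P \<in> borel_measurable (env K)" by (rule block_time_measurable[OF P(3) P(1)])
  note Sn = E.measure_preserving_funpow[OF shift_env_measurable[of y] shift_env_distr[OF K.prob_space_axioms]]
  have Sm: "(\<lambda>\<omega>. block_time w P ((shift_env y ^^ j) \<omega>)) \<in> borel_measurable (env K)" for j
    by (rule measurable_compose[OF Sn(1) meas])
  let ?f = "\<lambda>n \<omega>. - (\<Sum>j<n. block_time w P ((shift_env y ^^ j) \<omega>))"
  have fm: "?f n \<in> borel_measurable (env K)" for n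
    using Sm by (intro borel_measurable_uminus borel_measurable_sum) auto
  have "AE \<omega> in env K. \<forall>\<^sub>F n in sequentially. - c * n \<le> ?f n \<omega>"
  proof (rule E.subadditive_liminf[where S = "shift_env y" and C = B
        and g = "- (\<integral>\<omega>. block_time w P \<omega> \<partial>env K)" and f = ?f])
    show "shift_env y \<in> measurable (env K) (env K)" by (rule shift_env_measurable)
    show "distr (env K) (env K) (shift_env y) = env K" by (rule shift_env_distr) (rule K.prob_space_axioms)
    show "?f n \<in> borel_measurable (env K)" for n by (rule fm)
    show "0 \<le> B" by (rule B0)
    show "\<bar>?f n \<omega>\<bar> \<le> B * n" for n \<omega>
    proof -
      have "0 \<le> (\<Sum>j<n. block_time w P ((shift_env y ^^ j) \<omega>))" using bd by (intro sum_nonneg) auto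
      moreover have "(\<Sum>j<n. block_time w P ((shift_env y ^^ j) \<omega>)) \<le> (\<Sum>j<n. B)" using bd by (intro sum_mono) auto
      ultimately show ?thesis by (simp add: mult.commute)
    qed
    show "?f (n + k) \<omega> \<le> ?f n \<omega> + ?f k ((shift_env y ^^ n) \<omega>)" for n k \<omega>
      by (induction k) (simp_all add: funpow_add add.commute[of n])
    have "E.expectation (\<lambda>\<omega>. block_time w P ((shift_env y ^^ j) \<omega>)) = (\<integral>\<omega>. block_time w P \<omega> \<partial>env K)" for j
      using integral_distr[OF Sn(1)[of j] meas] by (simp add: Sn(2))
    moreover have "integrable (env K) (\<lambda>\<omega>. block_time w P ((shift_env y ^^ j) \<omega>))" for j
      using Sm bd by (intro E.integrable_const_bound[where B = B]) auto
    ultimately show "- (\<integral>\<omega>. block_time w P \<omega> \<partial>env K) * n \<le> E.expectation (?f n)" for n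
      by (simp add: mult.commute)
    show "- c < - (\<integral>\<omega>. block_time w P \<omega> \<partial>env K)" using c by simp
    show "E.prob {\<omega> \<in> space (env K). \<forall>k. \<exists>\<^sub>F n in sequentially. ?f n \<omega> < (a + 1 / Suc k) * n} \<in> {0, 1}" for a
      unfolding env_def
    proof (rule liminf_zero_one)
      fix \<omega> \<omega>' :: "'a edge \<Rightarrow> 'l"
      assume fin: "finite {e \<in> lattice_edges. \<omega> e \<noteq> \<omega>' e}"
      let ?D = "{e \<in> lattice_edges. \<omega> e \<noteq> \<omega>' e}"
      \<comment> \<open>The indices of the blocks that see a changed edge. Since
        \<open>y \<noteq> 0\<close>, each of the finitely many edges in \<open>P\<close> is moved to
        different places by different \<open>j\<close>, so \<open>J\<close> is finite.\<close>
      define J where "J = {j. \<exists>e\<in>\<Union>P. \<omega> ((+) (int j *s y) ` e) \<noteq> \<omega>' ((+) (int j *s y) ` e)}"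
      have PE: "e \<in> lattice_edges" if "e \<in> \<Union>P" for e using that P(3) path_subset by blast
      have injy: "inj (\<lambda>j. int j *s y + u)" for u
      proof (rule injI)
        fix i j :: nat assume "int i *s y + u = int j *s y + u"
        then have "int i *s y = int j *s y" by simp
        moreover obtain k where "y $ k \<noteq> 0" using y by (auto simp: vec_eq_iff)
        ultimately show "i = j" by (auto simp: vec_eq_iff)
      qed
      have "finite J"
      proof (rule finite_subset)
        show "J \<subseteq> (\<Union>e\<in>\<Union>P. \<Union>u\<in>e. (\<lambda>j. int j *s y + u) -` \<Union>?D)"
        proof
          fix j assume "j \<in> J"
          then obtain e where e: "e \<in> \<Union>P" "\<omega> ((+) (int j *s y) ` e) \<noteq> \<omega>' ((+) (int j *s y) ` e)" by (auto simp: J_def)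
          obtain u u' where u: "e = {u, u'}" using lattice.edges[OF PE[OF e(1)]] by blast
          have "(+) (int j *s y) ` e \<in> ?D" using e PE by (auto simp: translate_edge_iff)
          then have "int j *s y + u \<in> \<Union>?D" using u by blast
          then show "j \<in> (\<Union>e\<in>\<Union>P. \<Union>u\<in>e. (\<lambda>j. int j *s y + u) -` \<Union>?D)" using e u by blast
        qed
        have fe: "finite e" if "e \<in> lattice_edges" for e :: "'a edge" using lattice.edges[OF that] by auto
        have "finite (\<Union>?D)" using fin fe by (intro finite_Union) auto
        moreover have "finite (\<Union>P)" using P path_finite by (intro finite_Union) auto
        ultimately show "finite (\<Union>e\<in>\<Union>P. \<Union>u\<in>e. (\<lambda>j. int j *s y + u) -` \<Union>?D)"
          using fe PE injy by (intro finite_UN_I finite_vimageI) auto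
      qed
      have "?f n \<omega>' \<le> ?f n \<omega> + B * card J" for n
      proof -
        have "(\<Sum>j<n. block_time w P ((shift_env y ^^ j) \<omega>)) - (\<Sum>j<n. block_time w P ((shift_env y ^^ j) \<omega>'))
          = (\<Sum>j<n. block_time w P ((shift_env y ^^ j) \<omega>) - block_time w P ((shift_env y ^^ j) \<omega>'))"
          by (simp add: sum_subtractf)
        also have "\<dots> \<le> (\<Sum>j<n. if j \<in> J then B else 0)"
        proof (rule sum_mono)
          fix j
          show "block_time w P ((shift_env y ^^ j) \<omega>) - block_time w P ((shift_env y ^^ j) \<omega>') \<le> (if j \<in> J then B else 0)"
          proof (cases "j \<in> J")
            case True
            then show ?thesis using bd(2)[of "(shift_env y ^^ j) \<omega>"] bd(1)[of "(shift_env y ^^ j) \<omega>'"] by simp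
          next
            case False
            then have "block_time w P ((shift_env y ^^ j) \<omega>) = block_time w P ((shift_env y ^^ j) \<omega>')"
              using PE by (intro block_time_cong) (auto simp: shift_env_funpow J_def)
            then show ?thesis using False by simp
          qed
        qed
        also have "\<dots> = B * card ({..<n} \<inter> J)" by (simp add: sum.If_cases mult.commute)
        also have "\<dots> \<le> B * card J" using B0 \<open>finite J\<close> by (intro mult_left_mono) (auto intro!: card_mono)
        finally show ?thesis by simp
      qed
      then show "\<exists>D. \<forall>n. ?f n \<omega>' \<le> ?f n \<omega> + D" by blast
    qed (use K.prob_space_axioms countable_lattice_edges infinite_lattice_edges fm[unfolded env_def] in auto)
  qed
  then show ?thesis by eventually_elim (auto elim!: eventually_mono)
qed

lemma ttime_le_block_sum:
  assumes "P \<noteq> {}" "P \<subseteq> paths_between 0 y"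
  shows "ttime w \<omega> 0 (int n *s y) \<le> (\<Sum>j<n. block_time w P ((shift_env y ^^ j) \<omega>))"
proof (induction n)
  case 0
  then show ?case using ttime_le[of \<omega> 0 0] by simp
next
  case (Suc n)
  have "ttime w \<omega> 0 (int (Suc n) *s y) \<le> ttime w \<omega> 0 (int n *s y) + ttime w \<omega> (int n *s y) (int (Suc n) *s y)"
    by (rule ttime_triangle)
  also have "ttime w \<omega> (int n *s y) (int (Suc n) *s y) = ttime w ((shift_env y ^^ n) \<omega>) 0 y"
    using vector_sadd_rdistrib[of "int n" 1 y] by (simp add: ttime_shift_env_funpow add.commute)
  also have "\<dots> \<le> block_time w P ((shift_env y ^^ n) \<omega>)" by (rule ttime_le_block_time[OF assms(2,1)])
  finally show ?case using Suc by simp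
qed

text \<open>Chains blocks of displacement \<open>k\<close> times \<open>z\<close>, where
  \<open>k\<close> nearly attains the infimum in \<open>mu\<close>. Their average is controlled by
  \<open>block_average\<close>, and the incomplete last block has bounded cost.\<close>

lemma ttime_limsup:
  assumes z: "z \<noteq> 0" and \<delta>: "0 < \<delta>"
  shows "AE \<omega> in env K. \<forall>\<^sub>F n in sequentially. ttime w \<omega> 0 (int n *s z) \<le> (mu z + 4 * \<delta>) * n"
proof -
  obtain k where k: "1 \<le> k" "(\<integral>\<omega>. ttime w \<omega> 0 (int k *s z) \<partial>env K) < (mu z + \<delta>) * k" by (rule mu_approx[OF \<delta>])
  define y where "y = int k *s z"
  have y: "y \<noteq> 0" using z k by (auto simp: y_def vec_eq_iff)
  obtain P where P: "finite P" "P \<noteq> {}" "P \<subseteq> paths_between 0 y"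
    "(\<integral>\<omega>. block_time w P \<omega> \<partial>env K) < (\<integral>\<omega>. ttime w \<omega> 0 y \<partial>env K) + \<delta>"
    by (rule block_time_approx[OF \<delta>])
  let ?c = "(mu z + \<delta>) * k + \<delta>"
  have "(\<integral>\<omega>. block_time w P \<omega> \<partial>env K) < ?c" using P(4) k(2) by (simp add: y_def)
  then have "AE \<omega> in env K. \<forall>\<^sub>F n in sequentially. (\<Sum>j<n. block_time w P ((shift_env y ^^ j) \<omega>)) \<le> ?c * n"
    by (rule block_average[OF P(1-3) y])
  then show ?thesis
  proof eventually_elim
    case (elim \<omega>)
    define C where "C = M * dist1 0 z * k"
    have ev1: "\<forall>\<^sub>F n in sequentially. (\<Sum>j<n div k. block_time w P ((shift_env y ^^ j) \<omega>)) \<le> ?c * real (n div k)"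
    proof -
      have "filterlim (\<lambda>n. n div k) sequentially sequentially"
        unfolding filterlim_at_top
      proof
        fix Z
        show "\<forall>\<^sub>F n in sequentially. Z \<le> n div k"
          using eventually_ge_at_top[of "Z * k"]
          by eventually_elim (use k in \<open>metis div_le_mono nonzero_mult_div_cancel_right not_one_le_zero\<close>)
      qed
      from eventually_compose_filterlim[OF elim this] show ?thesis .
    qed
    have ev2: "\<forall>\<^sub>F n in sequentially. C \<le> \<delta> * real n"
      using eventually_ge_at_top[of "nat \<lceil>C / \<delta>\<rceil>"]
    proof eventually_elim
      case (elim n)
      then have "C / \<delta> \<le> n" by linarith
      then show ?case using \<delta> by (simp add: field_simps)
    qed
    from ev1 ev2 show ?case
    proof eventually_elim
      case (elim n)
      define q where "q = n div k"
      define r where "r = n mod k"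
      have n: "n = q * k + r" by (simp add: q_def r_def)
      have r: "r \<le> k" using k by (simp add: r_def less_imp_le)
      have e: "int n *s z = int q *s y + int r *s z"
        by (simp add: n y_def vector_sadd_rdistrib vector_smult_assoc)
      have "ttime w \<omega> 0 (int n *s z) \<le> ttime w \<omega> 0 (int q *s y) + ttime w \<omega> (int q *s y) (int n *s z)"
        by (rule ttime_triangle)
      also have "ttime w \<omega> (int q *s y) (int n *s z) \<le> M * dist1 (int q *s y) (int n *s z)" by (rule ttime_le)
      also have "dist1 (int q *s y) (int n *s z) = r * dist1 0 z"
        using dist1_translate[of "int q *s y" 0 "int r *s z"] by (simp add: e dist1_scale)
      also have "M * real (r * dist1 0 z) \<le> C"
        using r M_nonneg by (simp add: C_def mult.assoc mult.commute[of "real r"] mult_left_mono)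
      also have "ttime w \<omega> 0 (int q *s y) \<le> ?c * q"
        using ttime_le_block_sum[OF P(2,3), of \<omega> q] elim(1) by (simp add: q_def)
      finally have "ttime w \<omega> 0 (int n *s z) \<le> (mu z + \<delta>) * (real q * real k) + \<delta> * real q + C" by (simp add: algebra_simps)
      \<comment> \<open>The three \<delta> come from the choice of \<open>k\<close>, from the
        restriction to finitely many paths, and from the incomplete last block.\<close>
      also have "\<dots> \<le> (mu z + \<delta>) * n + \<delta> * n + \<delta> * n"
      proof -
        have qk: "q * k \<le> n" by (simp add: n)
        then have "real q * real k \<le> real n" by (metis of_nat_le_iff of_nat_mult)
        then have "(mu z + \<delta>) * (real q * real k) \<le> (mu z + \<delta>) * n"
          using \<delta> mu_nonneg[of z] by (intro mult_left_mono) auto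
        moreover have "q \<le> q * k" using k by simp
        then have "real q \<le> real n" using qk by linarith
        then have "\<delta> * real q \<le> \<delta> * n" using \<delta> by (intro mult_left_mono) auto
        ultimately show ?thesis using elim(2) by linarith
      qed
      also have "\<dots> \<le> (mu z + 4 * \<delta>) * n" using \<delta> by (simp add: algebra_simps)
      finally show ?case .
    qed
  qed
qed

theorem ttime_limit:
  "AE \<omega> in env K. (\<lambda>n. ttime w \<omega> 0 (int n *s z) / n) \<longlonglongrightarrow> mu z"
proof (cases "z = 0")
  case True
  have "ttime w \<omega> 0 0 = 0" for \<omega> :: "'a edge \<Rightarrow> 'l"
    using ttime_le[of \<omega> 0 0] ttime_nonneg[of \<omega> 0 0] by simp
  moreover from this have "mu (0 :: 'a vertex) = 0"
  proof -
    have "mu (0 :: 'a vertex) * 1 \<le> 0" using mu_le[of "0 :: 'a vertex" 1] calculation by simp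
    then show ?thesis using mu_nonneg[of "0 :: 'a vertex"] by simp
  qed
  ultimately show ?thesis using True by simp
next
  case False
  have "AE \<omega> in env K. \<forall>i. (\<forall>\<^sub>F n in sequentially. ttime w \<omega> 0 (int n *s z) \<le> (mu z + 4 * (1 / Suc i)) * n) \<and>
      (\<forall>\<^sub>F n in sequentially. (mu z - 1 / Suc i) * n \<le> ttime w \<omega> 0 (int n *s z))"
    unfolding AE_all_countable
    by (intro allI AE_conjI ttime_limsup[OF False] ttime_liminf) auto
  then show ?thesis
  proof eventually_elim
    case (elim \<omega>)
    show ?case
    proof (rule tendstoI)
      fix \<epsilon> :: real assume "0 < \<epsilon>"
      then obtain i where i: "1 / Suc i < \<epsilon> / 4" using reals_Archimedean[of "\<epsilon> / 4"] by (auto simp: inverse_eq_divide)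
      have "\<forall>\<^sub>F n in sequentially. ttime w \<omega> 0 (int n *s z) \<le> (mu z + 4 * (1 / Suc i)) * n"
        "\<forall>\<^sub>F n in sequentially. (mu z - 1 / Suc i) * n \<le> ttime w \<omega> 0 (int n *s z)"
        using elim by auto
      then show "\<forall>\<^sub>F n in sequentially. dist (ttime w \<omega> 0 (int n *s z) / n) (mu z) < \<epsilon>"
        using eventually_gt_at_top[of 0]
      proof eventually_elim
        case (elim n)
        have "ttime w \<omega> 0 (int n *s z) / n \<le> mu z + 4 * (1 / Suc i)" using elim by (simp add: divide_le_eq)
        moreover have "mu z - 1 / Suc i \<le> ttime w \<omega> 0 (int n *s z) / n" using elim by (simp add: le_divide_eq)
        moreover have "0 < 1 / real (Suc i)" by simp
        ultimately show ?case using i unfolding dist_real_def by linarith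
      qed
    qed
  qed
qed

end

section \<open>Limits in a fixed direction\<close>

lemma dist1_le_norm: "real (dist1 u v) \<le> CARD('d) * norm (real_vec u - real_vec v :: real ^ 'd::finite)"
proof -
  have "real (dist1 u v) = (\<Sum>i\<in>UNIV. \<bar>(real_vec u - real_vec v :: real ^ 'd) $ i\<bar>)"
    by (simp add: dist1_def real_vec_def flip: of_int_diff of_int_abs)
  also have "\<dots> \<le> (\<Sum>i\<in>(UNIV :: 'd set). norm (real_vec u - real_vec v))"
    by (intro sum_mono component_le_norm_cart)
  finally show ?thesis by simp
qed

lemma norm_le_dist1: "norm (real_vec u - real_vec v :: real ^ 'd::finite) \<le> dist1 u v"
proof -
  have "norm (real_vec u - real_vec v :: real ^ 'd) \<le> (\<Sum>i\<in>UNIV. \<bar>(real_vec u - real_vec v :: real ^ 'd) $ i\<bar>)"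
    by (rule norm_le_l1_cart)
  also have "\<dots> = real (dist1 u v)"
    by (simp add: dist1_def real_vec_def flip: of_int_diff of_int_abs)
  finally show ?thesis .
qed

lemma real_vec_zero [simp]: "real_vec 0 = 0"
  by (simp add: real_vec_def vec_eq_iff)

lemma real_vec_scale: "real_vec (int n *s z) = real n *\<^sub>R real_vec z"
  by (simp add: real_vec_def vec_eq_iff)

lemma lattice_point_zero [simp]: "lattice_point 0 = 0"
  by (simp add: lattice_point_def vec_eq_iff)

lemma lattice_point_real_vec [simp]: "lattice_point (real_vec z) = z"
  by (simp add: lattice_point_def real_vec_def vec_eq_iff)

lemma norm_lattice_point: "norm (real_vec (lattice_point x) - x) \<le> CARD('d)" for x :: "real ^ 'd::finite"
proof -
  have "norm (real_vec (lattice_point x) - x) \<le> (\<Sum>i\<in>UNIV. \<bar>(real_vec (lattice_point x) - x) $ i\<bar>)"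
    by (rule norm_le_l1_cart)
  also have "\<dots> \<le> (\<Sum>i\<in>(UNIV :: 'd set). 1)"
  proof (rule sum_mono)
    fix i
    have "(real_vec (lattice_point x) - x) $ i = of_int \<lfloor>x $ i\<rfloor> - x $ i"
      by (simp add: real_vec_def lattice_point_def)
    then show "\<bar>(real_vec (lattice_point x) - x) $ i\<bar> \<le> 1" by linarith
  qed
  finally show ?thesis by simp
qed

context bounded_weight
begin

text \<open>The direction need not be rational, so \<open>r *\<^sub>R \<xi>\<close> is compared with
  the multiple \<open>\<lfloor>r / k\<rfloor>\<close> of the lattice point near
  \<open>k *\<^sub>R \<xi>\<close>. Each of these roughly \<open>r / k\<close> steps misplaces the
  endpoint by at most \<open>CARD('d)\<close> in norm; passing to \<open>dist1\<close> costs another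
  such factor, whence the square in the error.\<close>

lemma direction_approx:
  fixes \<xi> :: "real ^ 'd::finite"
  assumes \<xi>: "norm \<xi> = 1" and k: "0 < k"
    and lim: "(\<lambda>n. ttime w \<omega> 0 (int n *s lattice_point (real k *\<^sub>R \<xi>)) / n) \<longlonglongrightarrow> mu (lattice_point (real k *\<^sub>R \<xi>))"
  shows "\<forall>\<^sub>F r in at_top. \<bar>ttime w \<omega> 0 (lattice_point (r *\<^sub>R \<xi>)) / r - mu (lattice_point (real k *\<^sub>R \<xi>)) / k\<bar>
    \<le> (M * CARD('d) * CARD('d) + 1) / k"
proof -
  define d where "d = real CARD('d)"
  define z where "z = lattice_point (real k *\<^sub>R \<xi>)"
  define n where "n r = nat \<lfloor>r / k\<rfloor>" for r :: real
  define b where "b r = ttime w \<omega> 0 (int (n r) *s z) / r" for r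
  have nr: "real (n r) \<le> r / k" "r / k < real (n r) + 1" if "0 < r" for r
  proof -
    have "0 \<le> \<lfloor>r / k\<rfloor>" using that k by simp
    then show "real (n r) \<le> r / k" "r / k < real (n r) + 1" unfolding n_def by linarith+
  qed
  have n_top: "filterlim n at_top at_top"
    unfolding filterlim_at_top
  proof
    fix Z
    show "\<forall>\<^sub>F r in at_top. Z \<le> n r"
      using eventually_ge_at_top[of "real Z * k"]
    proof eventually_elim
      case (elim r)
      then have "real Z \<le> r / k" using k by (simp add: field_simps)
      then have "int Z \<le> \<lfloor>r / k\<rfloor>" by (simp add: le_floor_iff)
      then show ?case by (simp add: n_def)
    qed
  qed
  have "((\<lambda>r. ttime w \<omega> 0 (int (n r) *s z) / n r) \<longlongrightarrow> mu z) at_top"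
    using filterlim_compose[OF lim n_top] by (simp add: z_def)
  moreover have "((\<lambda>r. n r / r) \<longlongrightarrow> 1 / k) at_top"
  proof (rule tendsto_sandwich[where f = "\<lambda>r. 1 / k - 1 / r" and h = "\<lambda>_. 1 / k"])
    show "\<forall>\<^sub>F r in at_top. 1 / k - 1 / r \<le> n r / r"
      using eventually_gt_at_top[of 0]
    proof eventually_elim
      case (elim r)
      have "(r / k - 1) / r \<le> n r / r" using nr(2)[OF elim] elim by (intro divide_right_mono) auto
      then show ?case using elim by (simp add: diff_divide_distrib)
    qed
    show "\<forall>\<^sub>F r in at_top. n r / r \<le> 1 / k"
      using eventually_gt_at_top[of 0]
    proof eventually_elim
      case (elim r)
      have "n r / r \<le> (r / k) / r" using nr(1)[OF elim] elim by (intro divide_right_mono) auto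
      then show ?case using elim by simp
    qed
    have "((\<lambda>r::real. 1 / k - 1 / r) \<longlongrightarrow> 1 / k - 0) at_top"
      by (intro tendsto_intros tendsto_divide_0[OF tendsto_const] filterlim_at_top_imp_at_infinity filterlim_ident)
    then show "((\<lambda>r::real. 1 / k - 1 / r) \<longlongrightarrow> 1 / k) at_top" by simp
  qed auto
  ultimately have "((\<lambda>r. ttime w \<omega> 0 (int (n r) *s z) / n r * (n r / r)) \<longlongrightarrow> mu z * (1 / k)) at_top"
    by (rule tendsto_mult)
  moreover have "\<forall>\<^sub>F r in at_top. ttime w \<omega> 0 (int (n r) *s z) / n r * (n r / r) = b r"
    using n_top[unfolded filterlim_at_top, rule_format, of 1]
    by eventually_elim (simp add: b_def)
  ultimately have b: "(b \<longlongrightarrow> mu z / k) at_top" using tendsto_cong by fastforce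
  \<comment> \<open>Half of the summand \<open>1\<close> in the error bound pays for the convergence
    of \<open>b\<close>, the other half for the displacement that stays bounded as \<open>r\<close>
    grows.\<close>
  have "0 < 1 / (2 * real k)" using k by simp
  then have ev1: "\<forall>\<^sub>F r in at_top. \<bar>b r - mu z / k\<bar> < 1 / (2 * real k)"
    using tendstoD[OF b] by (simp add: dist_real_def)
  have ev2: "\<forall>\<^sub>F r in at_top. 2 * real k * (M * d * (d + k)) \<le> r" by (rule eventually_ge_at_top)
  show ?thesis
    unfolding z_def[symmetric] d_def[symmetric]
    using ev1 ev2 eventually_gt_at_top[of 0]
  proof eventually_elim
    case (elim r)
    note r = elim(3)
    let ?l = "lattice_point (r *\<^sub>R \<xi>)"
    have d0: "0 \<le> d" by (simp add: d_def)
    have "norm (real_vec ?l - real_vec (int (n r) *s z)) \<le>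
      norm (real_vec ?l - r *\<^sub>R \<xi>) + norm (r *\<^sub>R \<xi> - real (n r) *\<^sub>R real k *\<^sub>R \<xi>)
        + norm (real (n r) *\<^sub>R (real k *\<^sub>R \<xi> - real_vec z))"
      unfolding real_vec_scale
      by (rule order_trans[OF _ norm_triangle_mono[OF norm_triangle_ineq order_refl]]) (simp add: algebra_simps)
    also have "norm (real_vec ?l - r *\<^sub>R \<xi>) \<le> d" unfolding d_def by (rule norm_lattice_point)
    also have "norm (r *\<^sub>R \<xi> - real (n r) *\<^sub>R real k *\<^sub>R \<xi>) \<le> k"
    proof -
      have "r *\<^sub>R \<xi> - real (n r) *\<^sub>R real k *\<^sub>R \<xi> = (r - real (n r) * k) *\<^sub>R \<xi>" by (simp add: algebra_simps)
      then have "norm (r *\<^sub>R \<xi> - real (n r) *\<^sub>R real k *\<^sub>R \<xi>) = \<bar>r - real (n r) * k\<bar>" using \<xi> by simp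
      also have "\<dots> \<le> k" using nr[OF r] k by (simp add: field_simps abs_le_iff)
      finally show ?thesis .
    qed
    also have "norm (real (n r) *\<^sub>R (real k *\<^sub>R \<xi> - real_vec z)) \<le> n r * d"
      using norm_lattice_point[of "real k *\<^sub>R \<xi>"] by (simp add: z_def d_def norm_minus_commute mult_left_mono)
    finally have nv: "norm (real_vec ?l - real_vec (int (n r) *s z)) \<le> d + k + n r * d" by simp
    have "real (dist1 ?l (int (n r) *s z)) \<le> d * norm (real_vec ?l - real_vec (int (n r) *s z))"
      unfolding d_def by (rule dist1_le_norm)
    also have "\<dots> \<le> d * (d + k + n r * d)" using nv d0 by (rule mult_left_mono)
    finally have "M * dist1 ?l (int (n r) *s z) \<le> M * (d * (d + k + n r * d))"
      using M_nonneg by (rule mult_left_mono)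
    then have "\<bar>ttime w \<omega> 0 ?l - ttime w \<omega> 0 (int (n r) *s z)\<bar> \<le> M * (d * (d + k + n r * d))"
      using ttime_Lipschitz[of \<omega> 0 ?l 0 "int (n r) *s z"] by simp
    then have "\<bar>ttime w \<omega> 0 ?l - ttime w \<omega> 0 (int (n r) *s z)\<bar> / r \<le> M * (d * (d + k + n r * d)) / r"
      using r by (intro divide_right_mono) auto
    also have "\<dots> = M * d * (d + k) / r + M * d * d * (n r / r)" by (simp add: add_divide_distrib algebra_simps)
    also have "M * d * (d + k) / r \<le> 1 / (2 * real k)" using elim(2) r k by (simp add: field_simps)
    also have "M * d * d * (n r / r) \<le> M * d * d * (1 / k)"
      using nr(1)[OF r] r k d0 M_nonneg by (intro mult_left_mono) (auto simp: field_simps)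
    finally have "\<bar>ttime w \<omega> 0 ?l - ttime w \<omega> 0 (int (n r) *s z)\<bar> / r \<le> 1 / (2 * real k) + M * d * d * (1 / k)"
      by simp
    moreover have "\<bar>ttime w \<omega> 0 ?l - ttime w \<omega> 0 (int (n r) *s z)\<bar> / r = \<bar>ttime w \<omega> 0 ?l / r - b r\<bar>"
      using r by (simp add: b_def abs_divide flip: diff_divide_distrib)
    ultimately have "\<bar>ttime w \<omega> 0 ?l / r - mu z / k\<bar> \<le> 1 / (2 * real k) + M * d * d * (1 / k) + 1 / (2 * real k)"
      using elim(1) by linarith
    also have "\<dots> = (M * d * d + 1) / k" using k by (simp add: field_simps)
    finally show ?case .
  qed
qed

text \<open>Defined from means and not as the almost sure limit, so that measurability in the
  weights and concavity can be read off integrals.\<close>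

definition tconst :: "real ^ 'd::finite \<Rightarrow> real" where
  "tconst \<xi> = lim (\<lambda>n. (\<integral>\<omega>. ttime w \<omega> 0 (lattice_point (real n *\<^sub>R \<xi>)) \<partial>env K) / n)"

theorem ttime_direction_limit:
  fixes \<xi> :: "real ^ 'd::finite"
  assumes \<xi>: "norm \<xi> = 1"
  shows "AE \<omega> in env K. ((\<lambda>r. ttime w \<omega> 0 (lattice_point (r *\<^sub>R \<xi>)) / r) \<longlongrightarrow> tconst \<xi>) at_top"
    and "(\<lambda>n. (\<integral>\<omega>. ttime w \<omega> 0 (lattice_point (real n *\<^sub>R \<xi>)) \<partial>env K) / n) \<longlonglongrightarrow> tconst \<xi>"
proof -
  interpret E: prob_space "env K :: ('d edge \<Rightarrow> 'l) measure" by (rule prob_space_env) (rule K.prob_space_axioms)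
  define C where "C = M * CARD('d) * CARD('d) + 1"
  have C: "0 < C" using M_nonneg by (simp add: C_def add_nonneg_pos)
  define a where "a \<omega> r = ttime w \<omega> 0 (lattice_point (r *\<^sub>R \<xi>)) / r" for \<omega> r
  define m where "m k = mu (lattice_point (real (Suc k) *\<^sub>R \<xi>)) / Suc k" for k
  have good: "AE \<omega> in env K. \<forall>k. \<forall>\<^sub>F r in at_top. \<bar>a \<omega> r - m k\<bar> \<le> C / Suc k"
  proof (subst AE_all_countable, rule allI)
    fix k
    have "AE \<omega> in env K. (\<lambda>n. ttime w \<omega> 0 (int n *s lattice_point (real (Suc k) *\<^sub>R \<xi>)) / n) \<longlonglongrightarrow> mu (lattice_point (real (Suc k) *\<^sub>R \<xi>))"
      by (rule ttime_limit)
    then show "AE \<omega> in env K. \<forall>\<^sub>F r in at_top. \<bar>a \<omega> r - m k\<bar> \<le> C / Suc k"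
    proof eventually_elim
      case (elim \<omega>)
      from direction_approx[OF \<xi> zero_less_Suc elim] show ?case by (simp only: a_def m_def C_def)
    qed
  qed
  \<comment> \<open>The numbers \<open>m k\<close> are deterministic, so one good environment
    suffices to show that they form a Cauchy sequence.\<close>
  have "\<exists>\<omega>. \<forall>k. \<forall>\<^sub>F r in at_top. \<bar>a \<omega> r - m k\<bar> \<le> C / Suc k"
    using eventually_happens'[OF _ good] E.ae_filter_bot by blast
  then obtain \<omega>0 where w0: "\<And>k. \<forall>\<^sub>F r in at_top. \<bar>a \<omega>0 r - m k\<bar> \<le> C / Suc k" by blast
  have mm: "\<bar>m k - m l\<bar> \<le> C / Suc k + C / Suc l" for k l
  proof -
    have "\<forall>\<^sub>F r in (at_top :: real filter). \<bar>m k - m l\<bar> \<le> C / Suc k + C / Suc l"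
      using w0[of k] w0[of l] by eventually_elim linarith
    then show ?thesis by simp
  qed
  have Ck: "\<exists>k. C / Suc k < \<epsilon>" if e: "0 < \<epsilon>" for \<epsilon>
  proof -
    obtain k where "inverse (real (Suc k)) < \<epsilon> / C" using reals_Archimedean[OF divide_pos_pos[OF e C]] by blast
    then have "C / Suc k < \<epsilon>" using C by (simp add: field_simps)
    then show ?thesis ..
  qed
  have mono: "C / Suc l \<le> C / Suc k" if "k \<le> l" for k l
    using that C by (intro divide_left_mono) auto
  have "Cauchy m"
  proof (rule metric_CauchyI)
    fix \<epsilon> :: real assume "0 < \<epsilon>"
    then obtain k where k: "C / Suc k < \<epsilon> / 2" using Ck[of "\<epsilon> / 2"] by auto
    have "dist (m i) (m j) < \<epsilon>" if "k \<le> i" "k \<le> j" for i j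
      using mm[of i j] mono[OF that(1)] mono[OF that(2)] k unfolding dist_real_def by linarith
    then show "\<exists>M. \<forall>i\<ge>M. \<forall>j\<ge>M. dist (m i) (m j) < \<epsilon>" by blast
  qed
  then obtain c where c: "m \<longlonglongrightarrow> c" using Cauchy_convergent_iff convergent_def by blast
  have mc: "\<bar>m k - c\<bar> \<le> 2 * (C / Suc k)" for k
  proof (rule LIMSEQ_le_const2)
    show "(\<lambda>l. \<bar>m k - m l\<bar>) \<longlonglongrightarrow> \<bar>m k - c\<bar>" using c by (intro tendsto_intros)
    show "\<exists>N. \<forall>l\<ge>N. \<bar>m k - m l\<bar> \<le> 2 * (C / Suc k)"
      using mm mono by (intro exI[of _ k] allI impI) (smt (verit))
  qed
  have lim: "AE \<omega> in env K. (a \<omega> \<longlongrightarrow> c) at_top"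
    using good
  proof eventually_elim
    case (elim \<omega>)
    show ?case
    proof (rule tendstoI)
      fix \<epsilon> :: real assume "0 < \<epsilon>"
      then obtain k where k: "C / Suc k < \<epsilon> / 3" using Ck[of "\<epsilon> / 3"] by auto
      show "\<forall>\<^sub>F r in at_top. dist (a \<omega> r) c < \<epsilon>"
        using elim[rule_format, of k]
      proof eventually_elim
        case (elim r)
        then show ?case unfolding dist_real_def using k mc[of k] by linarith
      qed
    qed
  qed
  \<comment> \<open>Dominated convergence identifies the almost sure limit \<open>c\<close> with the
    limit of the means.\<close>
  have "(\<lambda>n. \<integral>\<omega>. a \<omega> (real n) \<partial>env K) \<longlonglongrightarrow> (\<integral>\<omega>. c \<partial>(env K :: ('d edge \<Rightarrow> 'l) measure))"
  proof (rule integral_dominated_convergence[where w = "\<lambda>_. M * (CARD('d) * (CARD('d) + 1))"])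
    show "AE \<omega> in env K. (\<lambda>n. a \<omega> (real n)) \<longlonglongrightarrow> c"
      using lim by eventually_elim (rule filterlim_compose[OF _ filterlim_real_sequentially])
    show "(\<lambda>\<omega>. a \<omega> (real n)) \<in> borel_measurable (env K)" for n
      unfolding a_def by measurable
    show "AE \<omega> in env K. norm (a \<omega> (real n)) \<le> M * (CARD('d) * (CARD('d) + 1))" for n
    proof (rule AE_I2)
      fix \<omega> :: "'d edge \<Rightarrow> 'l"
      show "norm (a \<omega> (real n)) \<le> M * (CARD('d) * (CARD('d) + 1))"
      proof (cases "n = 0")
        case True
        then show ?thesis using M_nonneg by (simp add: a_def)
      next
        case False
        let ?l = "lattice_point (real n *\<^sub>R \<xi>)"
        have "norm (real_vec ?l) \<le> norm (real_vec ?l - real n *\<^sub>R \<xi>) + norm (real n *\<^sub>R \<xi>)"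
          using norm_triangle_ineq[of "real_vec ?l - real n *\<^sub>R \<xi>" "real n *\<^sub>R \<xi>"] by simp
        also have "\<dots> \<le> CARD('d) + real n"
          using norm_lattice_point[of "real n *\<^sub>R \<xi>"] \<xi> by simp
        also have "\<dots> \<le> CARD('d) * real n + real n"
          using False by (simp add: mult_le_cancel_left1)
        also have "\<dots> = (CARD('d) + 1) * real n" by (simp add: algebra_simps)
        finally have "CARD('d) * norm (real_vec ?l) \<le> CARD('d) * ((CARD('d) + 1) * real n)"
          by (rule mult_left_mono) simp
        moreover have "real (dist1 0 ?l) \<le> CARD('d) * norm (real_vec ?l)"
          using dist1_le_norm[of 0 ?l] by simp
        ultimately have "real (dist1 0 ?l) \<le> CARD('d) * ((CARD('d) + 1) * real n)" by (rule order_trans[rotated])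
        then have "M * dist1 0 ?l \<le> M * (CARD('d) * ((CARD('d) + 1) * real n))"
          using M_nonneg by (rule mult_left_mono)
        then have "ttime w \<omega> 0 ?l \<le> M * (CARD('d) * ((CARD('d) + 1) * real n))"
          using ttime_le[of \<omega> 0 ?l] by (rule order_trans[rotated])
        also have "\<dots> = M * (CARD('d) * (CARD('d) + 1)) * real n" by (simp add: algebra_simps)
        finally have "ttime w \<omega> 0 ?l \<le> M * (CARD('d) * (CARD('d) + 1)) * real n" .
        then show ?thesis using False ttime_nonneg[of \<omega> 0 ?l] by (simp add: a_def divide_le_eq)
      qed
    qed
  qed auto
  then have c': "(\<lambda>n. (\<integral>\<omega>. ttime w \<omega> 0 (lattice_point (real n *\<^sub>R \<xi>)) \<partial>env K) / n) \<longlonglongrightarrow> c"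
    by (simp add: a_def E.prob_space)
  then have ct: "c = tconst \<xi>" unfolding tconst_def by (simp add: limI)
  show "AE \<omega> in env K. ((\<lambda>r. ttime w \<omega> 0 (lattice_point (r *\<^sub>R \<xi>)) / r) \<longlongrightarrow> tconst \<xi>) at_top"
    using lim by eventually_elim (simp add: a_def[abs_def] ct)
  show "(\<lambda>n. (\<integral>\<omega>. ttime w \<omega> 0 (lattice_point (real n *\<^sub>R \<xi>)) \<partial>env K) / n) \<longlonglongrightarrow> tconst \<xi>"
    using c' ct by simp
qed

text \<open>Deterministic: from the limit along the ray, Lipschitz continuity gives the limit for
  every starting vertex and every family of endpoints with this asymptotic direction, even if they
  depend on the environment.\<close>

lemma ttime_along_direction:
  fixes \<xi> :: "real ^ 'd::finite"
  assumes lim: "((\<lambda>r. ttime w \<omega> 0 (lattice_point (r *\<^sub>R \<xi>)) / r) \<longlongrightarrow> c) at_top"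
    and top: "filterlim (\<lambda>i. norm (real_vec (x i) :: real ^ 'd)) at_top F"
    and dir: "((\<lambda>i. real_vec (x i) /\<^sub>R norm (real_vec (x i))) \<longlongrightarrow> \<xi>) F"
  shows "((\<lambda>i. ttime w \<omega> y (x i) / norm (real_vec (x i) :: real ^ 'd)) \<longlongrightarrow> c) F"
proof -
  define d where "d = real CARD('d)"
  define r where "r i = norm (real_vec (x i) :: real ^ 'd)" for i
  let ?l = "\<lambda>i. lattice_point (r i *\<^sub>R \<xi>)"
  have d0: "0 \<le> d" by (simp add: d_def)
  have 1: "((\<lambda>i. ttime w \<omega> 0 (?l i) / r i) \<longlongrightarrow> c) F"
    using filterlim_compose[OF lim top] by (simp add: r_def)
  have "((\<lambda>i. (M * dist1 y 0 + M * d * d) / r i + M * d * norm (real_vec (x i) /\<^sub>R r i - \<xi>)) \<longlongrightarrow> 0 + M * d * norm (\<xi> - \<xi>)) F"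
    unfolding r_def using dir
    by (intro tendsto_intros tendsto_divide_0[OF tendsto_const] filterlim_at_top_imp_at_infinity[OF top])
  then have 2: "((\<lambda>i. (M * dist1 y 0 + M * d * d) / r i + M * d * norm (real_vec (x i) /\<^sub>R r i - \<xi>)) \<longlongrightarrow> 0) F"
    by simp
  have "((\<lambda>i. ttime w \<omega> y (x i) / r i - ttime w \<omega> 0 (?l i) / r i) \<longlongrightarrow> 0) F"
  proof (rule Lim_null_comparison[OF _ 2])
    have "\<forall>\<^sub>F i in F. 0 < r i" using top unfolding r_def filterlim_at_top_dense by blast
    then show "\<forall>\<^sub>F i in F. norm (ttime w \<omega> y (x i) / r i - ttime w \<omega> 0 (?l i) / r i)
      \<le> (M * dist1 y 0 + M * d * d) / r i + M * d * norm (real_vec (x i) /\<^sub>R r i - \<xi>)"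
    proof eventually_elim
      case (elim i)
      have "norm (real_vec (x i) - real_vec (?l i)) \<le> norm (real_vec (x i) - r i *\<^sub>R \<xi>) + norm (real_vec (?l i) - r i *\<^sub>R \<xi>)"
        using norm_triangle_ineq4[of "real_vec (x i) - r i *\<^sub>R \<xi>" "real_vec (?l i) - r i *\<^sub>R \<xi>"] by simp
      also have "norm (real_vec (?l i) - r i *\<^sub>R \<xi>) \<le> d" unfolding d_def by (rule norm_lattice_point)
      also have "norm (real_vec (x i) - r i *\<^sub>R \<xi>) = r i * norm (real_vec (x i) /\<^sub>R r i - \<xi>)"
      proof -
        have "real_vec (x i) - r i *\<^sub>R \<xi> = r i *\<^sub>R (real_vec (x i) /\<^sub>R r i - \<xi>)" using elim by (simp add: scaleR_diff_right)
        then show ?thesis using elim by simp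
      qed
      finally have "d * norm (real_vec (x i) - real_vec (?l i)) \<le> d * (r i * norm (real_vec (x i) /\<^sub>R r i - \<xi>) + d)"
        using d0 by (simp add: mult_left_mono)
      then have "real (dist1 (x i) (?l i)) \<le> d * (r i * norm (real_vec (x i) /\<^sub>R r i - \<xi>) + d)"
        using dist1_le_norm[of "x i" "?l i"] unfolding d_def by (rule order_trans[rotated])
      then have "M * dist1 (x i) (?l i) \<le> M * (d * (r i * norm (real_vec (x i) /\<^sub>R r i - \<xi>) + d))"
        using M_nonneg by (rule mult_left_mono)
      then have "\<bar>ttime w \<omega> y (x i) - ttime w \<omega> 0 (?l i)\<bar> \<le> M * dist1 y 0 + M * (d * (r i * norm (real_vec (x i) /\<^sub>R r i - \<xi>) + d))"
        using ttime_Lipschitz[of \<omega> y "x i" 0 "?l i"] by simp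
      then have "\<bar>ttime w \<omega> y (x i) - ttime w \<omega> 0 (?l i)\<bar> / r i \<le> (M * dist1 y 0 + M * (d * (r i * norm (real_vec (x i) /\<^sub>R r i - \<xi>) + d))) / r i"
        using elim by (intro divide_right_mono) auto
      also have "\<dots> = (M * dist1 y 0 + M * d * d) / r i + M * d * norm (real_vec (x i) /\<^sub>R r i - \<xi>)"
        using elim by (simp add: field_simps)
      finally show ?case using elim by (simp add: abs_divide flip: diff_divide_distrib)
    qed
  qed
  from tendsto_add[OF this 1] show ?thesis by (simp add: r_def)
qed

text \<open>Declaring each edge outside \<open>Z\<close> open with probability \<open>l\<close> opens a path with \<open>j\<close> such edges with
  probability \<open>l ^ j\<close>. Hence the mean of \<open>l ^ T\<close> is at most an exit probability at a parameter that is
  still subcritical, and Jensen's inequality bounds the mean of \<open>T\<close>.\<close>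

lemma expect_ttime_lower:
  assumes Z: "Z \<in> sets K" "measure K Z < critical_prob TYPE('d::finite)"
    and s: "0 < s" "\<And>x. x \<notin> Z \<Longrightarrow> s \<le> w x"
  obtains c b :: real where "0 < c" "\<And>x :: 'd vertex. c * dist1 0 x - b \<le> (\<integral>\<omega>. ttime w \<omega> 0 x \<partial>env K)"
proof -
  define p where "p = measure K Z"
  define pc where "pc = critical_prob TYPE('d)"
  have p: "0 \<le> p" "p < pc" "pc \<le> 1" using Z critical_prob_le_1 by (auto simp: p_def pc_def)
  \<comment> \<open>The window lies strictly between \<open>p\<close> and \<open>pc\<close>: above
    \<open>p\<close> to leave room for sprinkling, below \<open>pc\<close> for the decay.\<close>
  obtain q S where q: "(2 * p + pc) / 3 \<le> q" "q \<le> (p + 2 * pc) / 3"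
    and S: "finite S" "(0 :: 'd vertex) \<in> S" "lattice.phi 0 q S < 1"
    by (rule subcritical_phi_less_1[of "(2 * p + pc) / 3" "(p + 2 * pc) / 3"]) (use p in \<open>auto simp: pc_def\<close>)
  have pq: "p < q" "q < 1" "0 \<le> q" "q \<le> 1" using p q by auto
  obtain L where L: "L > 0" "\<And>k. lattice.exit_prob (0 :: 'd vertex) q (lball 0 (k * L)) \<le> lattice.phi 0 q S ^ k"
    using exit_prob_exp_decay[OF S(1,2) pq(3,4)] by blast
  \<comment> \<open>The maximum keeps \<rho> positive, for \<open>phi\<close> may vanish and
    logarithms follow.\<close>
  define \<rho> where "\<rho> = max (lattice.phi 0 q S) (1 / 2)"
  have \<rho>: "0 < \<rho>" "\<rho> < 1" using S by (auto simp: \<rho>_def)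
  have phi0: "0 \<le> lattice.phi (0 :: 'd vertex) q S"
    unfolding lattice.phi_def using pq by (intro sum_nonneg) (auto intro!: mult_nonneg_nonneg bexp_nonneg)
  \<comment> \<open>Chosen so that sprinkling with density \<open>l\<close> raises the density from
    \<open>p\<close> to exactly \<open>q\<close>.\<close>
  define l where "l = (q - p) / (1 - p)"
  have l: "0 < l" "l < 1" "p + (1 - p) * l = q" using pq by (auto simp: l_def field_simps)
  \<comment> \<open>A mean of \<open>l\<close> to the power \<open>T / s\<close> of at most
    \<open>\<rho> ^ k\<close> corresponds to a mean \<open>T\<close> of at least
    \<open>s * k * ln \<rho> / ln l\<close>; both logarithms are negative.\<close>
  define \<kappa> where "\<kappa> = s * (ln \<rho> / ln l)"
  have \<kappa>: "0 < \<kappa>" unfolding \<kappa>_def using s l \<rho> by (intro mult_pos_pos divide_neg_neg) auto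
  have main: "\<kappa> * k \<le> (\<integral>\<omega>. ttime w \<omega> 0 x \<partial>env K)" if x: "k * L < dist1 0 x" for k and x :: "'d vertex"
  proof -
    let ?B = "lball (0 :: 'd vertex) (k * L)"
    let ?E = "lattice.touching ?B"
    have fE: "finite ?E" by (intro lattice.finite_touching finite_lball)
    have EL: "?E \<subseteq> lattice_edges" by (auto simp: lattice.touching_def)
    \<comment> \<open>The probability of an exit after sprinkling, given that \<open>A\<close> is
      the set of edges with label in \<open>Z\<close>.\<close>
    define G where "G A = bexp ?E l (\<lambda>B. of_bool (out (A \<union> B) ?B 0))" for A
    have xB: "x \<notin> ?B" using x by (simp add: lball_def)
    have outE: "out (\<gamma> \<inter> ?E) ?B 0" if "\<gamma> \<in> paths_between 0 x" for \<gamma>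
    proof -
      have "out \<gamma> ?B 0" using path_reach[OF that] xB by (auto simp: out_def)
      from out_touching[OF this path_subset[OF that]] show ?thesis by (simp add: lattice.touching_def)
    qed
    have G_ge: "l ^ card (\<gamma> \<inter> ?E - A) \<le> G A" if g: "\<gamma> \<in> paths_between 0 x" for \<gamma> A
    proof -
      have "l ^ card (\<gamma> \<inter> ?E - A) = bexp ?E l (\<lambda>B. of_bool (\<gamma> \<inter> ?E - A \<subseteq> B))"
        using fE by (subst bexp_subset) auto
      also have "\<dots> \<le> G A"
        unfolding G_def
      proof (intro bexp_mono)
        fix B assume "B \<subseteq> ?E"
        have "out (A \<union> B) ?B 0" if "\<gamma> \<inter> ?E - A \<subseteq> B"
          by (rule out_mono[OF outE[OF g]]) (use that in auto)
        then show "of_bool (\<gamma> \<inter> ?E - A \<subseteq> B) \<le> (of_bool (out (A \<union> B) ?B 0) :: real)" by auto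
      qed (use l in auto)
      finally show ?thesis .
    qed
    have G_pos: "0 < G A" for A
    proof -
      obtain \<gamma> where g: "\<gamma> \<in> paths_between 0 x" using paths_between_nonempty by blast
      have "0 < l ^ card (\<gamma> \<inter> ?E - A)" using l by simp
      also have "\<dots> \<le> G A" by (rule G_ge[OF g])
      finally show ?thesis .
    qed
    let ?A = "\<lambda>\<omega>. {e\<in>?E. \<omega> e \<in> Z}"
    have T_ge: "s * (ln (G (?A \<omega>)) / ln l) \<le> ttime w \<omega> 0 x" for \<omega>
      unfolding ttime_def
    proof (rule ptime_ge)
      fix \<gamma> assume g: "\<gamma> \<in> paths_between 0 x"
      let ?D = "\<gamma> \<inter> ?E - ?A \<omega>"
      have "ln (l ^ card ?D) \<le> ln (G (?A \<omega>))" using G_ge[OF g, of "?A \<omega>"] l G_pos by (subst ln_le_cancel_iff) auto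
      then have "real (card ?D) * ln l \<le> ln (G (?A \<omega>))" using l by (simp add: ln_realpow)
      then have "ln (G (?A \<omega>)) / ln l \<le> card ?D" using l by (simp add: neg_divide_le_eq)
      then have "s * (ln (G (?A \<omega>)) / ln l) \<le> s * card ?D" using s by (intro mult_left_mono) auto
      also have "\<dots> = (\<Sum>e\<in>?D. s)" by simp
      also have "\<dots> \<le> (\<Sum>e\<in>?D. w (\<omega> e))" using s by (intro sum_mono) auto
      also have "\<dots> \<le> (\<Sum>e\<in>\<gamma>. w (\<omega> e))" using path_finite[OF g] w_nonneg by (intro sum_mono2) auto
      finally show "s * (ln (G (?A \<omega>)) / ln l) \<le> path_time (\<lambda>e. w (\<omega> e)) \<gamma>" by (simp add: path_time_def)
    qed
    define m where "m = bexp ?E p G"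
    have m_eq: "m = lattice.exit_prob 0 q ?B"
      unfolding m_def G_def lattice.exit_prob_def by (subst bexp_sprinkle[OF fE]) (simp add: l)
    have "l ^ card ?E \<le> G A" for A
    proof -
      obtain \<gamma> where g: "\<gamma> \<in> paths_between 0 x" using paths_between_nonempty by blast
      have "l ^ card ?E \<le> l ^ card (\<gamma> \<inter> ?E - A)" using l fE by (intro power_decreasing card_mono) auto
      also have "\<dots> \<le> G A" by (rule G_ge[OF g])
      finally show ?thesis .
    qed
    then have "bexp ?E p (\<lambda>_. l ^ card ?E) \<le> m"
      unfolding m_def using p by (intro bexp_mono) auto
    then have m0: "0 < m" using l fE by (simp add: bexp_const) (meson order_less_le_trans zero_less_power)
    have m_le: "m \<le> \<rho> ^ k"
      unfolding m_eq using L(2)[of k] power_mono[of "lattice.phi (0 :: 'd vertex) q S" \<rho> k] phi0 by (simp add: \<rho>_def)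
    \<comment> \<open>Jensen's inequality by hand: the logarithm lies below its tangent at the mean
      \<open>m\<close>.\<close>
    have "bexp ?E p (\<lambda>A. ln (G A)) \<le> bexp ?E p (\<lambda>A. (ln m - 1) + (1 / m) * G A)"
    proof (intro bexp_mono)
      fix A
      have "ln (G A / m) \<le> G A / m - 1" using G_pos[of A] m0 by (intro ln_le_minus_one) simp
      then show "ln (G A) \<le> (ln m - 1) + (1 / m) * G A" using G_pos[of A] m0 by (simp add: ln_div)
    qed (use p in auto)
    also have "\<dots> = (ln m - 1) + (1 / m) * m"
      unfolding bexp_add bexp_cmult m_def[symmetric] using fE by (simp add: bexp_const)
    also have "\<dots> = ln m" using m0 by simp
    also have "\<dots> \<le> ln (\<rho> ^ k)" using m0 m_le \<rho> by (subst ln_le_cancel_iff) auto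
    also have "\<dots> = k * ln \<rho>" using \<rho> by (simp add: ln_realpow)
    finally have lnG: "bexp ?E p (\<lambda>A. ln (G A)) \<le> k * ln \<rho>" .
    note I = integral_PiM_bexp[OF K.prob_space_axioms Z(1) fE EL, folded env_def p_def]
    have "\<kappa> * k = s * ((k * ln \<rho>) / ln l)" by (simp add: \<kappa>_def)
    also have "\<dots> \<le> s * (bexp ?E p (\<lambda>A. ln (G A)) / ln l)"
      using lnG l s by (intro mult_left_mono divide_right_mono_neg) auto
    also have "\<dots> = bexp ?E p (\<lambda>A. (s / ln l) * ln (G A))" by (subst bexp_cmult) simp
    also have "\<dots> = (\<integral>\<omega>. (s / ln l) * ln (G (?A \<omega>)) \<partial>env K)"
      using I(2)[of "\<lambda>A. (s / ln l) * ln (G A)"] by simp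
    also have "\<dots> \<le> (\<integral>\<omega>. ttime w \<omega> 0 x \<partial>env K)"
    proof (rule integral_mono)
      show "integrable (env K) (\<lambda>\<omega>. (s / ln l) * ln (G (?A \<omega>)))"
        using I(1)[of "\<lambda>A. (s / ln l) * ln (G A)"] by simp
      show "integrable (env K) (\<lambda>\<omega>. ttime w \<omega> 0 x)" by (rule ttime_integrable)
      show "(s / ln l) * ln (G (?A \<omega>)) \<le> ttime w \<omega> 0 x" for \<omega> using T_ge[of \<omega>] by simp
    qed
    finally show ?thesis .
  qed
  show ?thesis
  proof (rule that[of "\<kappa> / L" "2 * \<kappa>"])
    show "0 < \<kappa> / L" using \<kappa> L by simp
    fix x :: "'d vertex"
    show "\<kappa> / L * dist1 0 x - 2 * \<kappa> \<le> (\<integral>\<omega>. ttime w \<omega> 0 x \<partial>env K)"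
    proof (cases "dist1 0 x = 0")
      case True
      then show ?thesis using \<kappa> by (simp add: expect_ttime_nonneg order_trans[of _ 0])
    next
      case False
      \<comment> \<open>Subtracting 1 makes \<open>k * L < dist1 0 x\<close> strict, so that
        \<open>x\<close> lies outside the ball used in \<open>main\<close>.\<close>
      define k where "k = (dist1 0 x - 1) div L"
      have "k * L \<le> dist1 0 x - 1" by (simp add: k_def)
      then have kL: "k * L < dist1 0 x" using False by linarith
      have "dist1 0 x - 1 < (k + 1) * L" using L(1) by (simp add: k_def) (metis dividend_less_div_times mult.commute add.commute mult_Suc_right)
      then have "dist1 0 x \<le> (k + 1) * L" using False by linarith
      then have "real (dist1 0 x) \<le> (k + 1) * L" by (metis of_nat_le_iff of_nat_mult)
      then have "real (dist1 0 x) / L \<le> k + 1" using L(1) by (simp add: divide_le_eq algebra_simps)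
      then have "\<kappa> * (real (dist1 0 x) / L) \<le> \<kappa> * (k + 1)" using \<kappa> by (intro mult_left_mono) auto
      then show ?thesis using main[OF kL] \<kappa> by (simp add: algebra_simps)
    qed
  qed
qed

lemma tconst_pos:
  fixes \<xi> :: "real ^ 'd::finite"
  assumes \<xi>: "norm \<xi> = 1" and Z: "Z \<in> sets K" "measure K Z < critical_prob TYPE('d)"
    and s: "0 < s" "\<And>x. x \<notin> Z \<Longrightarrow> s \<le> w x"
  shows "0 < tconst \<xi>"
proof -
  obtain c b :: real where c: "0 < c" "\<And>x :: 'd vertex. c * dist1 0 x - b \<le> (\<integral>\<omega>. ttime w \<omega> 0 x \<partial>env K)"
    using expect_ttime_lower[OF Z s] by blast
  let ?e = "\<lambda>n. (\<integral>\<omega>. ttime w \<omega> 0 (lattice_point (real n *\<^sub>R \<xi>)) \<partial>env K) / n"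
  have "c \<le> tconst \<xi>"
  proof (rule LIMSEQ_le)
    show "?e \<longlonglongrightarrow> tconst \<xi>" by (rule ttime_direction_limit(2)[OF \<xi>])
    have "(\<lambda>n. c - (c * CARD('d) + b) / real n) \<longlonglongrightarrow> c - 0"
      by (intro tendsto_intros lim_const_over_n)
    then show "(\<lambda>n. c - (c * CARD('d) + b) / real n) \<longlonglongrightarrow> c" by simp
    have "c - (c * CARD('d) + b) / real n \<le> ?e n" if "1 \<le> n" for n
    proof -
      let ?l = "lattice_point (real n *\<^sub>R \<xi>)"
      have "real n = norm (real n *\<^sub>R \<xi>)" using \<xi> by simp
      also have "\<dots> \<le> norm (real_vec ?l) + norm (real_vec ?l - real n *\<^sub>R \<xi>)"
        by (metis norm_minus_commute norm_triangle_sub)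
      also have "\<dots> \<le> dist1 0 ?l + CARD('d)"
        using norm_le_dist1[of ?l 0] norm_lattice_point[of "real n *\<^sub>R \<xi>"] by (simp add: dist1_commute)
      finally have "c * (real n - CARD('d)) \<le> c * dist1 0 ?l" using c(1) by (intro mult_left_mono) auto
      then have "c * (real n - CARD('d)) - b \<le> (\<integral>\<omega>. ttime w \<omega> 0 ?l \<partial>env K)" using c(2)[of ?l] by linarith
      then have "(c * (real n - CARD('d)) - b) / n \<le> ?e n" by (intro divide_right_mono) auto
      moreover have "(c * (real n - CARD('d)) - b) / n = c - (c * CARD('d) + b) / real n"
        using that by (simp add: field_simps)
      ultimately show ?thesis by simp
    qed
    then show "\<exists>N. \<forall>n\<ge>N. c - (c * CARD('d) + b) / real n \<le> ?e n" by blast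
  qed
  then show ?thesis using c(1) by simp
qed

end

section \<open>Differentiability almost everywhere\<close>

lemma concave_three_slopes:
  fixes f :: "real \<Rightarrow> real"
  assumes conc: "\<And>x y a. 0 < x \<Longrightarrow> 0 < y \<Longrightarrow> 0 \<le> a \<Longrightarrow> a \<le> 1 \<Longrightarrow>
      a * f x + (1 - a) * f y \<le> f (a * x + (1 - a) * y)"
    and "0 < u" "u < v" "v < w"
  shows "(f w - f v) / (w - v) \<le> (f w - f u) / (w - u)" "(f w - f u) / (w - u) \<le> (f v - f u) / (v - u)"
proof -
  define a where "a = (w - v) / (w - u)"
  have a: "0 \<le> a" "a \<le> 1" using assms by (auto simp: a_def field_simps)
  have aw: "a * (w - u) = w - v" using assms by (simp add: a_def)
  have "a * u + (1 - a) * w = w - a * (w - u)" by (simp add: algebra_simps)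
  then have "a * u + (1 - a) * w = v" using aw by simp
  then have "a * f u + (1 - a) * f w \<le> f v" using conc[of u w a] a assms by simp
  then have "(w - u) * (a * f u + (1 - a) * f w) \<le> (w - u) * f v" using assms by (intro mult_left_mono) auto
  moreover have "(w - u) * (a * f u + (1 - a) * f w) = (w - v) * f u + (v - u) * f w"
  proof -
    have "(w - u) * (a * f u + (1 - a) * f w) = (a * (w - u)) * f u + (w - u) * f w - (a * (w - u)) * f w"
      by (simp add: algebra_simps)
    then show ?thesis unfolding aw by (simp add: algebra_simps)
  qed
  ultimately have key: "(w - v) * f u + (v - u) * f w \<le> (w - u) * f v" by simp
  show "(f w - f v) / (w - v) \<le> (f w - f u) / (w - u)"
    using key assms by (simp add: frac_le_eq divide_le_0_iff) (simp add: algebra_simps)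
  show "(f w - f u) / (w - u) \<le> (f v - f u) / (v - u)"
    using key assms by (simp add: frac_le_eq divide_le_0_iff) (simp add: algebra_simps)
qed

text \<open>Chord slopes decrease, so the one-sided derivatives exist as a supremum \<open>R\<close>
  and an infimum \<open>L\<close> with \<open>R x \<le> L x\<close>. At different kinks the
  intervals from \<open>R x\<close> to \<open>L x\<close> are disjoint, and each contains a
  rational. Differences along \<open>1 / Suc n\<close> suffice, and they keep the number of
  perturbations countable.\<close>

lemma countable_concave_kinks:
  fixes f :: "real \<Rightarrow> real"
  assumes conc: "\<And>x y a. 0 < x \<Longrightarrow> 0 < y \<Longrightarrow> 0 \<le> a \<Longrightarrow> a \<le> 1 \<Longrightarrow>
      a * f x + (1 - a) * f y \<le> f (a * x + (1 - a) * y)"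
  shows "countable {x. 0 < x \<and> \<not> (\<exists>D. (\<lambda>n. (f (x + 1 / Suc n) - f x) * Suc n) \<longlonglongrightarrow> D \<and>
      (\<lambda>n. (f x - f (x - 1 / Suc n)) * Suc n) \<longlonglongrightarrow> D)}"
proof -
  define s where "s x y = (f y - f x) / (y - x)" for x y
  have s1: "s v w \<le> s u w" and s2: "s u w \<le> s u v" if "0 < u" "u < v" "v < w" for u v w
    using concave_three_slopes[OF conc that] by (auto simp: s_def)
  define R where "R x = (SUP y\<in>{x<..}. s x y)" for x
  define L where "L x = (INF y\<in>{0<..<x}. s y x)" for x
  have RL: "s x y \<le> s z x" if "0 < z" "z < x" "x < y" for x y z
    using s1[OF that] s2[OF that] by simp
  have bR: "bdd_above (s x ` {x<..})" if "0 < x" for x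
    using RL[of "x / 2" x] that by (intro bdd_aboveI[of _ "s (x / 2) x"]) auto
  have bL: "bdd_below ((\<lambda>y. s y x) ` {0<..<x})" if "0 < x" for x
    using RL[of _ x "x + 1"] by (intro bdd_belowI[of _ "s x (x + 1)"]) auto
  have ne: "{x<..} \<noteq> {}" "0 < x \<Longrightarrow> {0<..<x} \<noteq> {}" for x :: real
    using dense by (auto intro: exI[of _ "x + 1"] simp: ex_in_conv[symmetric] simp del: ex_in_conv)
  have R_ge: "s x y \<le> R x" if "0 < x" "x < y" for x y
    unfolding R_def using that bR by (intro cSUP_upper) auto
  have L_le: "L x \<le> s y x" if "0 < y" "y < x" for x y
    unfolding L_def using that bL by (intro cINF_lower) auto
  have R_le_L: "R x \<le> L x" if "0 < x" for x
    unfolding R_def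
  proof (rule cSUP_least[OF ne(1)])
    fix y assume "y \<in> {x<..}"
    then show "s x y \<le> L x" unfolding L_def using RL that by (intro cINF_greatest ne(2)) auto
  qed
  have small: "\<forall>\<^sub>F n in sequentially. 1 / real (Suc n) < h" if h: "0 < h" for h
    using order_tendstoD(2)[OF LIMSEQ_inverse_real_of_nat h] by (simp add: inverse_eq_divide)
  have limR: "(\<lambda>n. (f (x + 1 / Suc n) - f x) * Suc n) \<longlonglongrightarrow> R x" if x: "0 < x" for x
  proof -
    have e: "(f (x + 1 / Suc n) - f x) * Suc n = s x (x + 1 / Suc n)" for n by (simp add: s_def)
    show ?thesis
      unfolding e
    proof (rule order_tendstoI)
      fix a assume "a < R x"
      then obtain y where y: "x < y" "a < s x y"
        unfolding R_def using less_cSUP_iff[OF ne(1) bR[OF x]] by auto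
      show "\<forall>\<^sub>F n in sequentially. a < s x (x + 1 / Suc n)"
        using small[OF diff_gt_0_iff_gt[THEN iffD2, OF y(1)]]
      proof eventually_elim
        case (elim n)
        have "s x y \<le> s x (x + 1 / real (Suc n))" using elim x by (intro s2) auto
        then show ?case using y by simp
      qed
    next
      fix a assume "R x < a"
      then show "\<forall>\<^sub>F n in sequentially. s x (x + 1 / Suc n) < a"
        using R_ge[OF x, of "x + 1 / Suc n" for n] by (intro always_eventually allI le_less_trans[OF R_ge[OF x]]) auto
    qed
  qed
  have limL: "(\<lambda>n. (f x - f (x - 1 / Suc n)) * Suc n) \<longlonglongrightarrow> L x" if x: "0 < x" for x
  proof -
    have e: "(f x - f (x - 1 / Suc n)) * Suc n = s (x - 1 / Suc n) x" for n by (simp add: s_def)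
    show ?thesis
      unfolding e
    proof (rule order_tendstoI)
      fix a assume "L x < a"
      then obtain y where y: "0 < y" "y < x" "s y x < a"
        unfolding L_def using cINF_less_iff[OF ne(2)[OF x] bL[OF x]] by auto
      show "\<forall>\<^sub>F n in sequentially. s (x - 1 / Suc n) x < a"
        using small[OF diff_gt_0_iff_gt[THEN iffD2, OF y(2)]]
      proof eventually_elim
        case (elim n)
        have "s (x - 1 / real (Suc n)) x \<le> s y x" using elim y by (intro s1) auto
        then show ?case using y by simp
      qed
    next
      fix a assume a: "a < L x"
      show "\<forall>\<^sub>F n in sequentially. a < s (x - 1 / Suc n) x"
        \<comment> \<open>Only for large \<open>n\<close> is \<open>x - 1 / Suc n\<close> positive,
          where concavity is available.\<close>
        using small[OF x]
      proof eventually_elim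
        case (elim n)
        then show ?case using L_le[of "x - 1 / Suc n" x] a by simp
      qed
    qed
  qed
  let ?K = "{x. 0 < x \<and> R x < L x}"
  \<comment> \<open>The slope of the chord from \<open>x\<close> to \<open>y\<close> separates the
    two.\<close>
  have sep: "L y \<le> R x" if "0 < x" "x < y" for x y
    using R_ge[OF that] L_le[OF that] by simp
  define q where "q x = (SOME r. R x < real_of_rat r \<and> real_of_rat r < L x)" for x
  have q: "R x < real_of_rat (q x) \<and> real_of_rat (q x) < L x" if "x \<in> ?K" for x
  proof -
    have "\<exists>r. R x < real_of_rat r \<and> real_of_rat r < L x" using of_rat_dense that by auto
    then show ?thesis unfolding q_def by (rule someI_ex)
  qed
  have "inj_on q ?K"
  proof (rule inj_onI)
    have *: "False" if "x \<in> ?K" "y \<in> ?K" "q x = q y" "x < y" for x y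
      using q[OF that(1)] q[OF that(2)] sep[of x y] that by auto
    fix x y assume "x \<in> ?K" "y \<in> ?K" "q x = q y"
    then show "x = y" using *[of x y] *[of y x] by (cases x y rule: linorder_cases) auto
  qed
  then have "countable ?K" by (rule countableI')
  then show ?thesis
  proof (rule countable_subset[rotated], intro subsetI)
    fix x assume x: "x \<in> {x. 0 < x \<and> \<not> (\<exists>D. (\<lambda>n. (f (x + 1 / Suc n) - f x) * Suc n) \<longlonglongrightarrow> D \<and>
      (\<lambda>n. (f x - f (x - 1 / Suc n)) * Suc n) \<longlonglongrightarrow> D)}"
    then have "R x \<noteq> L x" using limR[of x] limL[of x] by auto
    then show "x \<in> ?K" using R_le_L[of x] x by auto
  qed
qed

text \<open>Fubini, with coordinate \<open>k\<close> integrated first: countable sets are Lebesgue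
  null. It is applied to kinks and to coincidences \<open>t i = t j\<close>.\<close>

lemma AE_countable_slices:
  assumes I: "finite I" "k \<in> I" and B: "B \<in> sets (\<Pi>\<^sub>M i\<in>I. (lborel :: real measure))"
    and slice: "\<And>x. countable {y. x(k := y) \<in> B}"
  shows "AE t in (\<Pi>\<^sub>M i\<in>I. (lborel :: real measure)). t \<notin> B"
proof -
  interpret product_sigma_finite "\<lambda>_. lborel :: real measure" by unfold_locales
  define J where "J = I - {k}"
  have J: "finite J" "k \<notin> J" "I = insert k J" using I by (auto simp: J_def)
  have "emeasure (Pi\<^sub>M I (\<lambda>_. lborel)) B = (\<integral>\<^sup>+ t. indicator B t \<partial>Pi\<^sub>M I (\<lambda>_. lborel :: real measure))"
    using B by simp
  also have "\<dots> = (\<integral>\<^sup>+ x. (\<integral>\<^sup>+ y. indicator B (x(k := y)) \<partial>lborel) \<partial>Pi\<^sub>M J (\<lambda>_. lborel :: real measure))"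
    unfolding J(3) using J B by (subst product_nn_integral_insert) auto
  also have "\<dots> = (\<integral>\<^sup>+ x. 0 \<partial>Pi\<^sub>M J (\<lambda>_. lborel :: real measure))"
  proof (intro nn_integral_cong)
    fix x
    have "{y. x(k := y) \<in> B} \<in> null_sets lborel" by (rule countable_imp_null_set_lborel[OF slice])
    then have "AE y in lborel. y \<notin> {y. x(k := y) \<in> B}" by (rule AE_not_in)
    then have "(\<integral>\<^sup>+ y. indicator B (x(k := y)) \<partial>lborel) = (\<integral>\<^sup>+ y. 0 \<partial>(lborel :: real measure))"
      by (intro nn_integral_cong_AE) (auto elim!: eventually_mono)
    then show "(\<integral>\<^sup>+ y. indicator B (x(k := y)) \<partial>lborel) = 0" by simp
  qed
  finally have "B \<in> null_sets (Pi\<^sub>M I (\<lambda>_. lborel))" using B by auto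
  then show ?thesis by (rule AE_not_in)
qed

text \<open>Both measures agree on finite-dimensional cylinders. In \<open>AE_decode\<close> it
  carries an environment of weights back to one of labels.\<close>

lemma distr_PiM_map:
  assumes L: "prob_space L" and g: "g \<in> measurable L K"
  shows "distr (\<Pi>\<^sub>M i\<in>I. L) (\<Pi>\<^sub>M i\<in>I. K) (\<lambda>x. \<lambda>i\<in>I. g (x i)) = (\<Pi>\<^sub>M i\<in>I. distr L K g)"
proof (rule measure_eqI_PiM_infinite[where M = "\<lambda>_. distr L K g" and I = I])
  let ?h = "\<lambda>x. \<lambda>i\<in>I. g (x i)"
  interpret L: prob_space L by (rule L)
  interpret PL: prob_space "\<Pi>\<^sub>M i\<in>I. L" by (intro prob_space_PiM L)
  have h: "?h \<in> measurable (\<Pi>\<^sub>M i\<in>I. L) (\<Pi>\<^sub>M i\<in>I. K)"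
    using g by (intro measurable_restrict) auto
  show s: "sets (distr (\<Pi>\<^sub>M i\<in>I. L) (\<Pi>\<^sub>M i\<in>I. K) ?h) = sets (\<Pi>\<^sub>M i\<in>I. distr L K g)"
    by (simp cong: sets_PiM_cong)
  show "finite_measure (distr (\<Pi>\<^sub>M i\<in>I. L) (\<Pi>\<^sub>M i\<in>I. K) ?h)"
    using PL.prob_space_distr[OF h] by (simp add: prob_space_def)
  fix A J assume J: "finite J" "J \<subseteq> I" and A: "\<And>i. i \<in> J \<Longrightarrow> A i \<in> sets (distr L K g)"
  have A': "A i \<in> sets K" if "i \<in> J" for i using A[OF that] by simp
  have emb: "prod_emb I (\<lambda>_. distr L K g) J (Pi\<^sub>E J A) = prod_emb I (\<lambda>_. K) J (Pi\<^sub>E J A)"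
    by (simp add: prod_emb_def)
  have m: "prod_emb I (\<lambda>_. K) J (Pi\<^sub>E J A) \<in> sets (\<Pi>\<^sub>M i\<in>I. K)"
    using J A' by (intro sets_PiM_I) auto
  have pre: "?h -` prod_emb I (\<lambda>_. K) J (Pi\<^sub>E J A) \<inter> space (\<Pi>\<^sub>M i\<in>I. L) =
    prod_emb I (\<lambda>_. L) J (Pi\<^sub>E J (\<lambda>i. g -` A i \<inter> space L))"
  proof -
    have "?h x \<in> prod_emb I (\<lambda>_. K) J (Pi\<^sub>E J A) \<longleftrightarrow> (\<forall>i\<in>J. g (x i) \<in> A i)" if x: "x \<in> space (\<Pi>\<^sub>M i\<in>I. L)" for x
    proof -
      have "?h x \<in> space (\<Pi>\<^sub>M i\<in>I. K)" using measurable_space[OF h x] .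
      then show ?thesis using J by (auto simp: prod_emb_def space_PiM PiE_iff extensional_def subset_iff)
    qed
    moreover have "x \<in> prod_emb I (\<lambda>_. L) J (Pi\<^sub>E J (\<lambda>i. g -` A i \<inter> space L)) \<longleftrightarrow> (\<forall>i\<in>J. g (x i) \<in> A i)"
      if x: "x \<in> space (\<Pi>\<^sub>M i\<in>I. L)" for x
      using x J by (auto simp: prod_emb_def space_PiM PiE_iff extensional_def subset_iff)
    moreover have "prod_emb I (\<lambda>_. L) J (Pi\<^sub>E J (\<lambda>i. g -` A i \<inter> space L)) \<subseteq> space (\<Pi>\<^sub>M i\<in>I. L)"
      by (auto simp: prod_emb_def space_PiM)
    ultimately show ?thesis by blast
  qed
  have "emeasure (distr (\<Pi>\<^sub>M i\<in>I. L) (\<Pi>\<^sub>M i\<in>I. K) ?h) (prod_emb I (\<lambda>_. distr L K g) J (Pi\<^sub>E J A)) =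
    emeasure (\<Pi>\<^sub>M i\<in>I. L) (prod_emb I (\<lambda>_. L) J (Pi\<^sub>E J (\<lambda>i. g -` A i \<inter> space L)))"
    unfolding emb using m by (subst emeasure_distr[OF h]) (auto simp: pre)
  also have "\<dots> = (\<Prod>i\<in>J. emeasure L (g -` A i \<inter> space L))"
    using J L measurable_sets[OF g A'] by (intro emeasure_PiM_emb) auto
  also have "\<dots> = (\<Prod>i\<in>J. emeasure (distr L K g) (A i))"
    using g A' by (intro prod.cong refl) (simp add: emeasure_distr)
  also have "\<dots> = emeasure (\<Pi>\<^sub>M i\<in>I. distr L K g) (prod_emb I (\<lambda>_. distr L K g) J (Pi\<^sub>E J A))"
    using J A L.prob_space_distr[OF g] by (intro emeasure_PiM_emb[symmetric]) auto
  finally show "emeasure (distr (\<Pi>\<^sub>M i\<in>I. L) (\<Pi>\<^sub>M i\<in>I. K) ?h) (prod_emb I (\<lambda>_. distr L K g) J (Pi\<^sub>E J A)) =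
    emeasure (\<Pi>\<^sub>M i\<in>I. distr L K g) (prod_emb I (\<lambda>_. distr L K g) J (Pi\<^sub>E J A))" .
qed simp

section \<open>Finitely supported laws\<close>

definition types :: "nat \<Rightarrow> (nat \<Rightarrow> real) \<Rightarrow> nat measure" where
  "types N p = point_measure {0..N} (\<lambda>i. ennreal (p i))"

text \<open>Truncating the label at \<open>N\<close> keeps the weights positive off label 0 even for
  labels outside the support.\<close>

definition wt :: "nat \<Rightarrow> (nat \<Rightarrow> real) \<Rightarrow> nat \<Rightarrow> real" where
  "wt N t i = (if i = 0 then 0 else t (min i N))"

definition pos_weights :: "nat \<Rightarrow> (nat \<Rightarrow> real) \<Rightarrow> bool" where
  "pos_weights N t \<longleftrightarrow> (\<forall>i\<in>{1..N}. 0 < t i)"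

text \<open>The formula of \<open>tconst\<close> for the weights \<open>wt N t\<close>, stated for
  all \<open>t\<close>, also those with nonpositive entries, so that measurability on the whole
  product space makes sense.\<close>

definition rate :: "nat \<Rightarrow> (nat \<Rightarrow> real) \<Rightarrow> real ^ 'd::finite \<Rightarrow> (nat \<Rightarrow> real) \<Rightarrow> real" where
  "rate N p \<xi> t = lim (\<lambda>n. (\<integral>\<omega>. ttime (wt N t) \<omega> 0 (lattice_point (real n *\<^sub>R \<xi>)) \<partial>env (types N p)) / n)"

text \<open>The truncation matches \<open>wt\<close>: labels beyond \<open>N\<close> have the weight
  of label \<open>N\<close> and are counted with it.\<close>

definition type_count :: "nat \<Rightarrow> ('d::finite edge \<Rightarrow> nat) \<Rightarrow> nat \<Rightarrow> 'd edge set \<Rightarrow> nat" where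
  "type_count N \<omega> k \<gamma> = card {e\<in>\<gamma>. min (\<omega> e) N = k}"

text \<open>A two-sided partial derivative along \<open>1 / Suc n\<close>; the common limit
  \<open>D\<close> will be the density of edges of type \<open>k\<close> on geodesics.\<close>

definition rate_diff :: "nat \<Rightarrow> (nat \<Rightarrow> real) \<Rightarrow> real ^ 'd::finite \<Rightarrow> (nat \<Rightarrow> real) \<Rightarrow> nat \<Rightarrow> real \<Rightarrow> bool" where
  "rate_diff N p \<xi> t k D \<longleftrightarrow>
    (\<lambda>n. (rate N p \<xi> (t(k := t k + 1 / Suc n)) - rate N p \<xi> t) * Suc n) \<longlonglongrightarrow> D \<and>
    (\<lambda>n. (rate N p \<xi> t - rate N p \<xi> (t(k := t k - 1 / Suc n))) * Suc n) \<longlonglongrightarrow> D"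

text \<open>Only countable quantifiers occur on the right, which makes convergence a measurable
  condition.\<close>

lemma LIMSEQ_iff_Suc:
  "X \<longlonglongrightarrow> (D :: real) \<longleftrightarrow> (\<forall>i. \<exists>n0. \<forall>n\<ge>n0. \<bar>X n - D\<bar> < 1 / Suc i)"
proof
  assume "X \<longlonglongrightarrow> D"
  then show "\<forall>i. \<exists>n0. \<forall>n\<ge>n0. \<bar>X n - D\<bar> < 1 / Suc i"
    unfolding LIMSEQ_def dist_real_def by simp
next
  assume X: "\<forall>i. \<exists>n0. \<forall>n\<ge>n0. \<bar>X n - D\<bar> < 1 / Suc i"
  show "X \<longlonglongrightarrow> D"
  proof (rule LIMSEQ_I)
    fix r :: real assume "0 < r"
    then obtain i where i: "1 / real (Suc i) < r" by (rule nat_approx_posE)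
    obtain n0 where "\<forall>n\<ge>n0. \<bar>X n - D\<bar> < 1 / Suc i" using X by blast
    then show "\<exists>no. \<forall>n\<ge>no. norm (X n - D) < r" using i by (intro exI[of _ n0]) (auto intro: less_trans)
  qed
qed

section \<open>Empirical measures in terms of label counts\<close>

lemma integral_weighted_atoms:
  assumes "finite I" "\<And>i. i \<in> I \<Longrightarrow> 0 \<le> w i" "f \<in> borel_measurable borel"
  shows "integral\<^sup>L (weighted_atoms I w a) f = (\<Sum>i\<in>I. w i * f (a i :: real) :: real)"
proof -
  have "integral\<^sup>L (weighted_atoms I w a) f = (\<integral>i. f (a i) \<partial>point_measure I (\<lambda>i. ennreal (w i)))"
    unfolding weighted_atoms_def using assms(3) by (intro integral_distr) auto
  also have "\<dots> = (\<Sum>i\<in>I. w i * f (a i))"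
    using assms by (subst lebesgue_integral_point_measure_finite) auto
  finally show ?thesis .
qed

lemma weighted_atoms_nonneg_laws:
  assumes "finite I" "\<And>i. i \<in> I \<Longrightarrow> 0 \<le> w i" "sum w I = 1" "\<And>i. i \<in> I \<Longrightarrow> 0 \<le> a i"
  shows "weighted_atoms I w a \<in> nonneg_laws"
proof -
  let ?K = "point_measure I (\<lambda>i. ennreal (w i))"
  have a: "a \<in> measurable ?K borel" by auto
  have "emeasure ?K (space ?K) = 1"
    using assms by (simp add: space_point_measure emeasure_point_measure_finite sum_ennreal)
  then have K: "prob_space ?K" by (rule prob_spaceI)
  have "prob_space (weighted_atoms I w a)"
    unfolding weighted_atoms_def by (rule prob_space.prob_space_distr[OF K a])
  then have "real_distribution (weighted_atoms I w a)"
    by (simp add: real_distribution_def real_distribution_axioms_def weighted_atoms_def)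
  moreover have "AE x in weighted_atoms I w a. 0 \<le> x"
    unfolding weighted_atoms_def using assms(4)
    by (subst AE_distr_iff[OF a]) (auto simp: space_point_measure intro!: AE_I2)
  ultimately show ?thesis by (simp add: nonneg_laws_def)
qed

lemma sum_by_type:
  fixes h :: "nat \<Rightarrow> real"
  assumes "finite \<gamma>" "0 < N"
  shows "(\<Sum>e\<in>{e\<in>\<gamma>. \<omega> e \<noteq> 0}. h (min (\<omega> e) N)) = (\<Sum>k\<in>{1..N}. h k * type_count N \<omega> k \<gamma>)"
proof -
  let ?A = "{e\<in>\<gamma>. \<omega> e \<noteq> 0}"
  have "(\<Sum>e\<in>?A. h (min (\<omega> e) N)) = (\<Sum>k\<in>{1..N}. \<Sum>e\<in>{e\<in>?A. min (\<omega> e) N = k}. h (min (\<omega> e) N))"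
    using assms by (intro sum.group[symmetric]) auto
  also have "\<dots> = (\<Sum>k\<in>{1..N}. h k * type_count N \<omega> k \<gamma>)"
  proof (rule sum.cong[OF refl])
    fix k assume k: "k \<in> {1..N}"
    then have "{e\<in>?A. min (\<omega> e) N = k} = {e\<in>\<gamma>. min (\<omega> e) N = k}" by auto
    then show "(\<Sum>e\<in>{e\<in>?A. min (\<omega> e) N = k}. h (min (\<omega> e) N)) = h k * type_count N \<omega> k \<gamma>"
      by (simp add: type_count_def mult.commute)
  qed
  finally show ?thesis .
qed

lemma path_time_by_type:
  assumes "finite \<gamma>" "0 < N"
  shows "path_time (\<lambda>e. wt N t (\<omega> e)) \<gamma> = (\<Sum>k\<in>{1..N}. t k * type_count N \<omega> k \<gamma>)"
proof -
  have "path_time (\<lambda>e. wt N t (\<omega> e)) \<gamma> = (\<Sum>e\<in>{e\<in>\<gamma>. \<omega> e \<noteq> 0}. t (min (\<omega> e) N))"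
    unfolding path_time_def using assms by (intro sum.mono_neutral_cong_right) (auto simp: wt_def)
  then show ?thesis using sum_by_type[OF assms] by simp
qed

lemma path_time_upd:
  assumes "finite \<gamma>" "0 < N" "k \<in> {1..N}"
  shows "path_time (\<lambda>e. wt N (t(k := t k + s)) (\<omega> e)) \<gamma> =
    path_time (\<lambda>e. wt N t (\<omega> e)) \<gamma> + s * type_count N \<omega> k \<gamma>"
proof -
  have "(\<Sum>j\<in>{1..N}. (t(k := t k + s)) j * type_count N \<omega> j \<gamma>) =
    (\<Sum>j\<in>{1..N}. t j * type_count N \<omega> j \<gamma> + (if j = k then s * type_count N \<omega> k \<gamma> else 0))"
    by (intro sum.cong) (auto simp: algebra_simps)
  also have "\<dots> = (\<Sum>j\<in>{1..N}. t j * type_count N \<omega> j \<gamma>) + s * type_count N \<omega> k \<gamma>"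
    using assms(3) by (simp add: sum.distrib)
  finally show ?thesis by (simp add: path_time_by_type[OF assms(1,2)])
qed

lemma wt_eq_0_iff: "0 < N \<Longrightarrow> pos_weights N t \<Longrightarrow> wt N t i = 0 \<longleftrightarrow> i = 0"
  by (auto simp: wt_def pos_weights_def dest: bspec[of _ _ "min i N"])

text \<open>Positivity of the weights makes zero weight the same as label 0. On a path without
  nonzero weights both sides are 0, the right one by the convention for division by 0.\<close>

lemma integral_emp_pos:
  fixes f :: "real \<Rightarrow> real"
  assumes g: "finite \<gamma>" and N: "0 < N" and t: "pos_weights N t"
    and \<tau>: "\<And>e. e \<in> \<gamma> \<Longrightarrow> \<tau> e = wt N t (\<omega> e)" and f: "f \<in> borel_measurable borel"
  shows "integral\<^sup>L (emp_pos \<tau> \<gamma>) f =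
    (\<Sum>k\<in>{1..N}. f (t k) * type_count N \<omega> k \<gamma>) / (\<Sum>k\<in>{1..N}. real (type_count N \<omega> k \<gamma>))"
proof -
  let ?A = "{e\<in>\<gamma>. \<omega> e \<noteq> 0}"
  have A: "{e\<in>\<gamma>. \<tau> e \<noteq> 0} = ?A" using \<tau> wt_eq_0_iff[OF N t] by auto
  have "integral\<^sup>L (emp_pos \<tau> \<gamma>) f = (\<Sum>e\<in>?A. 1 / real (card ?A) * f (\<tau> e))"
    unfolding emp_pos_def Let_def A using g f by (intro integral_weighted_atoms) auto
  also have "\<dots> = (\<Sum>e\<in>?A. f (\<tau> e)) / real (card ?A)" by (simp add: sum_divide_distrib)
  also have "(\<Sum>e\<in>?A. f (\<tau> e)) = (\<Sum>e\<in>?A. f (t (min (\<omega> e) N)))"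
    using \<tau> by (intro sum.cong) (auto simp: wt_def)
  also have "\<dots> = (\<Sum>k\<in>{1..N}. f (t k) * type_count N \<omega> k \<gamma>)" by (rule sum_by_type[OF g N])
  also have "real (card ?A) = (\<Sum>k\<in>{1..N}. real (type_count N \<omega> k \<gamma>))"
    using sum_by_type[OF g N, where h = "\<lambda>_. 1" and \<omega> = \<omega>] by simp
  finally show ?thesis .
qed

locale atomic =
  fixes N :: nat and p :: "nat \<Rightarrow> real"
  assumes N: "0 < N" and p_nonneg: "\<And>i. i \<in> {0..N} \<Longrightarrow> 0 \<le> p i" and p_sum: "(\<Sum>i=0..N. p i) = 1"
begin

lemma prob_types: "prob_space (types N p)"
proof (rule prob_spaceI)
  have "(\<Sum>i=0..N. ennreal (p i)) = ennreal (\<Sum>i=0..N. p i)"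
    using p_nonneg by (intro sum_ennreal) auto
  then show "emeasure (types N p) (space (types N p)) = 1"
    using p_sum by (simp add: types_def space_point_measure emeasure_point_measure_finite)
qed

lemma wt_nonneg: "pos_weights N t \<Longrightarrow> 0 \<le> wt N t i"
  using N by (auto simp: wt_def pos_weights_def intro!: less_imp_le)

lemma bounded_weight_wt:
  assumes "pos_weights N t"
  shows "bounded_weight (types N p) (wt N t) (\<Sum>i\<in>{1..N}. t i)"
proof -
  interpret K: prob_space "types N p" by (rule prob_types)
  show ?thesis
  proof
    show "wt N t \<in> borel_measurable (types N p)" by (simp add: types_def)
    fix x
    show "0 \<le> wt N t x" by (rule wt_nonneg[OF assms])
    have t: "0 \<le> t i" if "i \<in> {1..N}" for i using assms that by (auto simp: pos_weights_def less_imp_le)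
    show "wt N t x \<le> (\<Sum>i\<in>{1..N}. t i)"
    proof (cases "x = 0")
      case True
      then show ?thesis using t by (auto simp: wt_def intro!: sum_nonneg)
    next
      case False
      then show ?thesis using t N member_le_sum[of "min x N" "{1..N}" t] by (auto simp: wt_def)
    qed
  qed
qed

lemma tconst_eq_rate: "pos_weights N t \<Longrightarrow> bounded_weight.tconst (types N p) (wt N t) \<xi> = rate N p \<xi> t"
  using bounded_weight.tconst_def[OF bounded_weight_wt] by (simp add: rate_def)

lemma rate_limit:
  assumes "pos_weights N t" "norm \<xi> = 1"
  shows "(\<lambda>n. (\<integral>\<omega>. ttime (wt N t) \<omega> 0 (lattice_point (real n *\<^sub>R \<xi>)) \<partial>env (types N p)) / n) \<longlonglongrightarrow> rate N p \<xi> t"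
  using bounded_weight.ttime_direction_limit(2)[OF bounded_weight_wt[OF assms(1)] assms(2)]
  by (simp add: tconst_eq_rate[OF assms(1)])

lemma rate_concave:
  fixes \<xi> :: "real ^ 'd::finite"
  assumes \<xi>: "norm \<xi> = 1" and t: "pos_weights N t" "pos_weights N t'" and ab: "0 \<le> a" "0 \<le> b"
    and ab': "pos_weights N (\<lambda>i. a * t i + b * t' i)"
  shows "a * rate N p \<xi> t + b * rate N p \<xi> t' \<le> rate N p \<xi> (\<lambda>i. a * t i + b * t' i)"
proof (rule LIMSEQ_le)
  let ?T = "\<lambda>t n. (\<integral>\<omega>. ttime (wt N t) \<omega> 0 (lattice_point (real n *\<^sub>R \<xi>)) \<partial>env (types N p)) / n"
  show "(\<lambda>n. a * ?T t n + b * ?T t' n) \<longlonglongrightarrow> a * rate N p \<xi> t + b * rate N p \<xi> t'"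
    by (intro tendsto_intros rate_limit t \<xi>)
  show "?T (\<lambda>i. a * t i + b * t' i) \<longlonglongrightarrow> rate N p \<xi> (\<lambda>i. a * t i + b * t' i)"
    by (rule rate_limit[OF ab' \<xi>])
  note int = bounded_weight.ttime_integrable[OF bounded_weight_wt]
  have "a * ?T t n + b * ?T t' n \<le> ?T (\<lambda>i. a * t i + b * t' i) n" for n
  proof -
    let ?l = "lattice_point (real n *\<^sub>R \<xi>)"
    have "a * (\<integral>\<omega>. ttime (wt N t) \<omega> 0 ?l \<partial>env (types N p)) + b * (\<integral>\<omega>. ttime (wt N t') \<omega> 0 ?l \<partial>env (types N p))
      = (\<integral>\<omega>. a * ttime (wt N t) \<omega> 0 ?l + b * ttime (wt N t') \<omega> 0 ?l \<partial>env (types N p))"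
      using int[OF t(1), of 0 ?l] int[OF t(2), of 0 ?l] by simp
    also have "\<dots> \<le> (\<integral>\<omega>. ttime (wt N (\<lambda>i. a * t i + b * t' i)) \<omega> 0 ?l \<partial>env (types N p))"
    proof (rule integral_mono)
      fix \<omega> :: "'d edge \<Rightarrow> nat"
      have "(\<lambda>e. wt N (\<lambda>i. a * t i + b * t' i) (\<omega> e)) = (\<lambda>e. a * wt N t (\<omega> e) + b * wt N t' (\<omega> e))"
        by (auto simp: wt_def)
      then show "a * ttime (wt N t) \<omega> 0 ?l + b * ttime (wt N t') \<omega> 0 ?l \<le> ttime (wt N (\<lambda>i. a * t i + b * t' i)) \<omega> 0 ?l"
        unfolding ttime_def using ab wt_nonneg t by (simp add: ptime_concave)
    qed (intro Bochner_Integration.integrable_add Bochner_Integration.integrable_mult_right int t ab')+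
    finally show ?thesis by (simp add: add_divide_distrib[symmetric] divide_right_mono)
  qed
  then show "\<exists>M. \<forall>n\<ge>M. a * ?T t n + b * ?T t' n \<le> ?T (\<lambda>i. a * t i + b * t' i) n" by blast
qed

section \<open>Properties of almost every weight vector\<close>

lemma coord_measurable [measurable]:
  "i \<in> {1..N} \<Longrightarrow> (\<lambda>t. t i) \<in> borel_measurable (\<Pi>\<^sub>M i\<in>{1..N}. (lborel :: real measure))"
  using measurable_component_singleton[of i "{1..N}" "\<lambda>_. lborel :: real measure"] by simp

text \<open>The passage time is a countable infimum of finite sums of edge weights, hence jointly
  measurable in \<open>t\<close> and the labels once a single weight is; the latter holds because a
  label takes finitely many values. Integrating out the labels leaves a measurable function of
  \<open>t\<close>.\<close>

lemma rate_measurable [measurable]: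
  fixes \<xi> :: "real ^ 'd::finite"
  shows "rate N p \<xi> \<in> borel_measurable (\<Pi>\<^sub>M i\<in>{1..N}. (lborel :: real measure))"
proof -
  let ?P = "\<Pi>\<^sub>M i\<in>{1..N}. (lborel :: real measure)" and ?E = "env (types N p) :: ('d edge \<Rightarrow> nat) measure"
  interpret E: prob_space ?E by (rule prob_space_env[OF prob_types])
  have edge: "(\<lambda>x. wt N (fst x) (snd x e)) \<in> borel_measurable (?P \<Otimes>\<^sub>M ?E)" if e: "e \<in> lattice_edges" for e
  proof (rule measurable_compose_countable'[where I = "{0..N}" and f = "\<lambda>i x. wt N (fst x) i" and g = "\<lambda>x. snd x e"])
    show "(\<lambda>x. wt N (fst x) i) \<in> borel_measurable (?P \<Otimes>\<^sub>M ?E)" for i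
    proof (cases "i = 0")
      case False
      then have "min i N \<in> {1..N}" using N by auto
      from measurable_compose[OF measurable_fst coord_measurable[OF this]] show ?thesis
        using False by (simp add: wt_def)
    qed (simp add: wt_def)
    have "(\<lambda>x. snd x e) \<in> measurable (?P \<Otimes>\<^sub>M ?E) (types N p)"
      by (rule measurable_compose[OF measurable_snd env_component[OF e]])
    then show "(\<lambda>x. snd x e) \<in> measurable (?P \<Otimes>\<^sub>M ?E) (count_space {0..N})"
      by (subst measurable_cong_sets[OF refl, of _ "types N p"]) (simp_all add: types_def sets_point_measure)
  qed auto
  have "(\<lambda>x. ttime (wt N (fst x)) (snd x) 0 v) \<in> borel_measurable (?P \<Otimes>\<^sub>M ?E)" for v
    unfolding ttime_def ptime_def path_time_def
  proof (intro borel_measurable_cINF_real countable_paths_between borel_measurable_sum)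
    fix \<gamma> e assume "\<gamma> \<in> paths_between 0 v" "e \<in> \<gamma>"
    then have "e \<in> lattice_edges" using path_subset by blast
    then show "(\<lambda>x. wt N (fst x) (snd x e)) \<in> borel_measurable (?P \<Otimes>\<^sub>M ?E)" by (rule edge)
  qed
  then have "(\<lambda>t. \<integral>\<omega>. ttime (wt N t) \<omega> 0 v \<partial>?E) \<in> borel_measurable ?P" for v
    by (intro E.borel_measurable_lebesgue_integral) (simp add: split_beta')
  then show ?thesis
    unfolding rate_def[abs_def] by (intro borel_measurable_lim_metric borel_measurable_divide) auto
qed

text \<open>Along coordinate \<open>k\<close> the rate is a concave function on the positive
  half-line, so each line in this direction meets the exceptional set in countably many
  points.\<close>

lemma AE_rate_diff:
  fixes \<xi> :: "real ^ 'd::finite"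
  assumes \<xi>: "norm \<xi> = 1" and k: "k \<in> {1..N}"
  shows "AE t in (\<Pi>\<^sub>M i\<in>{1..N}. (lborel :: real measure)). pos_weights N t \<longrightarrow> (\<exists>D. rate_diff N p \<xi> t k D)"
proof -
  let ?P = "\<Pi>\<^sub>M i\<in>{1..N}. (lborel :: real measure)"
  define X where "X n t = (rate N p \<xi> (t(k := t k + 1 / Suc n)) - rate N p \<xi> t) * Suc n" for n t
  define Y where "Y n t = (rate N p \<xi> t - rate N p \<xi> (t(k := t k - 1 / Suc n))) * Suc n" for n t
  define B where "B = {t\<in>space ?P. pos_weights N t \<and> \<not> (\<exists>D. rate_diff N p \<xi> t k D)}"
  have upd: "(\<lambda>t. t(k := t k + c)) \<in> measurable ?P ?P" for c
  proof (rule measurable_fun_upd[where J = "{1..N}"])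
    show "(\<lambda>t. t k + c) \<in> measurable ?P lborel"
      unfolding measurable_lborel1 by (intro borel_measurable_add coord_measurable[OF k] borel_measurable_const)
  qed (use k in auto)
  have [measurable]: "(\<lambda>t. rate N p \<xi> (t(k := t k + c))) \<in> borel_measurable ?P" for c
    by (rule measurable_compose[OF upd rate_measurable])
  have [measurable]: "(\<lambda>t. rate N p \<xi> (t(k := t k - c))) \<in> borel_measurable ?P" for c
    using measurable_compose[OF upd[of "- c"] rate_measurable] by simp
  have [measurable]: "X n \<in> borel_measurable ?P" for n
    unfolding X_def[abs_def] by measurable
  have [measurable]: "Y n \<in> borel_measurable ?P" for n
    unfolding Y_def[abs_def] by measurable
  have [measurable]: "(\<lambda>t. lim (\<lambda>n. X n t)) \<in> borel_measurable ?P"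
    by (rule borel_measurable_lim_metric) measurable
  have rd: "rate_diff N p \<xi> t k D \<longleftrightarrow> (\<lambda>n. X n t) \<longlonglongrightarrow> D \<and> (\<lambda>n. Y n t) \<longlonglongrightarrow> D" for t D
    by (simp add: rate_diff_def X_def Y_def)
  \<comment> \<open>If some \<open>D\<close> works, it is the limit of \<open>X\<close>; this
    removes an uncountable quantifier and makes the exceptional set measurable.\<close>
  have ex: "(\<exists>D. rate_diff N p \<xi> t k D) \<longleftrightarrow>
      (\<forall>i. \<exists>n0. \<forall>n\<ge>n0. \<bar>X n t - lim (\<lambda>n. X n t)\<bar> < 1 / Suc i) \<and>
      (\<forall>i. \<exists>n0. \<forall>n\<ge>n0. \<bar>Y n t - lim (\<lambda>n. X n t)\<bar> < 1 / Suc i)" for t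
    unfolding LIMSEQ_iff_Suc[symmetric] rd using limI by blast
  have pos_meas: "{t\<in>space ?P. pos_weights N t} \<in> sets ?P"
    unfolding pos_weights_def
    by (rule sets.sets_Collect_finite_All') (use coord_measurable N in auto)
  have "{t\<in>space ?P. \<not> (\<exists>D. rate_diff N p \<xi> t k D)} \<in> sets ?P"
    unfolding ex by measurable
  then have "{t\<in>space ?P. pos_weights N t} \<inter> {t\<in>space ?P. \<not> (\<exists>D. rate_diff N p \<xi> t k D)} \<in> sets ?P"
    using pos_meas by blast
  also have "{t\<in>space ?P. pos_weights N t} \<inter> {t\<in>space ?P. \<not> (\<exists>D. rate_diff N p \<xi> t k D)} = B"
    by (auto simp: B_def)
  finally have B: "B \<in> sets ?P" .
  have "countable {y. x(k := y) \<in> B}" for x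
  \<comment> \<open>If another coordinate fails to be positive, the slice is empty.\<close>
  proof (cases "\<forall>i\<in>{1..N} - {k}. 0 < x i")
    case True
    have pw: "pos_weights N (x(k := y)) \<longleftrightarrow> 0 < y" for y using True k by (auto simp: pos_weights_def)
    let ?f = "\<lambda>y. rate N p \<xi> (x(k := y))"
    have "countable {y. 0 < y \<and> \<not> (\<exists>D. (\<lambda>n. (?f (y + 1 / Suc n) - ?f y) * Suc n) \<longlonglongrightarrow> D \<and>
      (\<lambda>n. (?f y - ?f (y - 1 / Suc n)) * Suc n) \<longlonglongrightarrow> D)}"
    proof (rule countable_concave_kinks)
      fix y z a :: real assume yz: "0 < y" "0 < z" "0 \<le> a" "a \<le> 1"
      have e: "x(k := a * y + (1 - a) * z) = (\<lambda>i. a * (x(k := y)) i + (1 - a) * (x(k := z)) i)"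
        by (auto simp: algebra_simps)
      have "0 < a * y + (1 - a) * z"
      proof (cases "a = 0")
        case False
        then have "0 < a * y" using yz by simp
        then show ?thesis using yz by (intro add_pos_nonneg) auto
      qed (use yz in simp)
      then have "pos_weights N (\<lambda>i. a * (x(k := y)) i + (1 - a) * (x(k := z)) i)"
        unfolding e[symmetric] pw .
      then show "a * ?f y + (1 - a) * ?f z \<le> ?f (a * y + (1 - a) * z)"
        unfolding e using yz by (intro rate_concave \<xi>) (auto simp: pw)
    qed
    then show ?thesis
      by (rule countable_subset[rotated]) (auto simp: B_def pw rate_diff_def)
  next
    case False
    then have "\<not> pos_weights N (x(k := y))" for y by (auto simp: pos_weights_def)
    then show ?thesis by (simp add: B_def)
  qed
  then have "AE t in ?P. t \<notin> B" using k B by (intro AE_countable_slices[of _ k]) auto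
  then show ?thesis using AE_space by eventually_elim (auto simp: B_def)
qed

text \<open>A line in direction \<open>i\<close> meets the hyperplane in one point. Distinct values
  allow \<open>AE_decode\<close> to recover the labels.\<close>

lemma AE_distinct:
  assumes ij: "i \<in> {1..N}" "j \<in> {1..N}" "i \<noteq> j"
  shows "AE t in (\<Pi>\<^sub>M i\<in>{1..N}. (lborel :: real measure)). t i \<noteq> t j"
proof -
  let ?P = "\<Pi>\<^sub>M i\<in>{1..N}. (lborel :: real measure)"
  have "{t\<in>space ?P. t i = t j} \<in> sets ?P" using ij by measurable
  moreover have "countable {y. x(i := y) \<in> {t\<in>space ?P. t i = t j}}" for x
    by (rule countable_subset[of _ "{x j}"]) (use ij in auto)
  ultimately have "AE t in ?P. t \<notin> {t\<in>space ?P. t i = t j}" using ij by (intro AE_countable_slices[of _ i]) auto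
  then show ?thesis using AE_space by eventually_elim auto
qed

text \<open>Endpoints, normalisation and filter are left abstract, so that both finite geodesics and
  initial segments of infinite ones are covered. The limits of passage times enter only for
  countably many \<open>s\<close>.\<close>

lemma count_limit:
  fixes \<xi> :: "real ^ 'd::finite"
  assumes t: "pos_weights N t" and k: "k \<in> {1..N}" and D: "rate_diff N p \<xi> t k D"
    and lim: "\<And>s. pos_weights N (t(k := t k + s)) \<Longrightarrow> s \<in> {0} \<union> range (\<lambda>n. 1 / Suc n) \<union> range (\<lambda>n. - 1 / Suc n) \<Longrightarrow>
        ((\<lambda>i. ttime (wt N (t(k := t k + s))) \<omega> y (x i) / r i) \<longlongrightarrow> rate N p \<xi> (t(k := t k + s))) F"
    and r: "\<forall>\<^sub>F i in F. 0 < r i"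
    and geo: "\<forall>\<^sub>F i in F. \<gamma> i \<in> paths_between y (x i) \<and>
        path_time (\<lambda>e. wt N t (\<omega> e)) (\<gamma> i) = ttime (wt N t) \<omega> y (x i)"
  shows "((\<lambda>i. type_count N \<omega> k (\<gamma> i) / r i) \<longlongrightarrow> D) F"
proof -
  let ?T = "\<lambda>s i. ttime (wt N (t(k := t k + s))) \<omega> y (x i)"
  let ?\<rho> = "\<lambda>s. rate N p \<xi> (t(k := t k + s))"
  have pw: "pos_weights N (t(k := t k + s)) \<longleftrightarrow> 0 < t k + s" for s
    using t k by (auto simp: pos_weights_def)
  have tk: "0 < t k" using t k by (auto simp: pos_weights_def)
  have T_le: "?T s i \<le> ?T 0 i + s * type_count N \<omega> k (\<gamma> i)"
    if "0 < t k + s" and g: "\<gamma> i \<in> paths_between y (x i)"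
      "path_time (\<lambda>e. wt N t (\<omega> e)) (\<gamma> i) = ttime (wt N t) \<omega> y (x i)" for s i
  proof -
    have "?T s i \<le> path_time (\<lambda>e. wt N (t(k := t k + s)) (\<omega> e)) (\<gamma> i)"
      unfolding ttime_def using that pw wt_nonneg by (intro ptime_le) auto
    also have "\<dots> = ?T 0 i + s * type_count N \<omega> k (\<gamma> i)"
      using path_time_upd[OF path_finite[OF g(1)] N k] g(2) by simp
    finally show ?thesis .
  qed
  have D1: "(\<lambda>n. (?\<rho> (1 / Suc n) - ?\<rho> 0) * Suc n) \<longlonglongrightarrow> D"
    and D2: "(\<lambda>n. (?\<rho> 0 - ?\<rho> (- 1 / Suc n)) * Suc n) \<longlonglongrightarrow> D"
    using D by (auto simp: rate_diff_def)
  have lim0: "((\<lambda>i. ?T 0 i / r i) \<longlongrightarrow> ?\<rho> 0) F" by (rule lim) (use t in auto)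
  show ?thesis
  proof (rule order_tendstoI)
    fix a assume "a < D"
    \<comment> \<open>The step \<open>1 / Suc n\<close> is fixed before \<open>i\<close> varies, so
      the limits in \<open>i\<close> need no uniformity in the step.\<close>
    then obtain n where n: "a < (?\<rho> (1 / Suc n) - ?\<rho> 0) * Suc n"
      using eventually_happens'[OF sequentially_bot order_tendstoD(1)[OF D1]] by blast
    have s: "0 < t k + 1 / Suc n" using tk by (simp add: add_pos_pos)
    have "((\<lambda>i. (?T (1 / Suc n) i / r i - ?T 0 i / r i) * Suc n) \<longlongrightarrow> (?\<rho> (1 / Suc n) - ?\<rho> 0) * Suc n) F"
      using s pw by (intro tendsto_intros lim0 lim) auto
    from order_tendstoD(1)[OF this n] r geo
    show "\<forall>\<^sub>F i in F. a < type_count N \<omega> k (\<gamma> i) / r i"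
    proof eventually_elim
      case (elim i)
      have "?T (1 / Suc n) i - ?T 0 i \<le> 1 / Suc n * type_count N \<omega> k (\<gamma> i)"
        using T_le[OF s, of i] elim(3) by simp
      then have "(?T (1 / Suc n) i - ?T 0 i) * Suc n \<le> type_count N \<omega> k (\<gamma> i)"
        by (simp add: pos_le_divide_eq del: of_nat_Suc)
      then have "(?T (1 / Suc n) i - ?T 0 i) * Suc n / r i \<le> type_count N \<omega> k (\<gamma> i) / r i"
        using elim(2) by (intro divide_right_mono) auto
      moreover have "(?T (1 / Suc n) i - ?T 0 i) * Suc n / r i = (?T (1 / Suc n) i / r i - ?T 0 i / r i) * Suc n"
        by (simp add: diff_divide_distrib left_diff_distrib)
      ultimately show ?case using elim(1) by linarith
    qed
  next
    fix a assume "D < a"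
    \<comment> \<open>Lowering \<open>t k\<close> must leave it positive.\<close>
    have "\<forall>\<^sub>F n in sequentially. 1 / real (Suc n) < t k"
      using order_tendstoD(2)[OF LIMSEQ_inverse_real_of_nat tk] by (simp add: inverse_eq_divide)
    from eventually_happens'[OF sequentially_bot eventually_conj[OF this order_tendstoD(2)[OF D2 \<open>D < a\<close>]]]
    obtain n where n: "1 / real (Suc n) < t k" "(?\<rho> 0 - ?\<rho> (- 1 / Suc n)) * Suc n < a" by blast
    have s: "0 < t k + - 1 / Suc n" using n(1) by simp
    have "((\<lambda>i. ?T (- 1 / Suc n) i / r i) \<longlongrightarrow> ?\<rho> (- 1 / Suc n)) F"
      by (rule lim[OF pw[THEN iffD2, OF s]]) (intro UnI2 rangeI)
    then have "((\<lambda>i. (?T 0 i / r i - ?T (- 1 / Suc n) i / r i) * Suc n) \<longlongrightarrow> (?\<rho> 0 - ?\<rho> (- 1 / Suc n)) * Suc n) F"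
      by (intro tendsto_intros lim0)
    from order_tendstoD(2)[OF this n(2)] r geo
    show "\<forall>\<^sub>F i in F. type_count N \<omega> k (\<gamma> i) / r i < a"
    proof eventually_elim
      case (elim i)
      have "1 / Suc n * type_count N \<omega> k (\<gamma> i) \<le> ?T 0 i - ?T (- 1 / Suc n) i"
        using T_le[OF s, of i] elim(3) by simp
      then have "type_count N \<omega> k (\<gamma> i) \<le> (?T 0 i - ?T (- 1 / Suc n) i) * Suc n"
        by (simp add: pos_divide_le_eq del: of_nat_Suc)
      then have "type_count N \<omega> k (\<gamma> i) / r i \<le> (?T 0 i - ?T (- 1 / Suc n) i) * Suc n / r i"
        using elim(2) by (intro divide_right_mono) auto
      moreover have "(?T 0 i - ?T (- 1 / Suc n) i) * Suc n / r i = (?T 0 i / r i - ?T (- 1 / Suc n) i / r i) * Suc n"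
        by (simp add: diff_divide_distrib left_diff_distrib)
      ultimately show ?case using elim(1) by linarith
    qed
  qed
qed

end

text \<open>Countable, so that one null set serves for all perturbed weights; the step 0 includes
  \<open>t\<close> itself.\<close>

definition perturb :: "nat \<Rightarrow> (nat \<Rightarrow> real) \<Rightarrow> (nat \<Rightarrow> real) set" where
  "perturb N t = (\<Union>k\<in>{1..N}. (\<lambda>s. t(k := t k + s)) ` ({0} \<union> range (\<lambda>n. 1 / Suc n) \<union> range (\<lambda>n. - 1 / Suc n)))"

text \<open>The second branch is a dummy law; it is taken only if no geodesics exist almost surely.\<close>

definition emp_limit :: "nat \<Rightarrow> (nat \<Rightarrow> real) \<Rightarrow> (nat \<Rightarrow> real) \<Rightarrow> real measure" where
  "emp_limit N t D = (if (\<forall>k\<in>{1..N}. 0 \<le> D k) \<and> 0 < (\<Sum>k\<in>{1..N}. D k)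
    then weighted_atoms {1..N} (\<lambda>k. D k / (\<Sum>k\<in>{1..N}. D k)) t
    else weighted_atoms {0 :: nat} (\<lambda>_. 1) (\<lambda>_. 0))"

lemma emp_limit_nonneg_laws:
  assumes "pos_weights N t"
  shows "emp_limit N t D \<in> nonneg_laws"
proof (cases "(\<forall>k\<in>{1..N}. 0 \<le> D k) \<and> 0 < (\<Sum>k\<in>{1..N}. D k)")
  case True
  have "weighted_atoms {1..N} (\<lambda>k. D k / (\<Sum>k\<in>{1..N}. D k)) t \<in> nonneg_laws"
  proof (rule weighted_atoms_nonneg_laws)
    show "(\<Sum>k\<in>{1..N}. D k / (\<Sum>k\<in>{1..N}. D k)) = 1"
      using True unfolding sum_divide_distrib[symmetric] by simp
  qed (use True assms in \<open>auto simp: pos_weights_def intro: less_imp_le\<close>)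
  then show ?thesis using True by (simp add: emp_limit_def)
next
  case False
  then show ?thesis unfolding emp_limit_def by (auto intro!: weighted_atoms_nonneg_laws)
qed

lemma countable_perturb: "countable (perturb N t)"
  unfolding perturb_def by (intro countable_UN countable_image countable_Un) auto

section \<open>From passage times to empirical measures, and from labels to weights\<close>

context atomic
begin

text \<open>The empirical integral is a quotient of label counts, and dividing both by
  \<open>r i\<close> gives a convergent quotient as soon as the limiting counts have positive sum.
  Their signs are known because they are limits of counts along a nontrivial filter.\<close>

lemma emp_converges:
  fixes \<xi> :: "real ^ 'd::finite" and \<tau> :: "'d edge \<Rightarrow> real"
  assumes t: "pos_weights N t" and D: "\<And>k. k \<in> {1..N} \<Longrightarrow> rate_diff N p \<xi> t k (D k)"
    and rate: "0 < rate N p \<xi> t"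
    and lim: "\<And>t'. t' \<in> perturb N t \<Longrightarrow> pos_weights N t' \<Longrightarrow>
        ((\<lambda>i. ttime (wt N t') \<omega> y (x i) / r i) \<longlongrightarrow> rate N p \<xi> t') F"
    and F: "F \<noteq> bot" and r: "\<forall>\<^sub>F i in F. 0 < r i"
    and geo: "\<forall>\<^sub>F i in F. \<gamma> i \<in> paths_between y (x i) \<and> path_time \<tau> (\<gamma> i) = ptime \<tau> y (x i)"
    and \<tau>: "\<And>e. e \<in> lattice_edges \<Longrightarrow> \<tau> e = wt N t (\<omega> e)"
  shows "weak_conv_along (\<lambda>i. emp_pos \<tau> (\<gamma> i)) (emp_limit N t D) F"
proof -
  let ?N = "\<lambda>k i. real (type_count N \<omega> k (\<gamma> i))"
  have pt: "path_time \<tau> \<gamma> = path_time (\<lambda>e. wt N t (\<omega> e)) \<gamma>" if "\<gamma> \<in> paths_between u v" for \<gamma> u v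
    unfolding path_time_def using path_subset[OF that] \<tau> by (intro sum.cong) auto
  have pT: "ptime \<tau> u v = ttime (wt N t) \<omega> u v" for u v
    unfolding ttime_def using \<tau> by (intro ptime_cong) auto
  have geo': "\<forall>\<^sub>F i in F. \<gamma> i \<in> paths_between y (x i) \<and>
        path_time (\<lambda>e. wt N t (\<omega> e)) (\<gamma> i) = ttime (wt N t) \<omega> y (x i)"
    using geo by eventually_elim (auto simp: pt pT)
  have cl: "((\<lambda>i. ?N k i / r i) \<longlongrightarrow> D k) F" if k: "k \<in> {1..N}" for k
  proof (rule count_limit[OF t k D[OF k] _ r geo'])
    fix s assume "pos_weights N (t(k := t k + s))"
      "s \<in> {0} \<union> range (\<lambda>n. 1 / Suc n) \<union> range (\<lambda>n. - 1 / Suc n)"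
    then show "((\<lambda>i. ttime (wt N (t(k := t k + s))) \<omega> y (x i) / r i) \<longlongrightarrow> rate N p \<xi> (t(k := t k + s))) F"
      using k unfolding perturb_def by (intro lim[unfolded perturb_def]) blast+
  qed
  have D0: "0 \<le> D k" if k: "k \<in> {1..N}" for k
  proof (rule tendsto_lowerbound[OF cl[OF k] _ F])
    show "\<forall>\<^sub>F i in F. 0 \<le> ?N k i / r i" using r by eventually_elim simp
  qed
  have t_in: "t \<in> perturb N t" unfolding perturb_def using N by (intro UN_I[of 1] image_eqI[of _ _ 0]) auto
  \<comment> \<open>The time of a geodesic is the sum of its counts weighted by \<open>t\<close>, so
    the limits satisfy \<open>(\<Sum>k\<in>{1..N}. t k * D k) = rate N p \<xi> t\<close>; positivity
    of the rate excludes that all \<open>D k\<close> vanish.\<close>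
  have "((\<lambda>i. \<Sum>k\<in>{1..N}. t k * (?N k i / r i)) \<longlongrightarrow> (\<Sum>k\<in>{1..N}. t k * D k)) F"
    by (intro tendsto_intros cl)
  moreover have "((\<lambda>i. \<Sum>k\<in>{1..N}. t k * (?N k i / r i)) \<longlongrightarrow> rate N p \<xi> t) F"
  proof (rule Lim_transform_eventually[OF lim[OF t_in t]])
    show "\<forall>\<^sub>F i in F. ttime (wt N t) \<omega> y (x i) / r i = (\<Sum>k\<in>{1..N}. t k * (?N k i / r i))"
      using geo'
    proof eventually_elim
      case (elim i)
      then have "ttime (wt N t) \<omega> y (x i) = (\<Sum>k\<in>{1..N}. t k * ?N k i)"
        using path_time_by_type[OF path_finite N] by metis
      then show ?case by (simp add: sum_divide_distrib)
    qed
  qed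
  ultimately have "(\<Sum>k\<in>{1..N}. t k * D k) = rate N p \<xi> t" using tendsto_unique[OF F] by blast
  then have "\<exists>k\<in>{1..N}. D k \<noteq> 0" using rate by (metis (no_types, lifting) less_irrefl mult_zero_right sum.neutral)
  then have Dpos: "0 < (\<Sum>k\<in>{1..N}. D k)" using D0 by (metis (no_types, lifting) finite_atLeastAtMost order_le_less sum_pos2)
  show ?thesis
    unfolding weak_conv_along_def
  proof (intro allI impI)
    fix f :: "real \<Rightarrow> real" assume "continuous_on UNIV f \<and> bounded (range f)"
    then have f: "f \<in> borel_measurable borel" using borel_measurable_continuous_onI by blast
    have "integral\<^sup>L (emp_limit N t D) f = (\<Sum>k\<in>{1..N}. D k / (\<Sum>k\<in>{1..N}. D k) * f (t k))"
    proof -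
      have "integral\<^sup>L (weighted_atoms {1..N} (\<lambda>k. D k / (\<Sum>k\<in>{1..N}. D k)) t) f =
        (\<Sum>k\<in>{1..N}. D k / (\<Sum>k\<in>{1..N}. D k) * f (t k))"
        using D0 Dpos f by (intro integral_weighted_atoms divide_nonneg_pos) auto
      then show ?thesis using D0 Dpos by (simp add: emp_limit_def)
    qed
    also have "\<dots> = (\<Sum>k\<in>{1..N}. f (t k) * D k) / (\<Sum>k\<in>{1..N}. D k)"
      by (simp add: sum_divide_distrib mult.commute)
    finally have nu: "integral\<^sup>L (emp_limit N t D) f = (\<Sum>k\<in>{1..N}. f (t k) * D k) / (\<Sum>k\<in>{1..N}. D k)" .
    have "((\<lambda>i. (\<Sum>k\<in>{1..N}. f (t k) * (?N k i / r i)) / (\<Sum>k\<in>{1..N}. ?N k i / r i)) \<longlongrightarrow>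
        (\<Sum>k\<in>{1..N}. f (t k) * D k) / (\<Sum>k\<in>{1..N}. D k)) F"
      using Dpos by (intro tendsto_intros cl) auto
    then show "((\<lambda>i. integral\<^sup>L (emp_pos \<tau> (\<gamma> i)) f) \<longlongrightarrow> integral\<^sup>L (emp_limit N t D) f) F"
      unfolding nu
    proof (rule Lim_transform_eventually)
      show "\<forall>\<^sub>F i in F. (\<Sum>k\<in>{1..N}. f (t k) * (?N k i / r i)) / (\<Sum>k\<in>{1..N}. ?N k i / r i) =
        integral\<^sup>L (emp_pos \<tau> (\<gamma> i)) f"
        using geo r
      proof eventually_elim
        case (elim i)
        have "\<tau> e = wt N t (\<omega> e)" if "e \<in> \<gamma> i" for e using \<tau> path_subset elim(1) that by blast
        then have "integral\<^sup>L (emp_pos \<tau> (\<gamma> i)) f = (\<Sum>k\<in>{1..N}. f (t k) * ?N k i) / (\<Sum>k\<in>{1..N}. ?N k i)"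
          using elim(1) path_finite by (intro integral_emp_pos[OF _ N t _ f]) auto
        also have "\<dots> = ((\<Sum>k\<in>{1..N}. f (t k) * ?N k i) / r i) / ((\<Sum>k\<in>{1..N}. ?N k i) / r i)"
          using elim(2) by simp
        finally show ?case by (simp add: sum_divide_distrib)
      qed
    qed
  qed
qed

lemma AE_direction_limits:
  fixes \<xi> :: "real ^ 'd::finite"
  assumes \<xi>: "norm \<xi> = 1"
  shows "AE \<omega> in env (types N p). \<forall>t'\<in>perturb N t. pos_weights N t' \<longrightarrow>
    ((\<lambda>r. ttime (wt N t') \<omega> 0 (lattice_point (r *\<^sub>R \<xi>)) / r) \<longlongrightarrow> rate N p \<xi> t') at_top"
  unfolding AE_ball_countable[OF countable_perturb]
proof
  fix t' assume "t' \<in> perturb N t"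
  show "AE \<omega> in env (types N p). pos_weights N t' \<longrightarrow>
    ((\<lambda>r. ttime (wt N t') \<omega> 0 (lattice_point (r *\<^sub>R \<xi>)) / r) \<longlongrightarrow> rate N p \<xi> t') at_top"
    using bounded_weight.ttime_direction_limit(1)[OF bounded_weight_wt \<xi>]
    by (cases "pos_weights N t'") (auto simp: tconst_eq_rate)
qed

text \<open>The law of the weights is the image of the law of the labels under \<open>a\<close>,
  which is injective on labels because the values are positive and distinct. The inverse
  \<open>dec\<close> maps a product environment of weights to one of labels with the right law, so
  almost sure statements pull back.\<close>

lemma AE_decode:
  assumes t: "pos_weights N t" "inj_on t {1..N}"
    and P: "AE \<omega> in env (types N p). P \<omega>"
  shows "AE \<tau> in fpp_space (weighted_atoms {0..N} p (\<lambda>i. if i = 0 then 0 else t i)).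
    \<exists>\<omega>. P \<omega> \<and> (\<forall>e\<in>(lattice_edges :: 'd::finite edge set). \<tau> e = wt N t (\<omega> e))"
proof -
  define a where "a = (\<lambda>i::nat. if i = 0 then 0 else t i)"
  define L where "L = weighted_atoms {0..N} p a"
  \<comment> \<open>Values that are no \<open>t i\<close> get label 0; almost surely the only such
    value is 0 itself.\<close>
  define dec where "dec x = (if x \<in> t ` {1..N} then the_inv_into {1..N} t x else 0)" for x
  have am: "a \<in> measurable (types N p) borel" by (simp add: types_def)
  have L: "L = distr (types N p) borel a" by (simp add: L_def weighted_atoms_def types_def)
  interpret T: prob_space "types N p" by (rule prob_types)
  have PL: "prob_space L" unfolding L by (rule T.prob_space_distr[OF am])
  have t0: "0 \<notin> t ` {1..N}" using t(1) by (auto simp: pos_weights_def)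
  have dec_t: "dec (t i) = i" if "i \<in> {1..N}" for i
    using that t(2) by (simp add: dec_def the_inv_into_f_f)
  have dec_a: "dec (a i) = i" if "i \<in> {0..N}" for i
    using that dec_t[of i] t0 by (cases "i = 0") (auto simp: a_def dec_def)
  have wt_a: "wt N t i = a i" if "i \<in> {0..N}" for i
    using that by (auto simp: wt_def a_def)
  have dec_in: "dec x \<in> {0..N}" for x
    using dec_t by (cases "x \<in> t ` {1..N}") (auto simp: dec_def)
  have decm: "dec \<in> measurable L (types N p)"
  proof -
    have "dec \<in> measurable borel (count_space {0..N})"
    proof (subst measurable_count_space_eq2, simp, intro conjI ballI)
      show "dec \<in> space borel \<rightarrow> {0..N}" using dec_in by auto
      fix i assume i: "i \<in> {0..N}"
      show "dec -` {i} \<inter> space borel \<in> sets borel"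
      proof (cases "i = 0")
        case True
        have "dec -` {0} = - (t ` {1..N})"
          using dec_t by (auto simp: dec_def split: if_splits)
        moreover have "t ` {1..N} \<in> sets borel" by (intro borel_closed finite_imp_closed) auto
        ultimately show ?thesis using True by auto
      next
        case False
        then have "dec -` {i} = {t i}"
          using dec_t i by (auto simp: dec_def the_inv_into_f_f[OF t(2)] split: if_splits)
        then show ?thesis by simp
      qed
    qed
    moreover have "measurable L (types N p) = measurable borel (count_space {0..N})"
      by (intro measurable_cong_sets) (simp_all add: L types_def sets_point_measure)
    ultimately show ?thesis by simp
  qed
  have "distr L (types N p) dec = distr (types N p) (types N p) (dec \<circ> a)"
    unfolding L using decm am by (intro distr_distr) (simp_all add: L)
  also have "\<dots> = distr (types N p) (types N p) (\<lambda>x. x)"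
    by (intro distr_cong refl) (auto simp: types_def space_point_measure dec_a)
  finally have dd: "distr L (types N p) dec = types N p" by (simp add: distr_id)
  let ?h = "\<lambda>\<tau>. \<lambda>e\<in>(lattice_edges :: 'd edge set). dec (\<tau> e)"
  let ?PL = "\<Pi>\<^sub>M e\<in>(lattice_edges :: 'd edge set). L"
  have dPL: "distr ?PL (env (types N p)) ?h = env (types N p)"
    unfolding env_def distr_PiM_map[OF PL decm] dd ..
  have "AE \<omega> in distr ?PL (env (types N p)) ?h. P \<omega>" unfolding dPL by (rule P)
  moreover have "?h \<in> measurable ?PL (env (types N p))"
    unfolding env_def using decm by (intro measurable_restrict) auto
  ultimately have 1: "AE \<tau> in ?PL. P (?h \<tau>)" by (rule AE_distrD[rotated])
  have "AE x in L. x \<in> a ` {0..N}"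
    unfolding L
  proof (subst AE_distr_iff[OF am])
    have "a ` {0..N} \<in> sets borel" by (intro borel_closed finite_imp_closed) auto
    then show "{x \<in> space borel. x \<in> a ` {0..N}} \<in> sets borel" by simp
    show "AE x in types N p. a x \<in> a ` {0..N}" by (intro AE_I2) (auto simp: types_def space_point_measure)
  qed
  then have "AE \<tau> in ?PL. \<tau> e \<in> a ` {0..N}" if "e \<in> lattice_edges" for e :: "'d edge"
    using AE_PiM_component[of lattice_edges "\<lambda>_. L" e] PL that by auto
  then have 2: "AE \<tau> in ?PL. \<forall>e\<in>lattice_edges. \<tau> e \<in> a ` {0..N}"
    unfolding AE_ball_countable[OF countable_lattice_edges] by blast
  have "AE \<tau> in ?PL. \<exists>\<omega>. P \<omega> \<and> (\<forall>e\<in>(lattice_edges :: 'd edge set). \<tau> e = wt N t (\<omega> e))"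
    using 1 2
  proof eventually_elim
    case (elim \<tau>)
    have "\<tau> e = wt N t (?h \<tau> e)" if "e \<in> lattice_edges" for e
    proof -
      obtain i where "i \<in> {0..N}" "\<tau> e = a i" using elim(2) \<open>e \<in> lattice_edges\<close> by blast
      then show ?thesis using that by (simp add: dec_a wt_a)
    qed
    then show ?case using elim(1) by blast
  qed
  then have "AE \<tau> in fpp_space L. \<exists>\<omega>. P \<omega> \<and> (\<forall>e\<in>(lattice_edges :: 'd edge set). \<tau> e = wt N t (\<omega> e))"
    unfolding fpp_space_def by (rule AE_completion)
  then show ?thesis unfolding L_def a_def .
qed

lemma cdf_law_0:
  assumes "pos_weights N t"
  shows "cdf (weighted_atoms {0..N} p (\<lambda>i. if i = 0 then 0 else t i)) 0 = p 0"
    and "measure (types N p) {0} = p 0"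
proof -
  let ?a = "\<lambda>i::nat. if i = 0 then 0 else t i"
  have am: "?a \<in> measurable (types N p) borel" by (simp add: types_def)
  show m: "measure (types N p) {0} = p 0"
    using p_nonneg by (simp add: types_def measure_def emeasure_point_measure_finite)
  have "?a -` {..0} \<inter> space (types N p) = {0}"
  proof -
    have "\<not> t i \<le> 0" if "i \<noteq> 0" "i \<le> N" for i using assms that by (auto simp: pos_weights_def not_le)
    then show ?thesis by (auto simp: types_def space_point_measure split: if_splits)
  qed
  then have "measure (distr (types N p) borel ?a) {..0} = p 0"
    using m by (simp add: measure_distr[OF am])
  then show "cdf (weighted_atoms {0..N} p ?a) 0 = p 0"
    by (simp add: cdf_def weighted_atoms_def types_def)
qed

end

section \<open>Endpoints of geodesics tend to infinity\<close>

lemma direction_lattice_point: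
  fixes \<xi> :: "real ^ 'd::finite"
  assumes \<xi>: "norm \<xi> = 1"
  shows "filterlim (\<lambda>n. norm (real_vec (lattice_point (n *\<^sub>R \<xi>)) :: real ^ 'd)) at_top at_top"
    and "((\<lambda>n. real_vec (lattice_point (n *\<^sub>R \<xi>)) /\<^sub>R norm (real_vec (lattice_point (n *\<^sub>R \<xi>)) :: real ^ 'd)) \<longlongrightarrow> \<xi>) at_top"
proof -
  let ?v = "\<lambda>n. real_vec (lattice_point (n *\<^sub>R \<xi>)) :: real ^ 'd"
  have "\<forall>\<^sub>F n in at_top. - real CARD('d) + n \<le> norm (?v n)"
    using eventually_ge_at_top[of 0]
  proof eventually_elim
    case (elim n)
    have "n = norm (n *\<^sub>R \<xi>)" using elim \<xi> by simp
    also have "\<dots> \<le> norm (?v n) + norm (?v n - n *\<^sub>R \<xi>)" by (metis norm_minus_commute norm_triangle_sub)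
    finally show ?case using norm_lattice_point[of "n *\<^sub>R \<xi>"] by simp
  qed
  moreover have "filterlim (\<lambda>n. - real CARD('d) + n) at_top (at_top :: real filter)"
    by (rule filterlim_tendsto_add_at_top[OF tendsto_const filterlim_ident])
  ultimately show "filterlim (\<lambda>n. norm (?v n)) at_top at_top"
    by (rule filterlim_at_top_mono[rotated])
  have "((\<lambda>n. ?v n /\<^sub>R n - \<xi>) \<longlongrightarrow> 0) at_top"
  proof (rule Lim_null_comparison)
    show "\<forall>\<^sub>F n in at_top. norm (?v n /\<^sub>R n - \<xi>) \<le> CARD('d) / n"
      using eventually_gt_at_top[of 0]
    proof eventually_elim
      case (elim n)
      have "?v n /\<^sub>R n - \<xi> = (?v n - n *\<^sub>R \<xi>) /\<^sub>R n" using elim by (simp add: scaleR_diff_right)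
      then have "norm (?v n /\<^sub>R n - \<xi>) = norm (?v n - n *\<^sub>R \<xi>) / n" using elim by (simp add: divide_inverse mult.commute)
      then show ?case using norm_lattice_point[of "n *\<^sub>R \<xi>"] elim by (simp add: divide_right_mono)
    qed
    show "((\<lambda>n::real. CARD('d) / n) \<longlongrightarrow> 0) at_top"
      by (intro tendsto_divide_0[OF tendsto_const] filterlim_at_top_imp_at_infinity filterlim_ident)
  qed
  then have v: "((\<lambda>n. ?v n /\<^sub>R n) \<longlongrightarrow> \<xi>) at_top" using Lim_null by blast
  then have "((\<lambda>n. (?v n /\<^sub>R n) /\<^sub>R norm (?v n /\<^sub>R n)) \<longlongrightarrow> \<xi> /\<^sub>R norm \<xi>) at_top"
    using \<xi> by (intro tendsto_intros) auto
  then have "((\<lambda>n. (?v n /\<^sub>R n) /\<^sub>R norm (?v n /\<^sub>R n)) \<longlongrightarrow> \<xi>) at_top" using \<xi> by simp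
  then show "((\<lambda>n. ?v n /\<^sub>R norm (?v n)) \<longlongrightarrow> \<xi>) at_top"
  proof (rule Lim_transform_eventually)
    show "\<forall>\<^sub>F n in at_top. (?v n /\<^sub>R n) /\<^sub>R norm (?v n /\<^sub>R n) = ?v n /\<^sub>R norm (?v n)"
      using eventually_gt_at_top[of 0] by eventually_elim simp
  qed
qed

text \<open>A self-avoiding sequence visits each finite ball only finitely often, so the
  normalisation by the norm of the endpoint is legitimate for infinite geodesics.\<close>

lemma inj_vertices_to_infinity:
  fixes x :: "nat \<Rightarrow> 'd::finite vertex"
  assumes "inj x"
  shows "filterlim (\<lambda>l. norm (real_vec (x l) :: real ^ 'd)) at_top sequentially"
  unfolding filterlim_at_top
proof
  fix Z :: real
  let ?B = "lball (0 :: 'd vertex) (nat \<lceil>CARD('d) * Z\<rceil>)"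
  have "finite (x -` ?B)" using finite_lball assms by (rule finite_vimageI)
  then have "\<forall>\<^sub>F l in sequentially. l \<notin> x -` ?B"
    unfolding cofinite_eq_sequentially[symmetric] eventually_cofinite by (simp add: vimage_def)
  then show "\<forall>\<^sub>F l in sequentially. Z \<le> norm (real_vec (x l) :: real ^ 'd)"
  proof eventually_elim
    case (elim l)
    then have "CARD('d) * Z < dist1 0 (x l)" by (simp add: lball_def not_le) linarith
    also have "\<dots> \<le> CARD('d) * norm (real_vec (x l) :: real ^ 'd)" using dist1_le_norm[of 0 "x l"] by simp
    finally show ?case by simp
  qed
qed

theorem theorem3p9:
  fixes \<xi> :: "real ^ 'd::finite" and N :: nat and p :: "nat \<Rightarrow> real"
  assumes "CARD('d) \<ge> 2"
    and "N > 0"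
    and "\<xi> \<in> sphere 0 1"
    and "\<And>i. i \<in> {0..N} \<Longrightarrow> p i \<in> {0..1}"
    and "(\<Sum>i=0..N. p i) = 1"
  shows "AE t in (\<Pi>\<^sub>M i\<in>{1..N}. (lborel :: real measure)).
           (\<forall>i\<in>{1..N}. 0 < t i) \<longrightarrow>
           weighted_atoms {0..N} p (\<lambda>i. if i = 0 then 0 else t i) \<in> P_emp \<xi> \<inter> P_emp_inf \<xi>"
proof -
  interpret atomic N p using assms by unfold_locales auto
  have \<xi>: "norm \<xi> = 1" using assms(3) by simp
  let ?P = "\<Pi>\<^sub>M i\<in>{1..N}. (lborel :: real measure)"
  have diff: "AE t in ?P. \<forall>k\<in>{1..N}. pos_weights N t \<longrightarrow> (\<exists>D. rate_diff N p \<xi> t k D)"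
    by (intro AE_finite_allI AE_rate_diff \<xi>) auto
  have "AE t in ?P. \<forall>i\<in>{1..N}. \<forall>j\<in>{1..N} - {i}. t i \<noteq> t j"
    by (intro AE_finite_allI AE_distinct) auto
  from this diff show ?thesis
  proof eventually_elim
    case (elim t)
    show ?case
    proof
      assume "\<forall>i\<in>{1..N}. 0 < t i"
      then have t: "pos_weights N t" by (simp add: pos_weights_def)
      have inj: "inj_on t {1..N}" using elim(1) by (auto simp: inj_on_def)
      let ?L = "weighted_atoms {0..N} p (\<lambda>i. if i = 0 then 0 else t i)"
      have L: "?L \<in> nonneg_laws"
        using t p_nonneg p_sum by (intro weighted_atoms_nonneg_laws) (auto simp: pos_weights_def intro: less_imp_le)
      show "?L \<in> P_emp \<xi> \<inter> P_emp_inf \<xi>"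
      proof (cases "critical_prob TYPE('d) \<le> p 0")
        case True
        then show ?thesis using L by (simp add: P_emp_def P_emp_inf_def cdf_law_0[OF t])
      next
        case False
        \<comment> \<open>\<open>D\<close> depends on \<open>t\<close> alone, so the limit law is
          deterministic and serves for finite and infinite geodesics alike.\<close>
        obtain D where D: "\<And>k. k \<in> {1..N} \<Longrightarrow> rate_diff N p \<xi> t k (D k)"
          using elim(2) t by metis
        \<comment> \<open>A uniform lower bound on the nonzero weights, as \<open>tconst_pos\<close>
          requires with \<open>Z = {0}\<close>.\<close>
        define s where "s = Min (t ` {1..N})"
        have s: "0 < s" "i \<in> {1..N} \<Longrightarrow> s \<le> t i" for i
          using t N by (auto simp: s_def pos_weights_def)
        interpret W: bounded_weight "types N p" "wt N t" "\<Sum>i\<in>{1..N}. t i" by (rule bounded_weight_wt[OF t])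
        have "0 < W.tconst \<xi>"
        proof (rule W.tconst_pos[OF \<xi>, of "{0}"])
          show "{0} \<in> sets (types N p)" by (simp add: types_def sets_point_measure)
          show "measure (types N p) {0} < critical_prob TYPE('d)" using False cdf_law_0(2)[OF t] by simp
          show "s \<le> wt N t x" if "x \<notin> {0}" for x using that N s(2)[of "min x N"] by (simp add: wt_def)
        qed (rule s)
        then have rate: "0 < rate N p \<xi> t" by (simp add: tconst_eq_rate[OF t])
        \<comment> \<open>The exceptional null set is fixed here, before any geodesic is
          chosen.\<close>
        define good where "good \<omega> \<longleftrightarrow> (\<forall>t'\<in>perturb N t. pos_weights N t' \<longrightarrow>
          ((\<lambda>r. ttime (wt N t') \<omega> 0 (lattice_point (r *\<^sub>R \<xi>)) / r) \<longlongrightarrow> rate N p \<xi> t') at_top)" for \<omega>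
        have AE: "AE \<tau> in fpp_space ?L. \<exists>\<omega>. good \<omega> \<and> (\<forall>e\<in>lattice_edges. \<tau> e = wt N t (\<omega> e))"
          using AE_direction_limits[OF \<xi>, of t] by (intro AE_decode t inj) (simp add: good_def)
        have along: "((\<lambda>i. ttime (wt N t') \<omega> y (x i) / norm (real_vec (x i) :: real ^ 'd)) \<longlongrightarrow> rate N p \<xi> t') F"
          if "good \<omega>" "t' \<in> perturb N t" "pos_weights N t'"
            "filterlim (\<lambda>i. norm (real_vec (x i) :: real ^ 'd)) at_top F"
            "((\<lambda>i. real_vec (x i) /\<^sub>R norm (real_vec (x i))) \<longlongrightarrow> \<xi>) F" for \<omega> t' y F and x :: "_ \<Rightarrow> 'd vertex"
          using that by (intro bounded_weight.ttime_along_direction[OF bounded_weight_wt]) (auto simp: good_def)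
        have emp: "AE \<tau> in fpp_space ?L. \<forall>\<gamma> :: real \<Rightarrow> 'd edge set. (\<forall>n>0. \<gamma> n \<in> Geo \<tau> 0 (n *\<^sub>R \<xi>)) \<longrightarrow>
            weak_conv_along (\<lambda>n. emp_pos \<tau> (\<gamma> n)) (emp_limit N t D) at_top"
          using AE
        proof eventually_elim
          case (elim \<tau>)
          then obtain \<omega> where w: "good \<omega>" "\<And>e. e \<in> lattice_edges \<Longrightarrow> \<tau> e = wt N t (\<omega> e)" by blast
          show ?case
          proof (intro allI impI)
            fix \<gamma> :: "real \<Rightarrow> 'd edge set" assume g: "\<forall>n>0. \<gamma> n \<in> Geo \<tau> 0 (n *\<^sub>R \<xi>)"
            let ?x = "\<lambda>n. lattice_point (n *\<^sub>R \<xi>)"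
            note dir = direction_lattice_point[OF \<xi>]
            show "weak_conv_along (\<lambda>n. emp_pos \<tau> (\<gamma> n)) (emp_limit N t D) at_top"
            proof (rule emp_converges[OF t D rate, where y = 0 and x = ?x and r = "\<lambda>n. norm (real_vec (?x n) :: real ^ 'd)"])
              show "\<forall>\<^sub>F n in at_top. 0 < norm (real_vec (?x n) :: real ^ 'd)"
                using dir(1) unfolding filterlim_at_top_dense by blast
              show "\<forall>\<^sub>F n in at_top. \<gamma> n \<in> paths_between 0 (?x n) \<and> path_time \<tau> (\<gamma> n) = ptime \<tau> 0 (?x n)"
                using eventually_gt_at_top[of 0]
                by eventually_elim (use g in \<open>auto simp: Geo_def paths_def passage_time_eq\<close>)
            qed (use w along[OF w(1) _ _ dir] in auto)
          qed
        qed
        have emp_inf: "AE \<tau> in fpp_space ?L. \<forall>\<Gamma>\<in>Geo_inf \<tau> \<xi>.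
            weak_conv_along (\<lambda>l. emp_pos \<tau> (initial_segment \<Gamma> l)) (emp_limit N t D) sequentially"
          using AE
        proof eventually_elim
          case (elim \<tau>)
          then obtain \<omega> where w: "good \<omega>" "\<And>e. e \<in> lattice_edges \<Longrightarrow> \<tau> e = wt N t (\<omega> e)" by blast
          show ?case
          proof
            fix \<Gamma> assume G: "\<Gamma> \<in> Geo_inf \<tau> \<xi>"
            then have top: "filterlim (\<lambda>l. norm (real_vec (\<Gamma> l) :: real ^ 'd)) at_top sequentially"
              and dir: "((\<lambda>l. real_vec (\<Gamma> l) /\<^sub>R norm (real_vec (\<Gamma> l))) \<longlongrightarrow> \<xi>) sequentially"
              by (auto simp: Geo_inf_def infinite_geodesic_def intro: inj_vertices_to_infinity)
            show "weak_conv_along (\<lambda>l. emp_pos \<tau> (initial_segment \<Gamma> l)) (emp_limit N t D) sequentially"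
            proof (rule emp_converges[OF t D rate, where y = "\<Gamma> 0" and x = \<Gamma> and r = "\<lambda>l. norm (real_vec (\<Gamma> l) :: real ^ 'd)"])
              show "\<forall>\<^sub>F l in sequentially. 0 < norm (real_vec (\<Gamma> l) :: real ^ 'd)"
                using top unfolding filterlim_at_top_dense by blast
              show "\<forall>\<^sub>F l in sequentially. initial_segment \<Gamma> l \<in> paths_between (\<Gamma> 0) (\<Gamma> l) \<and>
                  path_time \<tau> (initial_segment \<Gamma> l) = ptime \<tau> (\<Gamma> 0) (\<Gamma> l)"
                using G by (intro always_eventually allI)
                  (auto simp: Geo_inf_def infinite_geodesic_def Geo_def paths_def passage_time_eq)
            qed (use w along[OF w(1) _ _ top dir] in auto)
          qed
        qed
        have "cdf ?L 0 < critical_prob TYPE('d)" using False by (simp add: cdf_law_0[OF t])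
        then show ?thesis
          using L emp emp_inf emp_limit_nonneg_laws[OF t, of D] unfolding P_emp_def P_emp_inf_def by blast
      qed
    qed
  qed
qed

end
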